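(* Let $(R,\mathfrak{m})$ be a quasi-unmixed local ring with infinite residue field and $\dim R\geq 1$. Let $I$ be an equimultiple ideal of $R$ with analytic spread $s=s(I)$, and suppose that $I$ contains a regular element (a nonzerodivisor of $R$). Then $I_s=(I^{*})^{u}$. In particular, $I_s$ is an unmixed ideal.
   Context: Rings are commutative and Noetherian. A local ring $(R,\mathfrak m)$ is quasi-unmixed if its completion is equidimensional. The analytic spread of a proper ideal $I$ is $s(I)=\dim\bigoplus_{n\ge0}I^n/\mathfrak mI^n$, and $I$ is equimultiple if $\mathrm{ht}(I)=s(I)$. $\mathrm{Min}(R/I)$ is the set of minimal primes over $I$; for $I$ equimultiple, every $\mathfrak p\in\mathrm{Min}(R/I)$ satisfies $\dim R_{\mathfrak p}=s$, and $I_{\mathfrak p}=IR_{\mathfrak p}$ is primary to the maximal ideal of $R_{\mathfrak p}$. For an ideal $Q$ primary to the maximal ideal of a local ring $A$ of dimension $s$, the Hilbert coefficients $e_i(Q)$, $0\le i\le s$, are the integers with $\ell(A/Q^n)=\sum_{i=0}^s(-1)^ie_i(Q)\binom{n+s-i-1}{s-i}$ for all large $n$. For $1\le k\le s$, the $k$-th equimultiple coefficient ideal $I_k$ is the unique largest ideal $L\supseteq I$ such that $e_i(I_{\mathfrak p})=e_i(L_{\mathfrak p})$ for all $0\le i\le k$ and all $\mathfrak p\in\mathrm{Min}(R/I)$ (in particular $L_{\mathfrak p}$ is proper). $I^{*}=\bigcup_{n\ge1}(I^{n+1}:I^n)$ is the Ratliff-Rush closure of $I$. For an ideal $J$, $J^u$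 denotes the unmixed part of $J$: the intersection of the primary components of $J$ belonging to the minimal primes of $J$; $J$ is unmixed if $J=J^u$, i.e. $R/J$ has no embedded associated primes. *)

theory Defs
  imports "HOL-Algebra.Algebra" "HOL-Library.Extended_Nat"
begin

section \<open>Dimension, height and minimal primes\<close>

definition chain_length :: "'a set set \<Rightarrow> enat" where
  "chain_length \<F> =
     Sup {enat n | n. \<exists>C :: nat \<Rightarrow> 'a set. (\<forall>i\<le>n. C i \<in> \<F>) \<and> (\<forall>i<n. C i \<subset> C (Suc i))}"

definition krull_dim :: "('a, 'b) ring_scheme \<Rightarrow> enat" where
  "krull_dim R = chain_length {P. primeideal P R}"

definition prime_height :: "('a, 'b) ring_scheme \<Rightarrow> 'a set \<Rightarrow> enat" where
  "prime_height R P = chain_length {Q. primeideal Q R \<and> Q \<subseteq> P}"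

definition ideal_height :: "('a, 'b) ring_scheme \<Rightarrow> 'a set \<Rightarrow> enat" where
  "ideal_height R I = Inf (prime_height R ` {P. primeideal P R \<and> I \<subseteq> P})"

definition min_primes :: "('a, 'b) ring_scheme \<Rightarrow> 'a set \<Rightarrow> 'a set set" where
  "min_primes R I = {P. primeideal P R \<and> I \<subseteq> P \<and>
     (\<forall>Q. primeideal Q R \<and> I \<subseteq> Q \<and> Q \<subseteq> P \<longrightarrow> Q = P)}"

definition equidimensional :: "('a, 'b) ring_scheme \<Rightarrow> bool" where
  "equidimensional R \<longleftrightarrow>
     (\<forall>P \<in> min_primes R {\<zero>\<^bsub>R\<^esub>}. krull_dim (R Quot P) = krull_dim R)"

definition regular_element :: "('a, 'b) ring_scheme \<Rightarrow> 'a \<Rightarrow> bool" where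
  "regular_element R a \<longleftrightarrow> a \<in> carrier R \<and>
     (\<forall>x \<in> carrier R. a \<otimes>\<^bsub>R\<^esub> x = \<zero>\<^bsub>R\<^esub> \<longrightarrow> x = \<zero>\<^bsub>R\<^esub>)"


section \<open>Noetherian local rings and their completions\<close>

locale noetherian_local_ring = cring R + noetherian_ring R
  for R :: "('a, 'b) ring_scheme" (structure) +
  fixes \<mm> :: "'a set"
  assumes maximalideal_mm: "maximalideal \<mm> R"
    and unique_maximalideal: "maximalideal M R \<Longrightarrow> M = \<mm>"

text \<open>The zeroth power of an ideal is the whole ring.\<close>

abbreviation ideal_power :: "('a, 'b) ring_scheme \<Rightarrow> 'a set \<Rightarrow> nat \<Rightarrow> 'a set" where
  "ideal_power R I n \<equiv> I [^]\<^bsub>ideals_set R\<^esub> n"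

text \<open>
  The \<open>I\<close>-adic completion is the inverse limit of the rings \<open>R / I^n\<close>. The transition map
  sends the coset \<open>x + I^(n+1)\<close> to the only coset of \<open>I^n\<close> containing it, so compatibility of a
  family of cosets amounts to its being decreasing.
\<close>

definition completion :: "('a, 'b) ring_scheme \<Rightarrow> 'a set \<Rightarrow> (nat \<Rightarrow> 'a set) ring" where
  "completion R I = \<lparr>
     carrier = {f. (\<forall>n. f n \<in> carrier (R Quot ideal_power R I n)) \<and> (\<forall>n. f (Suc n) \<subseteq> f n)},
     monoid.mult = (\<lambda>f g n. f n \<otimes>\<^bsub>R Quot ideal_power R I n\<^esub> g n),
     one = (\<lambda>n. \<one>\<^bsub>R Quot ideal_power R I n\<^esub>),
     ring.zero = (\<lambda>n. \<zero>\<^bsub>R Quot ideal_power R I n\<^esub>),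
     ring.add = (\<lambda>f g n. f n \<oplus>\<^bsub>R Quot ideal_power R I n\<^esub> g n)\<rparr>"

definition quasi_unmixed :: "('a, 'b) ring_scheme \<Rightarrow> 'a set \<Rightarrow> bool" where
  "quasi_unmixed R \<mm> \<longleftrightarrow> equidimensional (completion R \<mm>)"


section \<open>Analytic spread\<close>

text \<open>
  The ring \<open>\<Oplus>n. I^n / \<mm> I^n\<close>. An element of degree \<open>n\<close> is a coset of \<open>\<mm> I^n\<close> in \<open>R\<close> contained in
  \<open>I^n\<close>. The product of \<open>x + \<mm> I^i\<close> and \<open>y + \<mm> I^j\<close> is \<open>xy + \<mm> I^(i+j)\<close>, which \<^const>\<open>rcoset_mult\<close>
  computes when its modulus is \<open>\<mm> I^(i+j)\<close>; the summation takes place in \<open>R / \<mm> I^n\<close>.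
\<close>

definition fiber_cone :: "('a, 'b) ring_scheme \<Rightarrow> 'a set \<Rightarrow> 'a set \<Rightarrow> (nat \<Rightarrow> 'a set) ring" where
  "fiber_cone R \<mm> I = (let J = (\<lambda>n. ideal_prod R \<mm> (ideal_power R I n)) in \<lparr>
     carrier = {f. (\<forall>n. f n \<in> carrier (R Quot J n) \<and> f n \<subseteq> ideal_power R I n) \<and>
                   finite {n. f n \<noteq> \<zero>\<^bsub>R Quot J n\<^esub>}},
     monoid.mult = (\<lambda>f g n. finsum (R Quot J n) (\<lambda>i. rcoset_mult R (J n) (f i) (g (n - i))) {..n}),
     one = (\<lambda>n. if n = 0 then \<one>\<^bsub>R Quot J 0\<^esub> else \<zero>\<^bsub>R Quot J n\<^esub>),
     ring.zero = (\<lambda>n. \<zero>\<^bsub>R Quot J n\<^esub>),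
     ring.add = (\<lambda>f g n. f n \<oplus>\<^bsub>R Quot J n\<^esub> g n)\<rparr>)"

definition analytic_spread :: "('a, 'b) ring_scheme \<Rightarrow> 'a set \<Rightarrow> 'a set \<Rightarrow> enat" where
  "analytic_spread R \<mm> I = krull_dim (fiber_cone R \<mm> I)"

definition equimultiple :: "('a, 'b) ring_scheme \<Rightarrow> 'a set \<Rightarrow> 'a set \<Rightarrow> bool" where
  "equimultiple R \<mm> I \<longleftrightarrow>
     ideal I R \<and> I \<noteq> carrier R \<and> ideal_height R I = analytic_spread R \<mm> I"


section \<open>Localization\<close>

definition loc_rel :: "('a, 'b) ring_scheme \<Rightarrow> 'a set \<Rightarrow> (('a \<times> 'a) \<times> ('a \<times> 'a)) set" where
  "loc_rel R S = {((a, s), (b, t)). a \<in> carrier R \<and> b \<in> carrier R \<and> s \<in> S \<and> t \<in> S \<and>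
     (\<exists>u \<in> S. u \<otimes>\<^bsub>R\<^esub> (a \<otimes>\<^bsub>R\<^esub> t) = u \<otimes>\<^bsub>R\<^esub> (b \<otimes>\<^bsub>R\<^esub> s))}"

definition loc_frac :: "('a, 'b) ring_scheme \<Rightarrow> 'a set \<Rightarrow> 'a \<Rightarrow> 'a \<Rightarrow> ('a \<times> 'a) set" where
  "loc_frac R S a s = loc_rel R S `` {(a, s)}"

definition localization :: "('a, 'b) ring_scheme \<Rightarrow> 'a set \<Rightarrow> ('a \<times> 'a) set ring" where
  "localization R S = \<lparr>
     carrier = {loc_frac R S a s | a s. a \<in> carrier R \<and> s \<in> S},
     monoid.mult = (\<lambda>A B. \<Union>(a, s)\<in>A. \<Union>(b, t)\<in>B. loc_frac R S (a \<otimes>\<^bsub>R\<^esub> b) (s \<otimes>\<^bsub>R\<^esub> t)),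
     one = loc_frac R S \<one>\<^bsub>R\<^esub> \<one>\<^bsub>R\<^esub>,
     ring.zero = loc_frac R S \<zero>\<^bsub>R\<^esub> \<one>\<^bsub>R\<^esub>,
     ring.add = (\<lambda>A B. \<Union>(a, s)\<in>A. \<Union>(b, t)\<in>B.
              loc_frac R S (a \<otimes>\<^bsub>R\<^esub> t \<oplus>\<^bsub>R\<^esub> b \<otimes>\<^bsub>R\<^esub> s) (s \<otimes>\<^bsub>R\<^esub> t))\<rparr>"

definition local_at :: "('a, 'b) ring_scheme \<Rightarrow> 'a set \<Rightarrow> ('a \<times> 'a) set ring" where
  "local_at R P = localization R (carrier R - P)"

definition extend_at :: "('a, 'b) ring_scheme \<Rightarrow> 'a set \<Rightarrow> 'a set \<Rightarrow> ('a \<times> 'a) set set" where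
  "extend_at R P I = Idl\<^bsub>local_at R P\<^esub> ((\<lambda>a. loc_frac R (carrier R - P) a \<one>\<^bsub>R\<^esub>) ` I)"


section \<open>Hilbert coefficients\<close>

definition module_length :: "('a, 'b) ring_scheme \<Rightarrow> ('a, 'c, 'd) module_scheme \<Rightarrow> enat" where
  "module_length R M = chain_length {N. submodule N R M}"

definition quot_module :: "('a, 'b) ring_scheme \<Rightarrow> 'a set \<Rightarrow> ('a, 'a set) module" where
  "quot_module R J = ring.extend (R Quot J)
     \<lparr>smult = (\<lambda>a A. (J +>\<^bsub>R\<^esub> a) \<otimes>\<^bsub>R Quot J\<^esub> A)\<rparr>"

text \<open>
  The clause \<open>e i = 0\<close> for \<open>i\<close> beyond the dimension only serves to make the sequence of
  coefficients unique.
\<close>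

definition hilbert_coeff :: "('a, 'b) ring_scheme \<Rightarrow> 'a set \<Rightarrow> nat \<Rightarrow> int" where
  "hilbert_coeff A Q = (THE e. let s = the_enat (krull_dim A) in
     (\<forall>i>s. e i = 0) \<and>
     (\<forall>\<^sub>F n in sequentially. \<exists>l.
        module_length A (quot_module A (ideal_power A Q n)) = enat l \<and>
        int l = (\<Sum>i\<le>s. (- 1) ^ i * e i * int ((n + s - i - 1) choose (s - i)))))"


section \<open>Coefficient ideals and the Ratliff--Rush closure\<close>

definition same_coeffs :: "('a, 'b) ring_scheme \<Rightarrow> 'a set \<Rightarrow> nat \<Rightarrow> 'a set \<Rightarrow> bool" where
  "same_coeffs R I k L \<longleftrightarrow> ideal L R \<and> I \<subseteq> L \<and>
     (\<forall>P \<in> min_primes R I.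
        extend_at R P L \<noteq> carrier (local_at R P) \<and>
        (\<forall>i\<le>k. hilbert_coeff (local_at R P) (extend_at R P I) i
              = hilbert_coeff (local_at R P) (extend_at R P L) i))"

definition coeff_ideal :: "('a, 'b) ring_scheme \<Rightarrow> 'a set \<Rightarrow> nat \<Rightarrow> 'a set" where
  "coeff_ideal R I k =
     (THE L. same_coeffs R I k L \<and> (\<forall>L'. same_coeffs R I k L' \<longrightarrow> L' \<subseteq> L))"

definition ideal_colon :: "('a, 'b) ring_scheme \<Rightarrow> 'a set \<Rightarrow> 'a set \<Rightarrow> 'a set" where
  "ideal_colon R I J = {x \<in> carrier R. \<forall>y \<in> J. x \<otimes>\<^bsub>R\<^esub> y \<in> I}"

definition ratliff_rush :: "('a, 'b) ring_scheme \<Rightarrow> 'a set \<Rightarrow> 'a set" where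
  "ratliff_rush R I = (\<Union>n\<in>{1..}. ideal_colon R (ideal_power R I (n + 1)) (ideal_power R I n))"


section \<open>Primary decomposition and unmixed parts\<close>

definition radical :: "('a, 'b) ring_scheme \<Rightarrow> 'a set \<Rightarrow> 'a set" where
  "radical R I = {x \<in> carrier R. \<exists>n::nat. x [^]\<^bsub>R\<^esub> n \<in> I}"

definition primary_ideal :: "('a, 'b) ring_scheme \<Rightarrow> 'a set \<Rightarrow> bool" where
  "primary_ideal R Q \<longleftrightarrow> ideal Q R \<and> Q \<noteq> carrier R \<and>
     (\<forall>a \<in> carrier R. \<forall>b \<in> carrier R. a \<otimes>\<^bsub>R\<^esub> b \<in> Q \<longrightarrow> a \<in> Q \<or> b \<in> radical R Q)"

text \<open>
  Minimal primary decompositions. The intersections are taken inside \<^term>\<open>carrier R\<close>, so that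
  the empty family decomposes the unit ideal.
\<close>

definition primary_decomposition :: "('a, 'b) ring_scheme \<Rightarrow> 'a set \<Rightarrow> 'a set set \<Rightarrow> bool" where
  "primary_decomposition R J \<Q> \<longleftrightarrow>
     finite \<Q> \<and> (\<forall>Q \<in> \<Q>. primary_ideal R Q) \<and> J = carrier R \<inter> \<Inter>\<Q> \<and>
     inj_on (radical R) \<Q> \<and> (\<forall>Q \<in> \<Q>. \<not> carrier R \<inter> \<Inter>(\<Q> - {Q}) \<subseteq> Q)"

text \<open>
  The primary component of \<open>J\<close> belonging to \<open>P\<close>; it does not depend on the decomposition when
  \<open>P\<close> is a minimal prime of \<open>J\<close>.
\<close>

definition primary_component :: "('a, 'b) ring_scheme \<Rightarrow> 'a set \<Rightarrow> 'a set \<Rightarrow> 'a set" where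
  "primary_component R J P =
     (THE Q. \<exists>\<Q>. primary_decomposition R J \<Q> \<and> Q \<in> \<Q> \<and> radical R Q = P)"

definition unmixed_part :: "('a, 'b) ring_scheme \<Rightarrow> 'a set \<Rightarrow> 'a set" where
  "unmixed_part R J = carrier R \<inter> (\<Inter>P \<in> min_primes R J. primary_component R J P)"

definition unmixed_ideal :: "('a, 'b) ring_scheme \<Rightarrow> 'a set \<Rightarrow> bool" where
  "unmixed_ideal R J \<longleftrightarrow> ideal J R \<and> J = unmixed_part R J"

end

theory Submission
  imports Defs
begin

text \<open>
  At a minimal prime \<open>P\<close> of \<open>I\<close>, Hilbert polynomials of \<open>I_P \<subseteq> L_P\<close> agree if and only if \<open>I_P^n = L_P^n\<close> for
  large \<open>n\<close>, which means that \<open>L_P\<close> lies between \<open>I_P\<close> and its Ratliff--Rush closure; gluing over the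
  minimal primes gives the unmixed part of \<open>I^*\<close>. What is to be shown is that the coefficients \<open>e_0, \<dots>, e_s\<close>
  determine the whole polynomial, that is, \<open>dim R_P = s\<close>. Since the residue field is infinite, \<open>s\<close>
  generic elements of \<open>I\<close> generate an ideal containing a power of \<open>I\<close>, so \<open>dim R_P \<le> s\<close>, and equality
  follows from \<open>ht I = s\<close>.

  The Rees algebra and its graded modules are replaced by sequences of ideals of \<open>R\<close>, the homogeneous
  components. Lengths are suprema of lengths of chains of ideals; they are additive by the modular law.
\<close>

text \<open>Why generic elements x_1, ..., x_s of I generate an ideal containing a power of I: a
  homogeneous prime over \<mm> and these elements that omits part of I would be the top of a chain
  of length s of homogeneous primes, and the irrelevant ideal would prolong this chain beyond the
  analytic spread. So all such primes contain I, whence I^N \<subseteq> \<mm> I^N + (x_1, ..., x_s)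
  for some N, and Nakayama's lemma removes \<mm> I^N.

  Why s elements bound dim R_P: the Hilbert-Samuel function has degree at most the number of
  generators and at least the length of any chain of primes.

  The regular element enters when K = I^* is compared with I: it allows division, so that K^n = I^n
  for large n.

  One finiteness fact serves everywhere, a basis theorem for graded submodules. It yields the
  Artin-Rees lemma, the finiteness needed for the Hilbert-Serre theorem, the chain condition for
  homogeneous ideals, and the stability of the powers of K.\<close>

no_notation Sum_Type.Plus (infixr \<open><+>\<close> 65)

lemmas [simp del] = nat_pow_0 nat_pow_Suc

section \<open>Sums, products and powers of ideals\<close>

lemma (in ring)
  assumes "ideal I R"
  shows idl_zero: "\<zero> \<in> I"
    and idl_carr: "x \<in> I \<Longrightarrow> x \<in> carrier R"
    and idl_sub: "I \<subseteq> carrier R"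
    and idl_add: "x \<in> I \<Longrightarrow> y \<in> I \<Longrightarrow> x \<oplus> y \<in> I"
    and idl_neg: "x \<in> I \<Longrightarrow> \<ominus> x \<in> I"
    and idl_minus: "x \<in> I \<Longrightarrow> y \<in> I \<Longrightarrow> x \<ominus> y \<in> I"
    and idl_l: "x \<in> I \<Longrightarrow> a \<in> carrier R \<Longrightarrow> a \<otimes> x \<in> I"
    and idl_r: "x \<in> I \<Longrightarrow> a \<in> carrier R \<Longrightarrow> x \<otimes> a \<in> I"
proof -
  interpret I: ideal I R by fact
  show "\<zero> \<in> I" "x \<in> I \<Longrightarrow> x \<in> carrier R" "I \<subseteq> carrier R"
    "x \<in> I \<Longrightarrow> y \<in> I \<Longrightarrow> x \<oplus> y \<in> I" "x \<in> I \<Longrightarrow> \<ominus> x \<in> I"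
    "x \<in> I \<Longrightarrow> y \<in> I \<Longrightarrow> x \<ominus> y \<in> I" "x \<in> I \<Longrightarrow> a \<in> carrier R \<Longrightarrow> a \<otimes> x \<in> I"
    "x \<in> I \<Longrightarrow> a \<in> carrier R \<Longrightarrow> x \<otimes> a \<in> I"
    using I.a_subset I.I_l_closed I.I_r_closed by (auto simp: a_minus_def)
qed

lemma (in cring) cring_idealI:
  assumes "I \<subseteq> carrier R" "\<zero> \<in> I"
    and "\<And>x y. x \<in> I \<Longrightarrow> y \<in> I \<Longrightarrow> x \<oplus> y \<in> I"
    and l: "\<And>a x. a \<in> carrier R \<Longrightarrow> x \<in> I \<Longrightarrow> a \<otimes> x \<in> I"
  shows "ideal I R"
proof (rule idealI[OF ring_axioms])
  show "subgroup I (add_monoid R)"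
  proof (rule subgroup.intro)
    fix x assume "x \<in> I"
    then have "(\<ominus> \<one>) \<otimes> x \<in> I" using l by simp
    with \<open>x \<in> I\<close> assms(1) show "inv\<^bsub>add_monoid R\<^esub> x \<in> I"
      using l_minus[of \<one> x] by (simp add: a_inv_def subset_iff)
  qed (use assms in auto)
next
  fix a x assume "a \<in> I" "x \<in> carrier R"
  then show "x \<otimes> a \<in> I" "a \<otimes> x \<in> I"
    using l assms(1) m_comm[of a x] by (auto simp: subset_iff)
qed

lemma (in ring) idl_add_cancel:
  assumes "ideal I R" "v \<in> I" "w \<in> carrier R" "v \<oplus> w \<in> I"
  shows "w \<in> I"
proof -
  have "v \<in> carrier R" using assms idl_carr by blast
  then have "w = (\<ominus> v) \<oplus> (v \<oplus> w)" using assms(3) by algebra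
  then show ?thesis using idl_add[OF assms(1) idl_neg[OF assms(1,2)] assms(4)] by simp
qed

lemma set_add_mem: "x \<in> I <+>\<^bsub>R\<^esub> J \<longleftrightarrow> (\<exists>i\<in>I. \<exists>j\<in>J. x = i \<oplus>\<^bsub>R\<^esub> j)"
  by (auto simp: set_add_def')

context ring
begin

lemma set_add_l: assumes "ideal I R" "ideal J R" shows "I \<subseteq> I <+> J"
  unfolding set_add_mem subset_iff
  by (metis assms idl_carr idl_zero r_zero)

lemma set_add_r: assumes "ideal I R" "ideal J R" shows "J \<subseteq> I <+> J"
  unfolding set_add_mem subset_iff
  by (metis assms idl_carr idl_zero l_zero)

lemma set_add_least: assumes "ideal K R" "I \<subseteq> K" "J \<subseteq> K" shows "I <+> J \<subseteq> K"
  using assms(2,3) idl_add[OF assms(1)] by (force simp: set_add_mem)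

lemma set_add_mono: "I \<subseteq> I' \<Longrightarrow> J \<subseteq> J' \<Longrightarrow> I <+> J \<subseteq> I' <+> J'"
  by (fastforce simp: set_add_mem subset_iff)

lemma ideal_prod_least:
  assumes "ideal K R" "\<And>i j. i \<in> I \<Longrightarrow> j \<in> J \<Longrightarrow> i \<otimes> j \<in> K"
  shows "I \<cdot> J \<subseteq> K"
proof
  fix s assume "s \<in> I \<cdot> J" then show "s \<in> K"
    by induct (auto intro: assms idl_add[OF assms(1)])
qed

lemma ideal_prod_mono:
  assumes "I \<subseteq> I'" "J \<subseteq> J'" shows "I \<cdot> J \<subseteq> I' \<cdot> J'"
proof
  fix s assume "s \<in> I \<cdot> J" then show "s \<in> I' \<cdot> J'"
    by induct (use assms in \<open>auto intro: ideal_prod.intros\<close>)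
qed

lemma ideal_inter: "ideal I R \<Longrightarrow> ideal J R \<Longrightarrow> ideal (I \<inter> J) R"
  by (rule i_intersect)

end

lemma ideal_power_0: "ideal_power R I 0 = carrier R"
  by (simp add: nat_pow_def ideals_set_def)

lemma ideal_power_Suc: "ideal_power R I (Suc n) = ideal_prod R (ideal_power R I n) I"
  by (simp add: nat_pow_def ideals_set_def)

context cring
begin

lemma ideal_smult:
  assumes "ideal U R" "x \<in> carrier R" shows "ideal ((\<otimes>) x ` U) R"
proof (rule cring_idealI)
  show "(\<otimes>) x ` U \<subseteq> carrier R" using assms idl_sub by auto
  show "\<zero> \<in> (\<otimes>) x ` U" using assms idl_zero[OF assms(1)] by (force simp: image_iff)
next
  fix a b assume "a \<in> (\<otimes>) x ` U" "b \<in> (\<otimes>) x ` U"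
  then show "a \<oplus> b \<in> (\<otimes>) x ` U"
    using assms idl_add[OF assms(1)] idl_carr[OF assms(1)] by (auto simp: r_distr[symmetric])
next
  fix a b assume "a \<in> carrier R" "b \<in> (\<otimes>) x ` U"
  then obtain u where u: "u \<in> U" "b = x \<otimes> u" by auto
  then have "a \<otimes> b = x \<otimes> (a \<otimes> u)"
    using assms idl_carr[OF assms(1)] \<open>a \<in> carrier R\<close> by (simp add: m_lcomm)
  then show "a \<otimes> b \<in> (\<otimes>) x ` U"
    using u idl_l[OF assms(1) _ \<open>a \<in> carrier R\<close>] by auto
qed

lemma ideal_colon_elt:
  assumes "ideal U R" "ideal V R" "x \<in> carrier R"
  shows "ideal {u \<in> U. x \<otimes> u \<in> V} R"
  by (rule cring_idealI)
    (use assms in \<open>auto simp: idl_carr idl_zero idl_add idl_l r_distr m_lcomm\<close>)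

lemma ideal_power_ideal: "ideal I R \<Longrightarrow> ideal (ideal_power R I n) R"
  by (induct n) (simp_all add: ideal_power_0 ideal_power_Suc oneideal ideal_prod_is_ideal)

lemma ideal_power_1: "ideal I R \<Longrightarrow> ideal_power R I (Suc 0) = I"
  using ideal_prod_commute[OF oneideal, of I]
  by (simp add: ideal_power_0 ideal_power_Suc ideal_prod_one)

lemma ideal_power_add:
  assumes "ideal I R"
  shows "ideal_power R I (m + n) = ideal_power R I m \<cdot> ideal_power R I n"
proof (induct n)
  case 0
  then show ?case using assms by (simp add: ideal_power_0 ideal_prod_one ideal_power_ideal)
next
  case (Suc n)
  then show ?case
    using assms by (simp add: ideal_power_Suc ideal_prod_assoc ideal_power_ideal)
qed

lemma ideal_power_mult_mem:
  assumes "ideal I R" "a \<in> ideal_power R I m" "b \<in> ideal_power R I n"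
  shows "a \<otimes> b \<in> ideal_power R I (m + n)"
  by (simp add: assms ideal_power_add ideal_prod.prod)

lemma ideal_power_Suc_mem:
  assumes "ideal I R" "a \<in> I" "b \<in> ideal_power R I n"
  shows "a \<otimes> b \<in> ideal_power R I (Suc n)"
  using ideal_power_mult_mem[of I a 1 b n] assms by (simp add: ideal_power_1)

lemma ideal_power_Suc_subset: "ideal I R \<Longrightarrow> ideal_power R I (Suc n) \<subseteq> ideal_power R I n"
  by (metis ideal_power_Suc ideal_power_ideal ideal_prod_inter le_inf_iff)

lemma ideal_power_antimono:
  assumes "ideal I R" "m \<le> n" shows "ideal_power R I n \<subseteq> ideal_power R I m"
  using assms(2)
proof (induct n rule: dec_induct)
  case (step n)
  then show ?case using ideal_power_Suc_subset[OF assms(1)] by blast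
qed auto

lemma ideal_power_mono:
  "I \<subseteq> J \<Longrightarrow> ideal_power R I n \<subseteq> ideal_power R J n"
  by (induct n) (simp_all add: ideal_power_0 ideal_power_Suc ideal_prod_mono)

lemma ideal_power_mult:
  assumes "ideal I R"
  shows "ideal_power R (ideal_power R I m) n = ideal_power R I (m * n)"
  by (induct n) (simp_all add: ideal_power_0 ideal_power_Suc ideal_power_add assms
      ideal_prod_commute ideal_power_ideal)

text \<open>The elements \<open>y\<close> with \<open>y \<otimes> w \<in> T\<close> for all
  \<open>w\<close> in the \<open>n\<close>-th power form an ideal; containing the generators
  \<open>Z\<close>, it contains \<open>I\<close>. This is what makes the Rees algebra generated in
  degree 1.\<close>

lemma ideal_power_Suc_least:
  assumes "Z \<subseteq> carrier R" "I = Idl Z" "ideal T R"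
    and "\<And>x w. x \<in> Z \<Longrightarrow> w \<in> ideal_power R I n \<Longrightarrow> x \<otimes> w \<in> T"
  shows "ideal_power R I (Suc n) \<subseteq> T"
proof -
  let ?P = "ideal_power R I n"
  have I: "ideal I R" using assms genideal_ideal by simp
  note P = ideal_power_ideal[OF I, of n]
  let ?C = "{y \<in> carrier R. \<forall>w\<in>?P. y \<otimes> w \<in> T}"
  have "ideal ?C R"
    by (rule cring_idealI)
      (use assms(3) P in \<open>auto simp: idl_carr idl_zero idl_add idl_l l_distr m_assoc\<close>)
  then have "Idl Z \<subseteq> ?C" by (rule genideal_minimal) (use assms in auto)
  then have "I \<subseteq> ?C" using assms(2) by simp
  show ?thesis unfolding ideal_power_Suc
  proof (rule ideal_prod_least[OF assms(3)])
    fix i j assume "i \<in> ?P" "j \<in> I"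
    then show "i \<otimes> j \<in> T"
      using \<open>I \<subseteq> ?C\<close> m_comm[of i j] P by (auto simp: idl_carr)
  qed
qed

end

section \<open>Chain and maximality conditions\<close>

lemma (in noetherian_ring) ascending_ideals_stationary:
  assumes "\<And>n. ideal (C n) R" "\<And>n. C n \<subseteq> C (Suc n)"
  shows "\<exists>N. \<forall>n\<ge>N. C n = C N"
proof -
  have mono: "m \<le> n \<Longrightarrow> C m \<subseteq> C n" for m n by (rule lift_Suc_mono_le[of C]) (use assms in auto)
  have total: "C m \<subseteq> C n \<or> C n \<subseteq> C m" for m n
    using mono nat_le_linear by metis
  have "subset.chain {I. ideal I R} (range C)"
    unfolding pred_on.chain_def using assms(1) total by blast
  then have "\<Union>(range C) \<in> range C" by (intro ideal_chain_is_trivial) auto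
  then obtain N where "\<Union>(range C) = C N" by auto
  then show ?thesis using mono by blast
qed

lemma (in noetherian_ring) ideal_maximal_element:
  assumes "\<F> \<noteq> {}" "\<And>I. I \<in> \<F> \<Longrightarrow> ideal I R"
  obtains M where "M \<in> \<F>" "\<And>J. J \<in> \<F> \<Longrightarrow> \<not> M \<subset> J"
proof -
  have "\<exists>M\<in>\<F>. \<forall>J\<in>\<F>. \<not> M \<subset> J"
  proof (rule ccontr)
    assume neg: "\<not> ?thesis"
    then obtain g where g: "\<And>M. M \<in> \<F> \<Longrightarrow> g M \<in> \<F> \<and> M \<subset> g M" by metis
    obtain M0 where "M0 \<in> \<F>" using assms(1) by auto
    define C where "C = rec_nat M0 (\<lambda>_. g)"
    have C: "C n \<in> \<F>" for n by (induct n) (auto simp: C_def \<open>M0 \<in> \<F>\<close> g)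
    have st: "C n \<subset> C (Suc n)" for n using g[OF C[of n]] by (simp add: C_def)
    obtain N where "\<forall>n\<ge>N. C n = C N"
      using ascending_ideals_stationary[of C] assms(2) C st by blast
    then show False using st[of N] by (metis le_Suc_eq nle_le psubsetE)
  qed
  then show ?thesis using that by metis
qed

section \<open>Length of an interval of ideals\<close>

definition strict_chain :: "'a set set \<Rightarrow> nat \<Rightarrow> (nat \<Rightarrow> 'a set) \<Rightarrow> bool" where
  "strict_chain \<F> n C \<longleftrightarrow> (\<forall>i\<le>n. C i \<in> \<F>) \<and> (\<forall>i<n. C i \<subset> C (Suc i))"

lemma chain_length_altdef: "chain_length \<F> = Sup {enat n | n. \<exists>C. strict_chain \<F> n C}"
  by (simp add: chain_length_def strict_chain_def)

text \<open>A supremum of at least \<open>k\<close> is witnessed by a chain of length at least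
  \<open>k\<close>, which can be cut down to \<open>k\<close>. For empty \<open>\<F>\<close> the
  supremum is 0, although no chain of length 0 exists, as that has one member.\<close>

lemma chain_length_ge_iff:
  assumes "\<F> \<noteq> {}"
  shows "enat k \<le> chain_length \<F> \<longleftrightarrow> (\<exists>C. strict_chain \<F> k C)"
proof
  assume "enat k \<le> chain_length \<F>"
  show "\<exists>C. strict_chain \<F> k C"
  proof (cases k)
    case 0
    obtain Y where "Y \<in> \<F>" using assms by auto
    with 0 have "strict_chain \<F> k (\<lambda>_. Y)" by (simp add: strict_chain_def)
    then show ?thesis by blast
  next
    case (Suc k')
    then have "enat k' < chain_length \<F>" using \<open>enat k \<le> _\<close> by (cases "chain_length \<F>") auto
    then obtain n C where "k' < n" "strict_chain \<F> n C"
      unfolding chain_length_altdef less_Sup_iff by auto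
    then have "strict_chain \<F> k C" using Suc by (auto simp: strict_chain_def)
    then show ?thesis by auto
  qed
qed (auto simp: chain_length_altdef intro: Sup_upper)

lemma enat_leI: "(\<And>k. enat k \<le> x \<Longrightarrow> enat k \<le> y) \<Longrightarrow> x \<le> y"
proof (cases y)
  case (enat m)
  assume le: "\<And>k. enat k \<le> x \<Longrightarrow> enat k \<le> y"
  show ?thesis
  proof (rule ccontr)
    assume "\<not> x \<le> y"
    then have "enat (Suc m) \<le> x" using enat by (cases x) auto
    then show False using le enat by fastforce
  qed
qed simp

lemma chain_length_mono:
  assumes "\<And>Z. Z \<in> \<F> \<Longrightarrow> f Z \<in> \<G>" "\<And>Z Y. Z \<in> \<F> \<Longrightarrow> Y \<in> \<F> \<Longrightarrow> Z \<subset> Y \<Longrightarrow> f Z \<subset> f Y"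
  shows "chain_length \<F> \<le> chain_length \<G>"
  unfolding chain_length_altdef
proof (rule Sup_subset_mono, safe)
  fix n C assume "strict_chain \<F> n C"
  then have "strict_chain \<G> n (f \<circ> C)" using assms by (auto simp: strict_chain_def)
  then show "\<exists>na. enat n = enat na \<and> (\<exists>C. strict_chain \<G> na C)" by blast
qed


text \<open>Repetitions are deleted from a weak chain. Recording the last member \<open>D k\<close>
  lets the induction append the next one.\<close>

lemma weak_chain_strict:
  assumes "\<And>i. i \<le> k \<Longrightarrow> D i \<in> \<F>" "\<And>i. i < k \<Longrightarrow> D i \<subseteq> D (Suc i)"
  shows "\<exists>E. strict_chain \<F> (card {i. i < k \<and> D i \<noteq> D (Suc i)}) E \<and>
    E (card {i. i < k \<and> D i \<noteq> D (Suc i)}) = D k"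
  using assms
proof (induct k)
  case 0
  then show ?case by (intro exI[of _ D]) (simp add: strict_chain_def)
next
  case (Suc k)
  let ?S = "\<lambda>k. {i. i < k \<and> D i \<noteq> D (Suc i)}"
  have "\<exists>E. strict_chain \<F> (card (?S k)) E \<and> E (card (?S k)) = D k"
    by (rule Suc.hyps) (use Suc.prems in auto)
  then obtain E where E: "strict_chain \<F> (card (?S k)) E" "E (card (?S k)) = D k"
    by blast
  show ?case
  proof (cases "D k = D (Suc k)")
    case True
    then have "?S (Suc k) = ?S k" by (auto simp: less_Suc_eq)
    then show ?thesis using E True by auto
  next
    case False
    then have "?S (Suc k) = insert k (?S k)" by (auto simp: less_Suc_eq)
    then have c: "card (?S (Suc k)) = Suc (card (?S k))" by simp
    have "strict_chain \<F> (Suc (card (?S k))) (E(Suc (card (?S k)) := D (Suc k)))"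
      using E False Suc.prems by (auto simp: strict_chain_def less_Suc_eq le_Suc_eq)
    then show ?thesis unfolding c by (metis (no_types, lifting) fun_upd_same)
  qed
qed

definition ideals_between :: "('a, 'b) ring_scheme \<Rightarrow> 'a set \<Rightarrow> 'a set \<Rightarrow> 'a set set" where
  "ideals_between R V U = {W. ideal W R \<and> V \<subseteq> W \<and> W \<subseteq> U}"

text \<open>The length of the module \<open>U / V\<close>: its submodules correspond to the ideals
  between \<open>V\<close> and \<open>U\<close>, so that no quotient has to be formed.\<close>

definition ilen :: "('a, 'b) ring_scheme \<Rightarrow> 'a set \<Rightarrow> 'a set \<Rightarrow> enat" where
  "ilen R V U = chain_length (ideals_between R V U)"

context cring
begin

text \<open>The modular law. Its use: a strict step of a chain stays strict after intersecting with
  \<open>U\<close> or after adding \<open>U\<close>.\<close>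

lemma modular_strict:
  assumes "ideal Z R" "ideal Y R" "ideal U R" "Z \<subseteq> Y" "Z \<inter> U = Y \<inter> U" "Z <+> U = Y <+> U"
  shows "Z = Y"
proof
  show "Y \<subseteq> Z"
  proof
    fix y assume y: "y \<in> Y"
    then have "y \<in> Z <+> U" using set_add_l[OF assms(2,3)] assms(6) by auto
    then obtain x u where xu: "x \<in> Z" "u \<in> U" "y = x \<oplus> u" by (auto simp: set_add_mem)
    have c: "x \<in> carrier R" "u \<in> carrier R" "y \<in> carrier R"
      using xu y assms(1,2,3) by (auto intro: idl_carr)
    have "u \<in> Y"
      by (rule idl_add_cancel[of Y x]) (use y xu c assms in auto)
    then have "u \<in> Z" using xu assms(5) by blast
    then show "y \<in> Z" using xu assms(1) by (auto intro: idl_add)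
  qed
qed fact

lemma ilen_add:
  assumes "ideal V R" "ideal U R" "ideal T R" "V \<subseteq> U" "U \<subseteq> T"
  shows "ilen R V T = ilen R V U + ilen R U T"
proof (rule antisym)
  have ne: "ideals_between R V U \<noteq> {}" "ideals_between R U T \<noteq> {}" "ideals_between R V T \<noteq> {}"
    using assms by (auto simp: ideals_between_def)
  show "ilen R V T \<le> ilen R V U + ilen R U T"
  proof (rule enat_leI)
    fix k assume "enat k \<le> ilen R V T"
    then obtain C where C: "strict_chain (ideals_between R V T) k C"
      using ne by (auto simp: ilen_def chain_length_ge_iff)
    have Ci: "ideal (C i) R" "V \<subseteq> C i" "C i \<subseteq> T" if "i \<le> k" for i
      using C that by (auto simp: strict_chain_def ideals_between_def)
    have Cs: "C i \<subset> C (Suc i)" if "i < k" for i using C that by (auto simp: strict_chain_def)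
    let ?D = "\<lambda>i. C i \<inter> U" and ?E = "\<lambda>i. C i <+> U"
    let ?S = "{i. i < k \<and> ?D i \<noteq> ?D (Suc i)}" and ?S' = "{i. i < k \<and> ?E i \<noteq> ?E (Suc i)}"
    have "\<exists>E. strict_chain (ideals_between R V U) (card ?S) E \<and> E (card ?S) = ?D k"
    proof (rule weak_chain_strict)
      fix i assume "i \<le> k" then show "C i \<inter> U \<in> ideals_between R V U"
        using Ci[of i] assms by (auto simp: ideals_between_def intro: ideal_inter)
    next
      fix i assume "i < k" then show "C i \<inter> U \<subseteq> C (Suc i) \<inter> U" using Cs[of i] by auto
    qed
    then have 1: "enat (card ?S) \<le> ilen R V U"
      using ne by (auto simp: ilen_def chain_length_ge_iff)
    have "\<exists>E. strict_chain (ideals_between R U T) (card ?S') E \<and> E (card ?S') = ?E k"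
    proof (rule weak_chain_strict)
      fix i assume "i \<le> k" then show "C i <+> U \<in> ideals_between R U T"
        using Ci[of i] assms add_ideals set_add_r set_add_least[of T "C i" U]
        by (auto simp: ideals_between_def)
    next
      fix i assume "i < k" then show "C i <+> U \<subseteq> C (Suc i) <+> U"
        using Cs[of i] by (intro set_add_mono) auto
    qed
    then have 2: "enat (card ?S') \<le> ilen R U T"
      using ne by (auto simp: ilen_def chain_length_ge_iff)
    have "{..<k} \<subseteq> ?S \<union> ?S'"
    proof
      fix i assume "i \<in> {..<k}"
      then show "i \<in> ?S \<union> ?S'"
        using modular_strict[of "C i" "C (Suc i)" U] Ci[of i] Ci[of "Suc i"] Cs[of i] assms(2)
        by auto
    qed
    then have "card {..<k} \<le> card (?S \<union> ?S')" by (intro card_mono) auto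
    also have "\<dots> \<le> card ?S + card ?S'" by (rule card_Un_le)
    finally have "enat k \<le> enat (card ?S) + enat (card ?S')" by simp
    also have "\<dots> \<le> ilen R V U + ilen R U T" using 1 2 by (rule add_mono)
    finally show "enat k \<le> ilen R V U + ilen R U T" .
  qed
  show "ilen R V U + ilen R U T \<le> ilen R V T"
  proof (rule enat_leI)
    fix k assume k: "enat k \<le> ilen R V U + ilen R U T"
    \<comment> \<open>Lengths may be infinite, so \<open>k\<close> is split by cases: either it fits
      below the first length, or that length is finite and the second takes the rest.\<close>
    have "\<exists>a b. k = a + b \<and> enat a \<le> ilen R V U \<and> enat b \<le> ilen R U T"
    proof (cases "enat k \<le> ilen R V U")
      case True
      then show ?thesis by (intro exI[of _ k] exI[of _ 0]) (auto simp: zero_enat_def[symmetric])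
    next
      case False
      then obtain a where a: "ilen R V U = enat a" "a < k" by (cases "ilen R V U") auto
      then have "enat (k - a) \<le> ilen R U T" using k by (cases "ilen R U T") auto
      then show ?thesis using a by (intro exI[of _ a] exI[of _ "k - a"]) auto
    qed
    then obtain a b where ab: "k = a + b" "enat a \<le> ilen R V U" "enat b \<le> ilen R U T" by blast
    then obtain C D where C: "strict_chain (ideals_between R V U) a C"
      and D: "strict_chain (ideals_between R U T) b D"
      using ne by (auto simp: ilen_def chain_length_ge_iff)
    \<comment> \<open>The member \<open>D 0\<close> is dropped; since
      \<open>C a \<subseteq> U \<subseteq> D 0 \<subset> D 1\<close>, the step at the junction
      remains strict.\<close>
    let ?E = "\<lambda>i. if i \<le> a then C i else D (i - a)"
    have "strict_chain (ideals_between R V T) k ?E"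
      unfolding strict_chain_def
    proof (intro conjI allI impI)
      fix i assume "i \<le> k" then show "?E i \<in> ideals_between R V T"
        using C D ab assms(4,5) le_diff_conv[of i a b] unfolding strict_chain_def ideals_between_def
        by (cases "i \<le> a") (auto simp: add.commute subset_iff)
    next
      fix i assume i: "i < k"
      consider "i < a" | "i = a" | "i > a" by linarith
      then show "?E i \<subset> ?E (Suc i)"
      proof cases
        case 2
        then have "0 < b" using i ab by simp
        then have "C i \<subseteq> U" "U \<subseteq> D 0" "D 0 \<subset> D (Suc 0)"
          using C D 2 by (auto simp: strict_chain_def ideals_between_def)
        then show ?thesis using 2 by auto
      next
        case 3
        then show ?thesis using D i ab by (auto simp: strict_chain_def Suc_diff_le)
      qed (use C in \<open>auto simp: strict_chain_def\<close>)
    qed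
    then show "enat k \<le> ilen R V T"
      using ne by (auto simp: ilen_def chain_length_ge_iff)
  qed
qed

text \<open>Multiplication by \<open>x\<close> maps \<open>U\<close> onto
  \<open>(V + xU) / V\<close> with kernel \<open>?N\<close>. Of this isomorphism only the two
  induced maps on ideals are used, \<open>W \<mapsto> V + xW\<close> and the preimage; both are
  strictly monotone.\<close>

lemma ilen_iso:
  assumes V: "ideal V R" and U: "ideal U R" and x: "x \<in> carrier R"
  shows "ilen R {u \<in> U. x \<otimes> u \<in> V} U = ilen R V (V <+> (\<otimes>) x ` U)" (is "ilen R ?N U = _")
proof (rule antisym)
  note xU = ideal_smult[OF U x]
  show "ilen R ?N U \<le> ilen R V (V <+> (\<otimes>) x ` U)"
    unfolding ilen_def
  proof (rule chain_length_mono[where f = "\<lambda>W. V <+> (\<otimes>) x ` W"])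
    fix W assume W: "W \<in> ideals_between R ?N U"
    then show "V <+> (\<otimes>) x ` W \<in> ideals_between R V (V <+> (\<otimes>) x ` U)"
      using V x W set_add_l[OF V ideal_smult[of W x]]
      by (simp add: ideals_between_def add_ideals ideal_smult set_add_mono image_mono)
  next
    fix Z Y assume Z: "Z \<in> ideals_between R ?N U" and Y: "Y \<in> ideals_between R ?N U" and "Z \<subset> Y"
    have iX: "ideal Z R" "?N \<subseteq> Z" and iY: "ideal Y R" "Y \<subseteq> U"
      using Z Y by (auto simp: ideals_between_def)
    have "\<not> V <+> (\<otimes>) x ` Y \<subseteq> V <+> (\<otimes>) x ` Z"
    proof
      assume sub: "V <+> (\<otimes>) x ` Y \<subseteq> V <+> (\<otimes>) x ` Z"
      have "Y \<subseteq> Z"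
      proof
        fix y assume y: "y \<in> Y"
        then have "x \<otimes> y \<in> V <+> (\<otimes>) x ` Z"
          using sub set_add_r[OF V ideal_smult[OF iY(1) x]] by blast
        then obtain v w where vw: "v \<in> V" "w \<in> Z" "x \<otimes> y = v \<oplus> x \<otimes> w" by (auto simp: set_add_mem)
        have c: "v \<in> carrier R" "w \<in> carrier R" "y \<in> carrier R"
          using vw y V iX iY by (auto intro: idl_carr)
        have "x \<otimes> (y \<ominus> w) = x \<otimes> y \<ominus> x \<otimes> w" using c x by algebra
        also have "\<dots> = v" unfolding vw(3) using c x by algebra
        finally have "x \<otimes> (y \<ominus> w) \<in> V" using vw by simp
        moreover have "w \<in> U" using vw Z by (auto simp: ideals_between_def)
        ultimately have "y \<ominus> w \<in> Z" using iX(2) y iY U by (auto intro: idl_minus)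
        then have "(y \<ominus> w) \<oplus> w \<in> Z" using vw iX by (auto intro: idl_add)
        moreover have "(y \<ominus> w) \<oplus> w = y" using c by algebra
        ultimately show "y \<in> Z" by simp
      qed
      then show False using \<open>Z \<subset> Y\<close> by blast
    qed
    then show "V <+> (\<otimes>) x ` Z \<subset> V <+> (\<otimes>) x ` Y"
      using \<open>Z \<subset> Y\<close> set_add_mono[of V V "(\<otimes>) x ` Z" "(\<otimes>) x ` Y"] by blast
  qed
  show "ilen R V (V <+> (\<otimes>) x ` U) \<le> ilen R ?N U"
    unfolding ilen_def
  proof (rule chain_length_mono[where f = "\<lambda>W. {u \<in> U. x \<otimes> u \<in> W}"])
    fix W assume W: "W \<in> ideals_between R V (V <+> (\<otimes>) x ` U)"
    then show "{u \<in> U. x \<otimes> u \<in> W} \<in> ideals_between R ?N U"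
      using U x by (auto simp: ideals_between_def intro!: ideal_colon_elt)
  next
    fix Z Y assume Z: "Z \<in> ideals_between R V (V <+> (\<otimes>) x ` U)"
      and Y: "Y \<in> ideals_between R V (V <+> (\<otimes>) x ` U)" and "Z \<subset> Y"
    then obtain y where y: "y \<in> Y" "y \<notin> Z" by blast
    have iX: "ideal Z R" "V \<subseteq> Z" and iY: "ideal Y R" "V \<subseteq> Y" "Y \<subseteq> V <+> (\<otimes>) x ` U"
      using Z Y by (auto simp: ideals_between_def)
    obtain v u where vu: "v \<in> V" "u \<in> U" "y = v \<oplus> x \<otimes> u" using subsetD[OF iY(3) y(1)] by (auto simp: set_add_mem)
    have c: "v \<in> carrier R" "u \<in> carrier R" "y \<in> carrier R"
      using vu y V U iY by (auto intro: idl_carr)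
    have "x \<otimes> u \<in> Y"
      by (rule idl_add_cancel[of Y v]) (use y vu iY c x in auto)
    moreover have "x \<otimes> u \<notin> Z"
      using y vu iX by (auto intro: idl_add)
    ultimately show "{u \<in> U. x \<otimes> u \<in> Z} \<subset> {u \<in> U. x \<otimes> u \<in> Y}"
      using vu \<open>Z \<subset> Y\<close> by blast
  qed
qed

text \<open>The second isomorphism theorem, as the case \<open>x = 1\<close> of
  \<open>ilen_iso\<close>.\<close>

lemma ilen_second_iso:
  assumes V: "ideal V R" and U: "ideal U R"
  shows "ilen R (U \<inter> V) U = ilen R V (V <+> U)"
proof -
  have "{u \<in> U. \<one> \<otimes> u \<in> V} = U \<inter> V" using U by (auto simp: idl_carr)
  moreover have "(\<otimes>) \<one> ` U = U" using U by (auto simp: idl_carr image_iff)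
  ultimately show ?thesis using ilen_iso[OF V U, of \<one>] by simp
qed

lemma ilen_self: "ideal V R \<Longrightarrow> ilen R V V = 0"
proof -
  assume V: "ideal V R"
  have "ilen R V V \<le> 0"
  proof (rule enat_leI)
    fix k assume "enat k \<le> ilen R V V"
    then obtain C where C: "strict_chain (ideals_between R V V) k C"
      using V by (auto simp: ilen_def chain_length_ge_iff ideals_between_def)
    have "k = 0"
    proof (rule ccontr)
      assume "k \<noteq> 0"
      then have "C 0 \<in> ideals_between R V V" "C (Suc 0) \<in> ideals_between R V V" "C 0 \<subset> C (Suc 0)"
        using C unfolding strict_chain_def by auto
      then show False unfolding ideals_between_def by auto
    qed
    then show "enat k \<le> 0" by (simp add: zero_enat_def)
  qed
  then show ?thesis by simp
qed

lemma ilen_pos: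
  assumes "ideal V R" "ideal U R" "V \<subset> U"
  shows "ilen R V U \<ge> 1"
proof -
  have "strict_chain (ideals_between R V U) 1 (\<lambda>i. if i = 0 then V else U)"
    using assms by (auto simp: strict_chain_def ideals_between_def)
  moreover have "ideals_between R V U \<noteq> {}" using assms by (auto simp: ideals_between_def)
  ultimately show ?thesis
    unfolding ilen_def one_enat_def by (metis chain_length_ge_iff One_nat_def)
qed

end

section \<open>Graded submodules of sequences of ideals\<close>

text \<open>
  A sequence of ideals \<open>W\<close> with \<open>x i \<cdot> W n \<subseteq> W (Suc n)\<close> is a graded module over the polynomial ring in
  \<open>x 0, \<dots>, x (s - 1)\<close>. The part of \<open>W / V\<close> in degree \<open>Suc n\<close> is generated by degree \<open>n\<close> when
  \<open>W (Suc n) = (\<Sum>i<s. x i \<cdot> W n) + V (Suc n)\<close>, expressed here by the universal property of the sum.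
\<close>

definition graded_sub :: "('a, 'b) ring_scheme \<Rightarrow> (nat \<Rightarrow> 'a) \<Rightarrow> nat \<Rightarrow> (nat \<Rightarrow> 'a set) \<Rightarrow> bool" where
  "graded_sub R x s W \<longleftrightarrow>
     (\<forall>n. ideal (W n) R) \<and> (\<forall>n. \<forall>i<s. \<forall>w\<in>W n. x i \<otimes>\<^bsub>R\<^esub> w \<in> W (Suc n))"

definition gen_at ::
  "('a, 'b) ring_scheme \<Rightarrow> (nat \<Rightarrow> 'a) \<Rightarrow> nat \<Rightarrow> (nat \<Rightarrow> 'a set) \<Rightarrow> (nat \<Rightarrow> 'a set) \<Rightarrow> nat \<Rightarrow> bool" where
  "gen_at R x s V W n \<longleftrightarrow> (\<forall>T. ideal T R \<longrightarrow> V (Suc n) \<subseteq> T \<longrightarrow>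
     (\<forall>i<s. \<forall>w\<in>W n. x i \<otimes>\<^bsub>R\<^esub> w \<in> T) \<longrightarrow> W (Suc n) \<subseteq> T)"

text \<open>Over a Noetherian ring each component is finitely generated, so generation of every
  degree from some point on by its predecessor is finite generation of the graded module
  \<open>W / V\<close>.\<close>

definition fin_gen ::
  "('a, 'b) ring_scheme \<Rightarrow> (nat \<Rightarrow> 'a) \<Rightarrow> nat \<Rightarrow> (nat \<Rightarrow> 'a set) \<Rightarrow> (nat \<Rightarrow> 'a set) \<Rightarrow> bool" where
  "fin_gen R x s V W \<longleftrightarrow> (\<exists>N. \<forall>n\<ge>N. gen_at R x s V W n)"

lemma gen_atD:
  "gen_at R x s V W n \<Longrightarrow> ideal T R \<Longrightarrow> V (Suc n) \<subseteq> T \<Longrightarrow>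
    (\<And>i w. i < s \<Longrightarrow> w \<in> W n \<Longrightarrow> x i \<otimes>\<^bsub>R\<^esub> w \<in> T) \<Longrightarrow> W (Suc n) \<subseteq> T"
  unfolding gen_at_def by blast

lemma graded_subD:
  assumes "graded_sub R x s W"
  shows "ideal (W n) R" "i < s \<Longrightarrow> w \<in> W n \<Longrightarrow> x i \<otimes>\<^bsub>R\<^esub> w \<in> W (Suc n)"
  using assms by (auto simp: graded_sub_def)

locale noetherian_cring = cring R + noetherian_ring R for R (structure)

context cring
begin

lemma graded_sub_pow:
  assumes "graded_sub R x s W" "r < s" "x r \<in> carrier R" "u \<in> W m"
  shows "x r [^] (k::nat) \<otimes> u \<in> W (m + k)"
proof (induct k)
  case 0
  then show ?case using assms idl_carr[OF graded_subD(1)[OF assms(1)]] by simp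
next
  case (Suc k)
  have "x r [^] Suc k \<otimes> u = x r \<otimes> (x r [^] k \<otimes> u)"
    using assms(3) idl_carr[OF graded_subD(1)[OF assms(1)] assms(4)]
    by (simp add: nat_pow_Suc m_assoc m_lcomm)
  then show ?case using graded_subD(2)[OF assms(1,2) Suc] by simp
qed

end

text \<open>Multiplication by \<open>y\<close> raises degrees, so \<open>y U\<close> has no component in degree \<open>0\<close>.\<close>

definition add_smult ::
  "('a, 'b) ring_scheme \<Rightarrow> 'a \<Rightarrow> (nat \<Rightarrow> 'a set) \<Rightarrow> (nat \<Rightarrow> 'a set) \<Rightarrow> nat \<Rightarrow> 'a set" where
  "add_smult R y V U n =
     (case n of 0 \<Rightarrow> V 0 | Suc m \<Rightarrow> V (Suc m) <+>\<^bsub>R\<^esub> (\<otimes>\<^bsub>R\<^esub>) y ` U m)"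

lemma (in cring) add_smult:
  assumes U: "graded_sub R x s U" and V: "graded_sub R x s V" and VU: "\<And>n. V n \<subseteq> U n"
    and r: "r < s" and x: "\<And>i. i < s \<Longrightarrow> x i \<in> carrier R"
  defines "V' \<equiv> add_smult R (x r) V U"
  shows "graded_sub R x s V'" "\<And>n. V n \<subseteq> V' n" "\<And>n. V' n \<subseteq> U n"
    "\<And>n u. u \<in> U n \<Longrightarrow> x r \<otimes> u \<in> V' (Suc n)"
proof -
  let ?y = "x r"
  note y = x[OF r]
  note U = graded_subD[OF U] and V = graded_subD[OF V]
  have carr: "u \<in> U n \<Longrightarrow> u \<in> carrier R" for u n using U(1) idl_carr by blast
  have iV': "ideal (V' n) R" for n
    unfolding V'_def add_smult_def using V(1) U(1) y
    by (cases n) (auto intro: add_ideals ideal_smult)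
  have yV': "(\<otimes>) ?y ` U n \<subseteq> V' (Suc n)" for n
    unfolding V'_def add_smult_def using set_add_r[OF V(1) ideal_smult[OF U(1) y]] by simp
  have VV': "V n \<subseteq> V' n" for n
    unfolding V'_def add_smult_def using set_add_l[OF V(1) ideal_smult[OF U(1) y]] by (cases n) auto
  then show "\<And>n. V n \<subseteq> V' n" .
  show "V' n \<subseteq> U n" for n
  proof (cases n)
    case (Suc m)
    have "(\<otimes>) ?y ` U m \<subseteq> U (Suc m)" using U(2)[OF r] by auto
    then show ?thesis unfolding V'_def add_smult_def Suc using set_add_least[OF U(1) VU] by simp
  qed (use VU in \<open>auto simp: V'_def add_smult_def\<close>)
  show "\<And>n u. u \<in> U n \<Longrightarrow> x r \<otimes> u \<in> V' (Suc n)" using yV' by blast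
  show "graded_sub R x s V'"
    unfolding graded_sub_def
  proof (intro conjI allI impI ballI iV')
    fix n i w assume i: "i < s" and w: "w \<in> V' n"
    show "x i \<otimes> w \<in> V' (Suc n)"
    proof (cases n)
      case 0
      then have "x i \<otimes> w \<in> V (Suc n)" using w V(2)[OF i] by (auto simp: V'_def add_smult_def)
      then show ?thesis using VV' by blast
    next
      case (Suc m)
      then obtain v u where vu: "v \<in> V n" "u \<in> U m" "w = v \<oplus> ?y \<otimes> u"
        using w by (auto simp: V'_def add_smult_def set_add_mem)
      have "x i \<otimes> w = x i \<otimes> v \<oplus> ?y \<otimes> (x i \<otimes> u)"
        unfolding vu(3) using x[OF i] y carr[OF vu(2)] idl_carr[OF V(1) vu(1)]
        by (simp add: r_distr m_lcomm)
      moreover have "x i \<otimes> v \<in> V' (Suc n)" using V(2)[OF i vu(1)] VV' by blast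
      moreover have "?y \<otimes> (x i \<otimes> u) \<in> V' (Suc n)" using yV' U(2)[OF i vu(2)] Suc by blast
      ultimately show ?thesis using idl_add[OF iV'] by simp
    qed
  qed
qed

context noetherian_cring
begin

text \<open>Each degree becomes stationary, but possibly later and later. Finite generation of the
  union repairs this: the degrees up to \<open>N\<close> have a common bound \<open>k0\<close>, and
  beyond \<open>N\<close> each degree of the union is generated by its predecessor, hence lies in
  \<open>Z k0\<close>.\<close>

lemma graded_acc:
  assumes Z: "\<And>k. graded_sub R x s (Z k)" and mono: "\<And>k n. Z k n \<subseteq> Z (Suc k) n"
    and VZ: "\<And>n. V n \<subseteq> Z 0 n"
    and gen: "\<And>W. graded_sub R x s W \<Longrightarrow> (\<And>n. V n \<subseteq> W n) \<Longrightarrow> (\<And>n. W n \<subseteq> (\<Union>k. Z k n)) \<Longrightarrow> fin_gen R x s V W"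
  shows "\<exists>k0. \<forall>k\<ge>k0. \<forall>n. Z k n = Z k0 n"
proof -
  have mono': "k \<le> l \<Longrightarrow> Z k n \<subseteq> Z l n" for k l n
    by (rule lift_Suc_mono_le[of "\<lambda>k. Z k n"]) (use mono in auto)
  have "\<exists>N. \<forall>k\<ge>N. Z k n = Z N n" for n
    by (rule ascending_ideals_stationary) (use Z mono in \<open>auto dest: graded_subD\<close>)
  then obtain M where M: "\<And>n k. k \<ge> M n \<Longrightarrow> Z k n = Z (M n) n" by metis
  let ?U = "\<lambda>n. Z (M n) n"
  have U: "Z k n \<subseteq> ?U n" for k n
    using mono'[of k "max k (M n)" n] M[of n "max k (M n)"] by auto
  have gU: "graded_sub R x s ?U"
    unfolding graded_sub_def
    using graded_subD[OF Z] U by blast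
  have "fin_gen R x s V ?U"
    by (rule gen[OF gU]) (use VZ U in blast)+
  then obtain N where N: "\<And>n. n \<ge> N \<Longrightarrow> gen_at R x s V ?U n" unfolding fin_gen_def by blast
  define k0 where "k0 = Max (M ` {..N})"
  have k0: "M n \<le> k0" if "n \<le> N" for n unfolding k0_def using that by (intro Max_ge) auto
  have eq: "?U n \<subseteq> Z k0 n" for n
  proof (induct n)
    case 0
    then show ?case using M[OF k0[of 0]] by simp
  next
    case (Suc n)
    show ?case
    proof (cases "Suc n \<le> N")
      case True
      then show ?thesis using M[OF k0[OF True]] by simp
    next
      case False
      show ?thesis
      proof (rule gen_atD[OF N, of n])
        show "V (Suc n) \<subseteq> Z k0 (Suc n)" using VZ mono'[of 0 k0] by blast
      qed (use False Suc graded_subD[OF Z] in auto)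
    qed
  qed
  have "Z k n = Z k0 n" if "k \<ge> k0" for k n
    using mono'[OF that, of n] eq[of n] U[of k n] by auto
  then show ?thesis by blast
qed

text \<open>
  Hilbert's basis theorem for graded modules. With \<open>y = x r\<close>, the quotient of \<open>U\<close> by \<open>V + y U\<close> needs
  one variable less; in it, the images of the submodules \<open>W : y^k\<close> ascend, hence stabilise at some
  \<open>k\<^sub>0\<close>. An element \<open>y^k u\<close> of \<open>W\<close> is reduced, degree by degree, either by the generators of
  \<open>W : y^k\<close> if \<open>k \<le> k\<^sub>0\<close>, or by those of \<open>W : y^(k-1)\<close> otherwise.
\<close>

lemma graded_noetherian:
  assumes "r \<le> s" and x: "\<And>i. i < s \<Longrightarrow> x i \<in> carrier R"
    and "graded_sub R x s U" "graded_sub R x s V" "graded_sub R x s W"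
    and "\<And>n. V n \<subseteq> W n" "\<And>n. W n \<subseteq> U n"
    and "\<And>i n u. r \<le> i \<Longrightarrow> i < s \<Longrightarrow> u \<in> U n \<Longrightarrow> x i \<otimes> u \<in> V (Suc n)"
    and "fin_gen R x s V U"
  shows "fin_gen R x s V W"
  using assms(1,3-)
proof (induct r arbitrary: U V W)
  case 0
  obtain N where N: "\<And>n. n \<ge> N \<Longrightarrow> gen_at R x s V U n" using 0 unfolding fin_gen_def by blast
  \<comment> \<open>For \<open>r = 0\<close> all variables annihilate \<open>U / V\<close>, so a
    component generated by its predecessor vanishes.\<close>
  have "U (Suc n) \<subseteq> V (Suc n)" if "n \<ge> N" for n
    by (rule gen_atD[OF N[OF that]]) (use 0 graded_subD[OF 0(3)] in auto)
  then have "gen_at R x s V W n" if "n \<ge> N" for n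
    unfolding gen_at_def using 0(6)[of "Suc n"] that by blast
  then show ?case unfolding fin_gen_def by blast
next
  case (Suc r)
  let ?y = "x r"
  have r: "r < s" and y: "?y \<in> carrier R" using Suc(2) x by auto
  note U = graded_subD[OF Suc(3)] and V = graded_subD[OF Suc(4)] and W = graded_subD[OF Suc(5)]
  note VW = Suc(6) and WU = Suc(7) and kill = Suc(8)
  have carr: "u \<in> U n \<Longrightarrow> u \<in> carrier R" for u n using U(1) idl_carr by blast
  have pow: "?y [^] (k::nat) \<in> carrier R" for k using y by simp
  define V' where "V' = add_smult R ?y V U"
  have VU: "V n \<subseteq> U n" for n using VW WU by blast
  note q = add_smult[OF Suc(3,4) VU r x, folded V'_def]
  note gV' = q(1) and VV' = q(2) and V'U = q(3)
  note iV' = graded_subD(1)[OF gV']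
  have kill': "x i \<otimes> u \<in> V' (Suc n)" if "r \<le> i" "i < s" "u \<in> U n" for i n u
  proof (cases "i = r")
    case False
    then show ?thesis using kill[of i u n] that VV' by auto
  qed (use q(4) that in auto)
  have gen': "fin_gen R x s V' U"
    using Suc(9) VV' unfolding fin_gen_def gen_at_def by (meson subset_trans)
  have IH: "fin_gen R x s V' Z" if "graded_sub R x s Z" "\<And>n. V' n \<subseteq> Z n" "\<And>n. Z n \<subseteq> U n" for Z
    by (rule Suc(1)[OF _ Suc(3) gV' that(1)]) (use r that kill' gen' in auto)
  \<comment> \<open>\<open>K k\<close> is the submodule \<open>W : y^k\<close> of \<open>U\<close>,
    and \<open>Z k\<close> below represents its image modulo \<open>V' = V + yU\<close>. The degree
    is shifted because \<open>y^k\<close> raises it by \<open>k\<close>.\<close>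
  define K where "K = (\<lambda>k n. {u \<in> U n. ?y [^] (k::nat) \<otimes> u \<in> W (n + k)})"
  have iK: "ideal (K k n) R" for k n
    unfolding K_def by (rule ideal_colon_elt) (use U W pow in auto)
  have gK: "x i \<otimes> u \<in> K k (Suc n)" if "i < s" "u \<in> K k n" for i k n u
  proof -
    have "?y [^] k \<otimes> (x i \<otimes> u) = x i \<otimes> (?y [^] k \<otimes> u)"
      using that x[OF that(1)] carr pow by (intro m_lcomm) (auto simp: K_def)
    then show ?thesis using that U(2)[OF that(1)] W(2)[OF that(1), of "?y [^] k \<otimes> u" "n + k"]
      by (auto simp: K_def)
  qed
  have KSuc: "K k n \<subseteq> K (Suc k) n" for k n
  proof
    fix u assume u: "u \<in> K k n"
    then have "?y [^] Suc k \<otimes> u = ?y \<otimes> (?y [^] k \<otimes> u)"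
      using y carr[of u n] by (simp add: K_def nat_pow_Suc m_assoc m_lcomm)
    then show "u \<in> K (Suc k) n" using u W(2)[OF r, of "?y [^] k \<otimes> u" "n + k"] by (auto simp: K_def)
  qed
  have VK: "V n \<subseteq> K k n" for k n
    using graded_sub_pow[OF Suc(4) r y] VW VU by (fastforce simp: K_def subset_iff)
  define Z where "Z = (\<lambda>k n. K k n <+> V' n)"
  have KZ: "K k n \<subseteq> Z k n" and V'Z: "V' n \<subseteq> Z k n" for k n
    unfolding Z_def using set_add_l[OF iK iV'] set_add_r[OF iK iV'] by auto
  have ZU: "Z k n \<subseteq> U n" for k n
    unfolding Z_def by (rule set_add_least) (use U V'U in \<open>auto simp: K_def\<close>)
  have gZ: "graded_sub R x s (Z k)" for k
    unfolding graded_sub_def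
  proof (intro conjI allI impI ballI)
    fix n i w assume i: "i < s" and w: "w \<in> Z k n"
    then obtain a b where ab: "a \<in> K k n" "b \<in> V' n" "w = a \<oplus> b" by (auto simp: Z_def set_add_mem)
    have "x i \<otimes> w = x i \<otimes> a \<oplus> x i \<otimes> b"
      unfolding ab(3) using ab x[OF i] idl_carr[OF iK] idl_carr[OF iV'] by (simp add: r_distr)
    then show "x i \<otimes> w \<in> Z k (Suc n)"
      using gK[OF i ab(1)] graded_subD(2)[OF gV' i ab(2)] by (auto simp: Z_def set_add_mem)
  qed (auto simp: Z_def intro: add_ideals iK iV')
  have "\<exists>k0. \<forall>k\<ge>k0. \<forall>n. Z k n = Z k0 n"
  proof (rule graded_acc[where V = V'])
    fix Y assume Y: "graded_sub R x s Y" "\<And>n. V' n \<subseteq> Y n" "\<And>n. Y n \<subseteq> (\<Union>k. Z k n)"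
    show "fin_gen R x s V' Y" by (rule IH[OF Y(1,2)]) (use Y(3) ZU in blast)
  next
    fix k n show "Z k n \<subseteq> Z (Suc k) n" unfolding Z_def by (intro set_add_mono KSuc subset_refl)
  qed (use gZ V'Z in auto)
  then obtain k0 where k0: "\<And>k n. k \<ge> k0 \<Longrightarrow> Z k n = Z k0 n" by metis
  have "fin_gen R x s V' (Z k)" for k using IH[OF gZ V'Z ZU] .
  then obtain M where M: "\<And>k n. n \<ge> M k \<Longrightarrow> gen_at R x s V' (Z k) n" unfolding fin_gen_def by metis
  define n1 where "n1 = Max (M ` {..k0})"
  have n1: "M k \<le> n1" if "k \<le> k0" for k unfolding n1_def using that by (intro Max_ge) auto
  \<comment> \<open>With this bound, \<open>k \<le> k0\<close> and \<open>m + k = n\<close> give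
    \<open>m \<ge> n1\<close>, where \<open>Z k\<close> is generated by its preceding
    degree.\<close>
  have "gen_at R x s V W n" if n: "n \<ge> n1 + k0" for n
    unfolding gen_at_def
  proof (intro allI impI)
    fix T assume T: "ideal T R" and VT: "V (Suc n) \<subseteq> T" and xT: "\<forall>i<s. \<forall>w\<in>W n. x i \<otimes> w \<in> T"
    \<comment> \<open>The total degree \<open>Suc n\<close> is fixed, and elements
      \<open>y^k u\<close> of \<open>W\<close> are treated by increasing degree \<open>m\<close> of
      \<open>u\<close>. At \<open>m = Suc n\<close> the power of \<open>y\<close> is trivial and all
      of \<open>W (Suc n)\<close> is reached.\<close>
    have main: "\<forall>u\<in>K (Suc n - m) m. ?y [^] (Suc n - m) \<otimes> u \<in> T" if "m \<le> Suc n" for m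
      using that
    proof (induct m)
      case m: 0
      show ?case
      proof
        fix u assume u: "u \<in> K (Suc n - 0) 0"
        \<comment> \<open>Degree 0 has no predecessor, but \<open>n \<ge> k0\<close> allows one
          factor \<open>y\<close> to be split off; the remainder lies in
          \<open>V' 0 = V 0\<close>.\<close>
        have "Z (Suc n) 0 = Z n 0" using k0[of n 0] k0[of "Suc n" 0] n by simp
        then have "u \<in> Z n 0" using u KZ by auto
        then obtain a b where ab: "a \<in> K n 0" "b \<in> V' 0" "u = a \<oplus> b" by (auto simp: Z_def set_add_mem)
        have c: "a \<in> carrier R" "b \<in> carrier R" using ab idl_carr[OF iK] idl_carr[OF iV'] by auto
        have "?y \<otimes> (?y [^] n \<otimes> a) \<in> T" using ab(1) xT r by (auto simp: K_def)
        moreover have "?y [^] Suc n \<otimes> b \<in> T"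
          using graded_sub_pow[OF Suc(4) r y, of b 0 "Suc n"] ab(2) VT by (auto simp: V'_def add_smult_def)
        moreover have "?y [^] Suc n \<otimes> u = ?y \<otimes> (?y [^] n \<otimes> a) \<oplus> ?y [^] Suc n \<otimes> b"
          unfolding ab(3) using c y by (simp add: r_distr nat_pow_Suc m_assoc m_lcomm)
        ultimately show "?y [^] (Suc n - 0) \<otimes> u \<in> T" using idl_add[OF T] by simp
      qed
    next
      case m: (Suc m)
      define k where "k = n - m"
      have mk: "m + k = n" "Suc n - Suc m = k" "Suc n - m = Suc k" using m(2) by (auto simp: k_def)
      show ?case
        unfolding mk
      proof
        fix u assume u: "u \<in> K k (Suc m)"
        \<comment> \<open>The elements whose multiple by \<open>y^k\<close> is already known to lie
          in \<open>T\<close>. Modulo \<open>D\<close>, the element \<open>u\<close> will be an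
          element of \<open>V + yU\<close>, on which the induction hypothesis can act.\<close>
        define D where "D = {t \<in> K k (Suc m). ?y [^] k \<otimes> t \<in> T}"
        have iD: "ideal D R" unfolding D_def by (rule ideal_colon_elt) (use iK T pow in auto)
        have DD: "D \<subseteq> D <+> V' (Suc m)" "V' (Suc m) \<subseteq> D <+> V' (Suc m)"
          using set_add_l[OF iD iV'] set_add_r[OF iD iV'] by auto
        have "u \<in> D <+> V' (Suc m)"
        proof (cases "k \<le> k0")
          case True
          then have "m \<ge> M k" using n1[OF True] n mk by linarith
          have "Z k (Suc m) \<subseteq> D <+> V' (Suc m)"
          proof (rule gen_atD[OF M[OF \<open>m \<ge> M k\<close>]])
            fix i w assume i: "i < s" and "w \<in> Z k m"
            then obtain a b where ab: "a \<in> K k m" "b \<in> V' m" "w = a \<oplus> b"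
              by (auto simp: Z_def set_add_mem)
            have c: "a \<in> carrier R" "b \<in> carrier R" using ab idl_carr[OF iK] idl_carr[OF iV'] by auto
            have "?y [^] k \<otimes> (x i \<otimes> a) = x i \<otimes> (?y [^] k \<otimes> a)"
              using x[OF i] c pow by (intro m_lcomm) auto
            then have "x i \<otimes> a \<in> D"
              using gK[OF i ab(1)] ab(1) xT i mk(1) by (auto simp: D_def K_def)
            moreover have "x i \<otimes> w = x i \<otimes> a \<oplus> x i \<otimes> b"
              unfolding ab(3) using c x[OF i] by (simp add: r_distr)
            ultimately show "x i \<otimes> w \<in> D <+> V' (Suc m)"
              using graded_subD(2)[OF gV' i ab(2)] by (auto simp: set_add_mem)
          qed (use iD iV' DD in \<open>auto intro: add_ideals\<close>)
          then show ?thesis using u KZ by blast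
        next
          case False
          then obtain l where l: "k = Suc l" "l \<ge> k0" by (cases k) auto
          have "Z k (Suc m) = Z l (Suc m)" using k0[of k] k0[of l] l by simp
          then have "u \<in> Z l (Suc m)" using u KZ[of k "Suc m"] by auto
          then obtain a b where ab: "a \<in> K l (Suc m)" "b \<in> V' (Suc m)" "u = a \<oplus> b"
            by (auto simp: Z_def set_add_mem)
          have c: "a \<in> carrier R" using ab idl_carr[OF iK] by auto
          have "?y [^] l \<otimes> a \<in> W n" using ab(1) mk l by (auto simp: K_def)
          then have "?y \<otimes> (?y [^] l \<otimes> a) \<in> T" using xT r by blast
          moreover have "?y [^] k \<otimes> a = ?y \<otimes> (?y [^] l \<otimes> a)"
            unfolding l using c y by (simp add: nat_pow_Suc m_assoc m_lcomm)
          ultimately have "a \<in> D" using ab(1) KSuc l by (auto simp: D_def)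
          then show ?thesis using ab by (auto simp: set_add_mem)
        qed
        then obtain d b where db: "d \<in> D" "b \<in> V' (Suc m)" "u = d \<oplus> b" by (auto simp: set_add_mem)
        then obtain v a where va: "v \<in> V (Suc m)" "a \<in> U m" "b = v \<oplus> ?y \<otimes> a"
          by (auto simp: V'_def add_smult_def set_add_mem)
        have c: "d \<in> carrier R" "v \<in> carrier R" "a \<in> carrier R"
          using db(1) va idl_carr[OF iD] idl_carr[OF V(1)] carr by auto
        \<comment> \<open>\<open>b\<close> is \<open>u\<close> minus an element of \<open>D\<close>,
          and modulo \<open>V\<close> it is the multiple \<open>ya\<close>. So \<open>a\<close> lies
          in \<open>K (k + 1)\<close> in degree \<open>m\<close>, to which the induction hypothesis
          applies.\<close>
        have "b \<in> K k (Suc m)"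
          by (rule idl_add_cancel[OF iK, of d]) (use db u idl_carr[OF iV'] D_def in auto)
        then have "v \<oplus> ?y \<otimes> a \<in> K k (Suc m)" unfolding va(3) .
        with subsetD[OF VK va(1)] have ya: "?y \<otimes> a \<in> K k (Suc m)"
          by (rule idl_add_cancel[OF iK _ m_closed[OF y c(3)]])
        have e: "?y [^] Suc k \<otimes> a = ?y [^] k \<otimes> (?y \<otimes> a)"
          using c y by (simp add: nat_pow_Suc m_assoc)
        have "a \<in> K (Suc n - m) m" unfolding mk(3) using ya va(2) e by (auto simp: K_def)
        then have "?y [^] Suc k \<otimes> a \<in> T" using m(1) m(2) mk(3) by auto
        moreover have "?y [^] k \<otimes> v \<in> T"
          using graded_sub_pow[OF Suc(4) r y va(1), of k] VT mk by (auto simp: D_def)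
        moreover have "?y [^] k \<otimes> d \<in> T" using db(1) by (auto simp: D_def)
        moreover have "?y [^] k \<otimes> u = ?y [^] k \<otimes> d \<oplus> (?y [^] k \<otimes> v \<oplus> ?y [^] Suc k \<otimes> a)"
          unfolding e db(3) va(3) using c y pow by (simp add: r_distr)
        ultimately show "?y [^] k \<otimes> u \<in> T" using idl_add[OF T] by simp
      qed
    qed
    show "W (Suc n) \<subseteq> T"
    proof
      fix w assume w: "w \<in> W (Suc n)"
      then have "w \<in> K 0 (Suc n)" using WU idl_carr[OF W(1)] by (auto simp: K_def)
      then show "w \<in> T" using main[of "Suc n"] w idl_carr[OF W(1)] by auto
    qed
  qed
  then show ?case unfolding fin_gen_def by blast
qed

end

section \<open>Numerical polynomials\<close>

definition fdiff :: "(nat \<Rightarrow> int) \<Rightarrow> nat \<Rightarrow> int" where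
  "fdiff f n = f (Suc n) - f n"

text \<open>Vanishing of the \<open>r\<close>-th difference means that \<open>f\<close> is eventually a polynomial of degree less than \<open>r\<close>.\<close>

definition npoly :: "nat \<Rightarrow> (nat \<Rightarrow> int) \<Rightarrow> bool" where
  "npoly r f \<longleftrightarrow> (\<forall>\<^sub>F n in sequentially. (fdiff ^^ r) f n = 0)"

lemma npoly_0: "npoly 0 f \<longleftrightarrow> (\<forall>\<^sub>F n in sequentially. f n = 0)"
  by (simp add: npoly_def)

lemma npoly_Suc: "npoly (Suc r) f \<longleftrightarrow> npoly r (fdiff f)"
  by (simp add: npoly_def funpow_swap1)

lemma fdiff_pow_diff: "(fdiff ^^ r) (\<lambda>n. f n - g n) = (\<lambda>n. (fdiff ^^ r) f n - (fdiff ^^ r) g n)"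
  by (induct r) (auto simp: fdiff_def)

lemma fdiff_pow_shift: "(fdiff ^^ r) (\<lambda>n. f (n + k)) = (\<lambda>n. (fdiff ^^ r) f (n + k))"
  by (induct r) (auto simp: fdiff_def)

lemma fdiff_pow_minus: "(fdiff ^^ r) (\<lambda>n. - f n) = (\<lambda>n. - (fdiff ^^ r) f n)"
  by (induct r) (auto simp: fdiff_def)

lemma npoly_diff: "npoly r f \<Longrightarrow> npoly r g \<Longrightarrow> npoly r (\<lambda>n. f n - g n)"
  unfolding npoly_def fdiff_pow_diff by (auto elim: eventually_elim2)

lemma npoly_minus: "npoly r f \<Longrightarrow> npoly r (\<lambda>n. - f n)"
  unfolding npoly_def fdiff_pow_minus by simp

lemma npoly_add: "npoly r f \<Longrightarrow> npoly r g \<Longrightarrow> npoly r (\<lambda>n. f n + g n)"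
  using npoly_diff[of r f "\<lambda>n. - g n"] npoly_minus[of r g] by simp

lemma npoly_shift: "npoly r (\<lambda>n. f (n + k)) \<longleftrightarrow> npoly r f"
  unfolding npoly_def fdiff_pow_shift by (rule eventually_sequentially_seg)

lemma npoly_mono: "npoly r f \<Longrightarrow> r \<le> t \<Longrightarrow> npoly t f"
proof (induct t)
  case (Suc t)
  show ?case
  proof (cases "r = Suc t")
    case False
    then have "npoly t f" using Suc by auto
    then obtain N where "\<And>n. n \<ge> N \<Longrightarrow> (fdiff ^^ t) f n = 0"
      unfolding npoly_def eventually_sequentially by blast
    then have "\<And>n. n \<ge> N \<Longrightarrow> (fdiff ^^ Suc t) f n = 0" by (simp add: fdiff_def)
    then show ?thesis unfolding npoly_def eventually_sequentially by blast
  qed (use Suc in simp)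
qed simp

lemma npoly_increment:
  assumes "npoly (Suc r) f" shows "npoly r (\<lambda>n. f (n + c) - f n)"
proof (induct c)
  case 0
  have "npoly 0 (\<lambda>n. 0)" by (simp add: npoly_0)
  then show ?case using npoly_mono by fastforce
next
  case (Suc c)
  have "npoly r (\<lambda>n. fdiff f (n + c))" using assms by (simp add: npoly_shift npoly_Suc)
  from npoly_add[OF this Suc] show ?case by (simp add: fdiff_def)
qed

lemma eventually_ge_1_of_fdiff:
  assumes "\<forall>\<^sub>F n in sequentially. (fdiff ^^ k) f n \<ge> 1"
  shows "\<forall>\<^sub>F n in sequentially. f n \<ge> 1"
  using assms
proof (induct k arbitrary: f)
  case (Suc k)
  then have "\<forall>\<^sub>F n in sequentially. fdiff f n \<ge> 1" by (simp add: funpow_swap1)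
  then obtain N where N: "\<And>n. n \<ge> N \<Longrightarrow> fdiff f n \<ge> 1" by (auto simp: eventually_sequentially)
  have "f (N + j) \<ge> f N + int j" for j
  proof (induct j)
    case (Suc j)
    then show ?case using N[of "N + j"] by (simp add: fdiff_def)
  qed simp
  then have j: "f (N + j) \<ge> 1" if "1 - f N \<le> int j" for j
    using that by (smt (verit))
  have "f n \<ge> 1" if n: "n \<ge> N + nat (1 - f N)" for n
  proof -
    have "1 - f N \<le> int (n - N)" "N + (n - N) = n" using n by linarith+
    then show ?thesis using j[of "n - N"] by simp
  qed
  then show ?case unfolding eventually_sequentially by blast
qed simp

text \<open>If \<open>g\<close> had degree \<open>c \<ge> r\<close>, its \<open>c\<close>-th
  difference would eventually be a nonzero constant, while that of \<open>h\<close> vanishes. A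
  positive constant makes \<open>g - h\<close> eventually positive, a negative one makes
  \<open>g\<close> eventually negative.\<close>

lemma npoly_comparison:
  assumes "npoly a g" "npoly r h" "\<forall>\<^sub>F n in sequentially. 0 \<le> g n" "\<forall>\<^sub>F n in sequentially. g n \<le> h n"
  shows "npoly r g"
proof (rule ccontr)
  assume neg: "\<not> npoly r g"
  define b where "b = (LEAST b. npoly b g)"
  have b: "npoly b g" unfolding b_def by (rule LeastI) fact
  then have "r < b" using neg npoly_mono[of b g r] by fastforce
  then obtain c where c: "b = Suc c" "r \<le> c" by (cases b) auto
  have nc: "\<not> npoly c g" using not_less_Least[of c "\<lambda>b. npoly b g"] c by (auto simp: b_def)
  let ?D = "(fdiff ^^ c) g"
  obtain N where N: "\<And>n. n \<ge> N \<Longrightarrow> fdiff ?D n = 0"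
    using b c by (auto simp: npoly_def eventually_sequentially)
  have N': "?D (Suc n) = ?D n" if "n \<ge> N" for n
    using N[OF that] unfolding fdiff_def[of ?D n] by simp
  have "?D n = ?D N" if "n \<ge> N" for n
    using that
  proof (induct n rule: dec_induct)
    case (step n)
    then show ?case using N'[OF step(1)] by metis
  qed simp
  then obtain d where D: "\<And>n. n \<ge> N \<Longrightarrow> ?D n = d" by blast
  have "d \<noteq> 0" using nc D unfolding npoly_def eventually_sequentially by blast
  then consider "d \<ge> 1" | "- d \<ge> 1" by linarith
  then show False
  proof cases
    case 1
    have "npoly c h" using npoly_mono assms(2) c by blast
    then have "\<forall>\<^sub>F n in sequentially. (fdiff ^^ c) (\<lambda>n. g n - h n) n \<ge> 1"
      unfolding npoly_def fdiff_pow_diff using eventually_ge_at_top[of N]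
      by eventually_elim (use 1 D in simp)
    from eventually_ge_1_of_fdiff[OF this] assms(4)
    have "\<forall>\<^sub>F n in sequentially. False" by eventually_elim simp
    then show False by simp
  next
    case 2
    have "\<forall>\<^sub>F n in sequentially. (fdiff ^^ c) (\<lambda>n. - g n) n \<ge> 1"
      unfolding fdiff_pow_minus using eventually_ge_at_top[of N]
      by eventually_elim (use 2 D in simp)
    from eventually_ge_1_of_fdiff[OF this] assms(3)
    have "\<forall>\<^sub>F n in sequentially. False" by eventually_elim simp
    then show False by simp
  qed
qed

section \<open>Hilbert functions\<close>

text \<open>Meaningful for finite lengths only, since \<open>the_enat \<infinity>\<close> has no
  specified value; this is why finiteness is carried along below.\<close>

definition ilen_int :: "('a, 'b) ring_scheme \<Rightarrow> 'a set \<Rightarrow> 'a set \<Rightarrow> int" where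
  "ilen_int R V U = int (the_enat (ilen R V U))"

lemma ilen_int_nonneg [simp]: "ilen_int R V U \<ge> 0"
  by (simp add: ilen_int_def)

lemma ilen_mono:
  assumes "V' \<subseteq> V" "U \<subseteq> U'" shows "ilen R V U \<le> ilen R V' U'"
  unfolding ilen_def
  by (rule chain_length_mono[where f = id]) (use assms in \<open>auto simp: ideals_between_def\<close>)

lemma ilen_finite_mono:
  "ilen R V' U' \<noteq> \<infinity> \<Longrightarrow> V' \<subseteq> V \<Longrightarrow> U \<subseteq> U' \<Longrightarrow> ilen R V U \<noteq> \<infinity>"
  using ilen_mono[of V' V U U' R] by (cases "ilen R V U") auto

lemma ilen_int_mono:
  assumes "V' \<subseteq> V" "U \<subseteq> U'" "ilen R V' U' \<noteq> \<infinity>" shows "ilen_int R V U \<le> ilen_int R V' U'"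
  using ilen_mono[OF assms(1,2), of R] assms(3)
  by (cases "ilen R V' U'"; cases "ilen R V U") (auto simp: ilen_int_def)

lemma (in cring) ilen_int_add:
  assumes "ideal V R" "ideal U R" "ideal T R" "V \<subseteq> U" "U \<subseteq> T" "ilen R V T \<noteq> \<infinity>"
  shows "ilen_int R V T = ilen_int R V U + ilen_int R U T" "ilen R V U \<noteq> \<infinity>" "ilen R U T \<noteq> \<infinity>"
proof -
  have "ilen R V T = ilen R V U + ilen R U T" using ilen_add assms by blast
  with assms(6) show "ilen_int R V T = ilen_int R V U + ilen_int R U T"
    "ilen R V U \<noteq> \<infinity>" "ilen R U T \<noteq> \<infinity>"
    by (cases "ilen R V U"; cases "ilen R U T"; auto simp: ilen_int_def)+
qed

context noetherian_cring
begin

text \<open>The theorem of Hilbert and Serre. Multiplication by \<open>y = x r\<close> from degree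
  \<open>n\<close> to \<open>n + 1\<close> of \<open>U / V\<close> has kernel \<open>N / V\<close>
  and cokernel \<open>U / V'\<close>. Both are annihilated by \<open>y\<close>, hence governed by
  \<open>r\<close> variables, and the difference of their lengths is the difference of the Hilbert
  function.\<close>

lemma npoly_ilen_graded:
  assumes "r \<le> s" and x: "\<And>i. i < s \<Longrightarrow> x i \<in> carrier R"
    and "graded_sub R x s U" "graded_sub R x s V" "\<And>n. V n \<subseteq> U n"
    and "\<And>i n u. r \<le> i \<Longrightarrow> i < s \<Longrightarrow> u \<in> U n \<Longrightarrow> x i \<otimes> u \<in> V (Suc n)"
    and "fin_gen R x s V U" "\<And>n. ilen R (V n) (U n) \<noteq> \<infinity>"
  shows "npoly r (\<lambda>n. ilen_int R (V n) (U n))"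
  using assms(1,3-)
proof (induct r arbitrary: U V)
  case 0
  note U = graded_subD[OF 0(2)] and V = graded_subD[OF 0(3)]
  obtain N where N: "\<And>n. n \<ge> N \<Longrightarrow> gen_at R x s V U n" using 0 unfolding fin_gen_def by blast
  have "U (Suc n) \<subseteq> V (Suc n)" if "n \<ge> N" for n
    by (rule gen_atD[OF N[OF that]]) (use 0 V in auto)
  then have "U (Suc n) = V (Suc n)" if "n \<ge> N" for n using that 0(4) by blast
  then have "U n = V n" if "n \<ge> Suc N" for n using that by (cases n) auto
  then have "ilen_int R (V n) (U n) = 0" if "n \<ge> Suc N" for n
    using that ilen_self[OF V(1)] by (simp add: ilen_int_def zero_enat_def)
  then show ?case by (auto simp: npoly_0 eventually_sequentially)
next
  case (Suc r)
  have r: "r < s" and y: "x r \<in> carrier R" using Suc(2) x by auto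
  note U = graded_subD[OF Suc(3)] and V = graded_subD[OF Suc(4)] and VU = Suc(5)
  define V' where "V' = add_smult R (x r) V U"
  note q = add_smult[OF Suc(3,4) VU r x, folded V'_def]
  note iV' = graded_subD(1)[OF q(1)]
  define N where "N = (\<lambda>n. {u \<in> U n. x r \<otimes> u \<in> V (Suc n)})"
  have iN: "ideal (N n) R" for n unfolding N_def by (rule ideal_colon_elt) (use U V y in auto)
  have gN: "graded_sub R x s N"
    unfolding graded_sub_def
  proof (intro conjI allI impI ballI iN)
    fix n i w assume i: "i < s" and w: "w \<in> N n"
    have "x r \<otimes> (x i \<otimes> w) = x i \<otimes> (x r \<otimes> w)"
      using w x[OF i] y idl_carr[OF U(1)] by (intro m_lcomm) (auto simp: N_def)
    then show "x i \<otimes> w \<in> N (Suc n)"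
      using w U(2)[OF i] V(2)[OF i] by (auto simp: N_def)
  qed
  have VN: "V n \<subseteq> N n" and NU: "N n \<subseteq> U n" for n
    using V(2)[OF r] VU by (auto simp: N_def)
  have kill: "x i \<otimes> u \<in> V (Suc n)" if "r \<le> i" "i < s" "u \<in> N n" for i n u
    using that Suc(6)[of i u n] by (cases "i = r") (auto simp: N_def)
  \<comment> \<open>Finite generation passes to the kernel by the basis theorem.\<close>
  have genN: "fin_gen R x s V N"
    by (rule graded_noetherian[OF Suc(2) x Suc(3,4) gN VN NU]) (use Suc(6,7) in auto)
  have kill': "x i \<otimes> u \<in> V' (Suc n)" if "r \<le> i" "i < s" "u \<in> U n" for i n u
    using that Suc(6)[of i u n] q(2,4) by (cases "i = r") auto
  have genV': "fin_gen R x s V' U"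
    using Suc(8) q(2) Suc(7) unfolding fin_gen_def gen_at_def by (meson subset_trans)
  note a1 = ilen_int_add[OF V(1) iN U(1) VN NU Suc(8)]
  note a2 = ilen_int_add[OF V(1) iV' U(1) q(2,3) Suc(8)]
  have h1: "npoly r (\<lambda>n. ilen_int R (V n) (N n))"
    by (rule Suc(1)[OF _ gN Suc(4) VN kill genN]) (use r a1 in auto)
  have "npoly r (\<lambda>n. ilen_int R (V' n) (U n))"
    by (rule Suc(1)[OF _ Suc(3) q(1) q(3) kill' genV']) (use r a2 in auto)
  then have h2: "npoly r (\<lambda>n. ilen_int R (V' (n + 1)) (U (n + 1)))"
    using npoly_shift[of r "\<lambda>n. ilen_int R (V' n) (U n)" 1] by simp
  have "fdiff (\<lambda>n. ilen_int R (V n) (U n)) =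
    (\<lambda>n. ilen_int R (V' (n + 1)) (U (n + 1)) - ilen_int R (V n) (N n))"
  proof
    fix n
    have "V' (Suc n) = V (Suc n) <+> (\<otimes>) (x r) ` U n" by (simp add: V'_def add_smult_def)
    then have "ilen_int R (N n) (U n) = ilen_int R (V (Suc n)) (V' (Suc n))"
      unfolding ilen_int_def N_def using ilen_iso[OF V(1) U(1) y] by simp
    then show "fdiff (\<lambda>n. ilen_int R (V n) (U n)) n =
        ilen_int R (V' (n + 1)) (U (n + 1)) - ilen_int R (V n) (N n)"
      using a1(1)[of n] a2(1)[of "Suc n"] by (simp add: fdiff_def)
  qed
  then show ?case unfolding npoly_Suc using npoly_diff[OF h2 h1] by simp
qed

end

section \<open>The Artin-Rees lemma\<close>

locale fin_gen_ideal = noetherian_cring +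
  fixes x :: "nat \<Rightarrow> 'a" and s :: nat and q :: "'a set"
  assumes x_carr: "\<And>i. i < s \<Longrightarrow> x i \<in> carrier R" and q_gen: "q = Idl (x ` {..<s})"
begin

abbreviation "qp \<equiv> ideal_power R q"

lemma q_ideal: "ideal q R"
  unfolding q_gen by (rule genideal_ideal) (use x_carr in auto)

lemma x_mem: "i < s \<Longrightarrow> x i \<in> q"
  unfolding q_gen by (rule subsetD[OF genideal_self]) (use x_carr in auto)

lemma qp_ideal: "ideal (qp n) R"
  by (rule ideal_power_ideal[OF q_ideal])

lemma qp_graded: "graded_sub R x s qp"
  unfolding graded_sub_def using qp_ideal ideal_power_Suc_mem[OF q_ideal x_mem] by blast

lemma qp_gen_at:
  "gen_at R x s V qp n"
  unfolding gen_at_def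
proof (intro allI impI)
  fix T assume T: "ideal T R" "\<forall>i<s. \<forall>w\<in>qp n. x i \<otimes> w \<in> T"
  show "qp (Suc n) \<subseteq> T"
    by (rule ideal_power_Suc_least[OF _ q_gen T(1)]) (use x_carr T(2) in auto)
qed

text \<open>From some degree \<open>c\<close> on, each component of the graded submodule
  \<open>q^n \<inter> B\<close> of the Rees algebra, with \<open>B = P + bR\<close>, is generated by
  its predecessor. In degree \<open>c\<close> it lies in \<open>B\<close>, and each further degree
  multiplies the cofactor of \<open>b\<close> by generators of \<open>q\<close>, so the cofactor can
  be chosen in \<open>q^(n-c)\<close>.\<close>

lemma artin_rees:
  assumes P: "ideal P R" and b: "b \<in> carrier R"
  shows "\<exists>c. \<forall>n\<ge>c. qp n \<inter> (P <+> PIdl b) \<subseteq> P <+> (\<otimes>) b ` qp (n - c)"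
proof -
  let ?B = "P <+> PIdl b"
  have B: "ideal ?B R" using P b by (simp add: add_ideals cgenideal_ideal)
  have gB: "graded_sub R x s (\<lambda>n. qp n \<inter> ?B)"
    using graded_subD[OF qp_graded] B x_carr by (auto simp: graded_sub_def ideal_inter idl_l)
  have gZ: "graded_sub R x s (\<lambda>_. {\<zero>})"
    using x_carr by (auto simp: graded_sub_def zeroideal)
  have fg: "fin_gen R x s (\<lambda>_. {\<zero>}) qp"
    unfolding fin_gen_def using qp_gen_at by blast
  have "fin_gen R x s (\<lambda>_. {\<zero>}) (\<lambda>n. qp n \<inter> ?B)"
  proof (rule graded_noetherian[OF order_refl x_carr qp_graded gZ gB _ _ _ fg])
    show "{\<zero>} \<subseteq> qp n \<inter> ?B" for n using idl_zero[OF B] idl_zero[OF qp_ideal] by simp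
  qed auto
  then obtain c where c: "\<And>n. n \<ge> c \<Longrightarrow> gen_at R x s (\<lambda>_. {\<zero>}) (\<lambda>n. qp n \<inter> ?B) n"
    unfolding fin_gen_def by blast
  have "qp n \<inter> ?B \<subseteq> P <+> (\<otimes>) b ` qp (n - c)" if "n \<ge> c" for n
    using that
  proof (induct n rule: dec_induct)
    case base
    have "PIdl b = (\<otimes>) b ` qp (c - c)" using b m_comm by (force simp: cgenideal_def ideal_power_0)
    then show ?case by auto
  next
    case (step n)
    let ?T = "P <+> (\<otimes>) b ` qp (Suc n - c)"
    have T: "ideal ?T R" using P b qp_ideal by (simp add: add_ideals ideal_smult)
    show ?case
    proof (rule gen_atD[OF c[OF step(1)] T])
      fix i w assume i: "i < s" and "w \<in> qp n \<inter> ?B"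
      then have "w \<in> P <+> (\<otimes>) b ` qp (n - c)" using step(3) by blast
      then obtain p u where pu: "p \<in> P" "u \<in> qp (n - c)" "w = p \<oplus> b \<otimes> u"
        by (auto simp: set_add_mem)
      have cc: "p \<in> carrier R" "u \<in> carrier R" using pu P qp_ideal idl_carr by auto
      have "x i \<otimes> w = x i \<otimes> p \<oplus> b \<otimes> (x i \<otimes> u)"
        unfolding pu(3) using cc b x_carr[OF i] by (simp add: r_distr m_lcomm)
      moreover have "x i \<otimes> u \<in> qp (Suc n - c)"
        using graded_subD(2)[OF qp_graded i pu(2)] step(1) by (simp add: Suc_diff_le)
      ultimately show "x i \<otimes> w \<in> ?T"
        using idl_l[OF P pu(1) x_carr[OF i]] by (auto simp: set_add_mem)
    qed (use idl_zero[OF T] in auto)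
  qed
  then show ?thesis by blast
qed

end

section \<open>Hilbert-Samuel functions and the dimension bound\<close>

locale fin_colength_ideal = fin_gen_ideal +
  assumes fin: "\<And>n. ilen R (ideal_power R q n) (carrier R) \<noteq> \<infinity>"
begin

definition hf :: "'a set \<Rightarrow> nat \<Rightarrow> int" where
  "hf J n = ilen_int R (J <+> qp n) (carrier R)"

lemma fin':
  assumes "ideal J R" shows "ilen R (J <+> qp n) (carrier R) \<noteq> \<infinity>"
  using ilen_finite_mono[OF fin set_add_r[OF assms qp_ideal] subset_refl] .

lemma hf_antimono:
  assumes "ideal J R" "J \<subseteq> J'" shows "hf J' n \<le> hf J n"
  unfolding hf_def using assms fin' by (intro ilen_int_mono set_add_mono) auto

text \<open>The difference of \<open>hf J\<close> at \<open>n\<close> is the length of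
  \<open>(J + q^n) / (J + q^(n+1))\<close>, the degree \<open>n\<close> part of the associated
  graded ring of \<open>R/J\<close>. By the second isomorphism theorem this is the length of
  \<open>q^n / V n\<close>, a graded quotient of the Rees algebra, generated by \<open>s\<close>
  elements of degree 1.\<close>

lemma npoly_hf:
  assumes J: "ideal J R"
  shows "npoly (Suc s) (hf J)"
proof -
  let ?B = "\<lambda>n. J <+> qp (Suc n)"
  have B: "ideal (?B n) R" for n using J qp_ideal by (simp add: add_ideals)
  define V where "V = (\<lambda>n. qp n \<inter> ?B n)"
  have gV: "graded_sub R x s V"
    unfolding graded_sub_def
  proof (intro conjI allI impI ballI)
    fix n i w assume i: "i < s" and w: "w \<in> V n"
    then obtain j u where ju: "j \<in> J" "u \<in> qp (Suc n)" "w = j \<oplus> u" by (auto simp: V_def set_add_mem)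
    have "x i \<otimes> w = x i \<otimes> j \<oplus> x i \<otimes> u"
      unfolding ju(3)
      by (rule r_distr[OF idl_carr[OF J ju(1)] idl_carr[OF qp_ideal ju(2)] x_carr[OF i]])
    moreover have "x i \<otimes> w \<in> qp (Suc n)" using w graded_subD(2)[OF qp_graded i] by (simp add: V_def)
    ultimately show "x i \<otimes> w \<in> V (Suc n)"
      using graded_subD(2)[OF qp_graded i ju(2)] idl_l[OF J ju(1) x_carr[OF i]]
      unfolding V_def by (metis IntI set_add_mem)
  qed (use B qp_ideal in \<open>auto simp: V_def ideal_inter\<close>)
  have eq: "?B n <+> qp n = J <+> qp n" for n
  proof
    show "?B n <+> qp n \<subseteq> J <+> qp n"
      using J qp_ideal ideal_power_Suc_subset[OF q_ideal, of n] set_add_r[OF J qp_ideal, of n]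
      by (intro set_add_least set_add_mono add_ideals) auto
    show "J <+> qp n \<subseteq> ?B n <+> qp n"
      using set_add_l[OF J qp_ideal, of "Suc n"] by (intro set_add_mono) auto
  qed
  have sub: "?B n \<subseteq> J <+> qp n" for n
    using ideal_power_Suc_subset[OF q_ideal, of n] by (intro set_add_mono) auto
  have iJ: "ideal (J <+> qp n) R" for n using J qp_ideal by (simp add: add_ideals)
  note a = ilen_int_add[OF B iJ oneideal sub idl_sub[OF iJ] fin'[OF J]]
  have si: "ilen R (V n) (qp n) = ilen R (?B n) (J <+> qp n)" for n
    unfolding V_def ilen_second_iso[OF B qp_ideal] eq ..
  have "npoly s (\<lambda>n. ilen_int R (V n) (qp n))"
    by (rule npoly_ilen_graded[OF order_refl x_carr qp_graded gV])
      (use qp_gen_at si a(2) in \<open>auto simp: V_def fin_gen_def\<close>)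
  moreover have "fdiff (hf J) = (\<lambda>n. ilen_int R (V n) (qp n))"
    using a(1) si by (auto simp: fdiff_def hf_def ilen_int_def)
  ultimately show ?thesis by (simp add: npoly_Suc)
qed

text \<open>
  For a nonzero \<open>y\<close> of the domain \<open>R / P\<close>, the Artin--Rees lemma makes the Hilbert function of
  \<open>R / (P + y R)\<close> smaller than a difference of the Hilbert function of \<open>R / P\<close>.
\<close>

lemma prime_chain_hf:
  assumes M: "ideal M R" "M \<noteq> carrier R" "q \<subseteq> M"
    and "\<And>i. i \<le> d \<Longrightarrow> primeideal (P i) R" "\<And>i. i < d \<Longrightarrow> P i \<subset> P (Suc i)" "P d \<subseteq> M"
    and "ideal J R" "J \<subseteq> P 0"
  shows "\<not> npoly d (hf J)"
  using assms(4-)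
proof (induct d arbitrary: P J)
  case 0
  have "J <+> qp n \<subset> carrier R" if "n \<ge> 1" for n
  proof -
    have "qp n \<subseteq> M" using ideal_power_antimono[OF q_ideal that] M(3) ideal_power_1[OF q_ideal] by auto
    then have "J <+> qp n \<subseteq> M" using 0 by (intro set_add_least M) auto
    then show ?thesis using M idl_sub by blast
  qed
  then have "ilen R (J <+> qp n) (carrier R) \<ge> 1" if "n \<ge> 1" for n
    using that 0(4) qp_ideal by (intro ilen_pos add_ideals oneideal) auto
  then have "hf J n \<noteq> 0" if "n \<ge> 1" for n
    using that fin'[OF 0(4), of n]
    by (fastforce simp: hf_def ilen_int_def one_enat_def)
  then show ?case by (auto simp: npoly_0 eventually_sequentially) (metis nat_le_linear)
next
  case (Suc d)
  show ?case
  proof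
    assume np: "npoly (Suc d) (hf J)"
    interpret P0: primeideal "P 0" R using Suc(2) by simp
    have P0: "ideal (P 0) R" ..
    \<comment> \<open>The statement admits any \<open>J \<subseteq> P 0\<close> because the
      induction hypothesis is applied to \<open>P 0 + yR\<close>, which lies in \<open>P 1\<close>
      but need not be prime. Enlarging \<open>J\<close> to \<open>P 0\<close> only lowers the
      function.\<close>
    have "npoly (Suc d) (hf (P 0))"
      by (rule npoly_comparison[OF npoly_hf[OF P0] np])
        (use hf_antimono[OF Suc(5,6)] in \<open>auto simp: hf_def\<close>)
    then have np0: "npoly d (\<lambda>n. hf (P 0) (n + c) - hf (P 0) n)" for c by (rule npoly_increment)
    obtain y where y: "y \<in> P 1" "y \<notin> P 0" using Suc(3)[of 0] by auto
    have P1: "ideal (P 1) R" using Suc(2)[of 1] by (auto dest: primeideal.axioms)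
    have yc: "y \<in> carrier R" using y P1 idl_carr by blast
    let ?B = "P 0 <+> PIdl y"
    have B: "ideal ?B R" using P0 yc by (simp add: add_ideals cgenideal_ideal)
    obtain c where c: "\<And>n. n \<ge> c \<Longrightarrow> qp n \<inter> ?B \<subseteq> P 0 <+> (\<otimes>) y ` qp (n - c)"
      using artin_rees[OF P0 yc] by blast
    \<comment> \<open>With \<open>V = P 0 + q^(n+c)\<close>, the length of \<open>R/V\<close> is
      that of \<open>(V + yR)/V \<cong> R/(V : y)\<close> plus that of \<open>R/(V + yR)\<close>.
      The second is at least \<open>hf ?B (n + c)\<close>. The first is at least
      \<open>hf (P 0) n\<close>, because Artin-Rees and primality of \<open>P 0\<close> give
      \<open>V : y \<subseteq> P 0 + q^n\<close>.\<close>
    have le: "hf ?B (n + c) \<le> hf (P 0) (n + c) - hf (P 0) n" for n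
    proof -
      let ?V = "P 0 <+> qp (n + c)"
      have V: "ideal ?V R" using P0 qp_ideal by (simp add: add_ideals)
      let ?N = "{u \<in> carrier R. y \<otimes> u \<in> ?V}" and ?T = "?V <+> (\<otimes>) y ` carrier R"
      have T: "ideal ?T R" by (intro add_ideals V ideal_smult oneideal yc)
      have N: "ideal ?N R" by (rule ideal_colon_elt[OF oneideal V yc])
      have "?N \<subseteq> P 0 <+> qp n"
      proof
        fix u assume "u \<in> ?N"
        then obtain p z where u: "u \<in> carrier R" and pz: "p \<in> P 0" "z \<in> qp (n + c)" "y \<otimes> u = p \<oplus> z"
          by (auto simp: set_add_mem)
        have cc: "p \<in> carrier R" "z \<in> carrier R" using pz P0 qp_ideal idl_carr by auto
        have "z = \<ominus> p \<oplus> u \<otimes> y" using pz(3) cc u yc m_comm[of u y] by (simp add: a_assoc[symmetric] l_neg)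
        then have "z \<in> ?B" using idl_neg[OF P0 pz(1)] u by (auto simp: set_add_mem cgenideal_def)
        then have "z \<in> P 0 <+> (\<otimes>) y ` qp n" using c[of "n + c"] pz(2) by auto
        then obtain p' b where b: "p' \<in> P 0" "b \<in> qp n" "z = p' \<oplus> y \<otimes> b" by (auto simp: set_add_mem)
        have cc': "p' \<in> carrier R" "b \<in> carrier R" using b P0 qp_ideal idl_carr by auto
        have "y \<otimes> (u \<ominus> b) = y \<otimes> u \<ominus> y \<otimes> b" using u yc cc' by algebra
        also have "\<dots> = p \<oplus> p'" unfolding pz(3) b(3) using cc cc' yc by algebra
        finally have "y \<otimes> (u \<ominus> b) \<in> P 0" using pz b idl_add[OF P0] by simp
        then have "u \<ominus> b \<in> P 0" using P0.I_prime[of y "u \<ominus> b"] y u cc' yc by auto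
        moreover have "u = (u \<ominus> b) \<oplus> b" using u cc' by algebra
        ultimately show "u \<in> P 0 <+> qp n" using b(2) by (auto simp: set_add_mem)
      qed
      then have le1: "hf (P 0) n \<le> ilen_int R ?N (carrier R)"
        unfolding hf_def
      proof (rule ilen_int_mono[OF _ subset_refl])
        have "ilen R ?N (carrier R) = ilen R ?V ?T" by (rule ilen_iso[OF V oneideal yc])
        then show "ilen R ?N (carrier R) \<noteq> \<infinity>"
          using ilen_finite_mono[OF fin'[OF P0] subset_refl idl_sub[OF T]] by metis
      qed
      have "PIdl y = (\<otimes>) y ` carrier R" using yc m_comm by (force simp: cgenideal_def)
      then have "(\<otimes>) y ` carrier R \<subseteq> ?B <+> qp (n + c)"
        using set_add_l[OF B qp_ideal] set_add_r[OF P0 cgenideal_ideal[OF yc]] by blast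
      with set_add_mono[OF set_add_l[OF P0 cgenideal_ideal[OF yc]] subset_refl]
      have "?T \<subseteq> ?B <+> qp (n + c)" by (rule set_add_least[OF add_ideals[OF B qp_ideal]])
      then have "hf ?B (n + c) \<le> ilen_int R ?T (carrier R)"
        unfolding hf_def
      proof (rule ilen_int_mono[OF _ subset_refl])
        show "ilen R ?T (carrier R) \<noteq> \<infinity>"
          by (rule ilen_finite_mono[OF fin'[OF P0] set_add_l[OF V ideal_smult[OF oneideal yc]] subset_refl])
      qed
      moreover have "hf (P 0) (n + c) = ilen_int R ?V ?T + ilen_int R ?T (carrier R)"
        unfolding hf_def
        by (rule ilen_int_add(1)[OF V T oneideal set_add_l[OF V ideal_smult[OF oneideal yc]]
              idl_sub[OF T] fin'[OF P0]])
      moreover have "ilen_int R ?N (carrier R) = ilen_int R ?V ?T"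
        unfolding ilen_int_def ilen_iso[OF V oneideal yc] ..
      ultimately show ?thesis using le1 by linarith
    qed
    have "npoly (Suc s) (\<lambda>n. hf ?B (n + c))" using npoly_shift npoly_hf[OF B] by simp
    then have "npoly d (\<lambda>n. hf ?B (n + c))"
      by (rule npoly_comparison[OF _ np0[of c]]) (use le in \<open>auto simp: hf_def\<close>)
    then have "npoly d (hf ?B)" by (simp add: npoly_shift)
    moreover have "\<not> npoly d (hf ?B)"
    proof (rule Suc(1)[of "\<lambda>i. P (Suc i)"])
      show "?B \<subseteq> P (Suc 0)"
        using Suc(3)[of 0] y P1 cgenideal_minimal[OF P1 y(1)] by (intro set_add_least) auto
    qed (use Suc(2,3,4) B in auto)
    ultimately show False by simp
  qed
qed

text \<open>The Hilbert-Samuel function of \<open>R\<close> has degree at most \<open>s\<close>, the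
  number of generators, and at least the length of any chain of primes.\<close>

lemma krull_dim_le:
  assumes M: "ideal M R" "M \<noteq> carrier R" "q \<subseteq> M" "\<And>P. primeideal P R \<Longrightarrow> P \<subseteq> M"
  shows "krull_dim R \<le> enat s"
  unfolding krull_dim_def chain_length_altdef
proof (rule Sup_least, safe)
  fix n C assume C: "strict_chain {P. primeideal P R} n C"
  show "enat n \<le> enat s"
  proof (rule ccontr)
    assume "\<not> enat n \<le> enat s"
    then have "npoly n (hf {\<zero>})" using npoly_mono[OF npoly_hf[OF zeroideal]] by simp
    moreover have "{\<zero>} \<subseteq> C 0"
      using C by (auto simp: strict_chain_def intro!: idl_zero dest: primeideal.axioms(1))
    then have "\<not> npoly n (hf {\<zero>})"
      using C M by (intro prime_chain_hf[OF M(1-3), of n C]) (auto simp: strict_chain_def zeroideal)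
    ultimately show False by simp
  qed
qed

end

section \<open>Hilbert coefficients\<close>

definition hpoly :: "nat \<Rightarrow> (nat \<Rightarrow> int) \<Rightarrow> nat \<Rightarrow> int" where
  "hpoly s e n = (\<Sum>i\<le>s. (- 1) ^ i * e i * int ((n + s - i - 1) choose (s - i)))"

lemma hpoly_0: "hpoly 0 e n = e 0"
  by (simp add: hpoly_def)

text \<open>Pascal's rule. The term with \<open>i = Suc s\<close> is constant and drops out. The
  value on the right is taken at \<open>Suc n\<close>, where the truncated subtraction in the
  binomials is exact.\<close>

lemma fdiff_hpoly: "fdiff (hpoly (Suc s) e) n = hpoly s e (Suc n)"
proof -
  have "(Suc n + Suc s - i - 1) choose (Suc s - i) =
      ((n + Suc s - i - 1) choose (Suc s - i)) + ((Suc n + s - i - 1) choose (s - i))"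
    if "i \<le> s" for i
  proof -
    have "Suc n + Suc s - i - 1 = Suc (n + s - i)" "Suc s - i = Suc (s - i)"
      "n + Suc s - i - 1 = n + s - i" "Suc n + s - i - 1 = n + s - i"
      using that by auto
    then show ?thesis by simp
  qed
  then have "(\<Sum>i\<le>s. (- 1) ^ i * e i * int ((Suc n + Suc s - i - 1) choose (Suc s - i))) =
    (\<Sum>i\<le>s. (- 1) ^ i * e i * int ((n + Suc s - i - 1) choose (Suc s - i))) + hpoly s e (Suc n)"
    unfolding hpoly_def sum.distrib[symmetric]
    by (intro sum.cong) (auto simp: algebra_simps)
  then show ?thesis by (simp add: fdiff_def hpoly_def)
qed

lemma hpoly_cong: "(\<And>i. i \<le> s \<Longrightarrow> e i = e' i) \<Longrightarrow> hpoly s e n = hpoly s e' n"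
  by (simp add: hpoly_def)

lemma hpoly_upd: "hpoly (Suc s) (e(Suc s := v)) n = hpoly (Suc s) e n + (- 1) ^ Suc s * (v - e (Suc s))"
proof -
  have "(\<Sum>i\<le>s. (- 1) ^ i * (e(Suc s := v)) i * int ((n + Suc s - i - 1) choose (Suc s - i))) =
     (\<Sum>i\<le>s. (- 1) ^ i * e i * int ((n + Suc s - i - 1) choose (Suc s - i)))"
    by (intro sum.cong) auto
  then show ?thesis by (simp add: hpoly_def algebra_simps)
qed

lemma eventually_const:
  assumes "\<forall>\<^sub>F n in sequentially. fdiff f n = 0"
  obtains c where "\<forall>\<^sub>F n in sequentially. f n = c"
proof -
  obtain N where N: "\<And>n. n \<ge> N \<Longrightarrow> f (Suc n) = f n"
    using assms by (auto simp: eventually_sequentially fdiff_def)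
  have "f n = f N" if "n \<ge> N" for n
    using that
  proof (induct n rule: dec_induct)
    case (step n)
    then show ?case using N[OF step(1)] by metis
  qed simp
  then show ?thesis using that unfolding eventually_sequentially by blast
qed

lemma npoly_hpoly:
  assumes "npoly (Suc s) f"
  shows "\<exists>e. (\<forall>i>s. e i = 0) \<and> (\<forall>\<^sub>F n in sequentially. f n = hpoly s e n)"
  using assms
proof (induct s arbitrary: f)
  case 0
  then obtain c where "\<forall>\<^sub>F n in sequentially. f n = c"
    using eventually_const by (auto simp: npoly_Suc npoly_0)
  then show ?case by (intro exI[of _ "(\<lambda>_. 0)(0 := c)"]) (simp add: hpoly_0)
next
  case (Suc s)
  \<comment> \<open>The argument is shifted because \<open>fdiff_hpoly\<close> returns a value at
    \<open>Suc n\<close>.\<close>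
  have "npoly (Suc s) (\<lambda>n. fdiff f (n - 1))"
    using npoly_shift[of "Suc s" "\<lambda>n. fdiff f (n - 1)" 1] Suc(2) by (simp add: npoly_Suc[of "Suc s"])
  then obtain e where e: "\<And>i. i > s \<Longrightarrow> e i = 0" "\<forall>\<^sub>F n in sequentially. fdiff f (n - 1) = hpoly s e n"
    using Suc(1) by blast
  have "\<forall>\<^sub>F n in sequentially. fdiff f n = hpoly s e (Suc n)"
    using e(2) eventually_sequentially_Suc[of "\<lambda>n. fdiff f (n - 1) = hpoly s e n"] by simp
  then have "\<forall>\<^sub>F n in sequentially. fdiff (\<lambda>n. f n - hpoly (Suc s) e n) n = 0"
  proof eventually_elim
    case (elim n)
    then show ?case using fdiff_hpoly[of s e n] by (simp add: fdiff_def)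
  qed
  then obtain c where c: "\<forall>\<^sub>F n in sequentially. f n - hpoly (Suc s) e n = c"
    by (rule eventually_const)
  \<comment> \<open>The sign cancels the one that \<open>hpoly\<close> gives to its last
    coefficient, whose term is constant in \<open>n\<close>.\<close>
  let ?e = "e(Suc s := (- 1) ^ Suc s * c)"
  have "(- 1) ^ Suc s * ((- 1) ^ Suc s * c) = (c :: int)"
    by (simp add: mult.assoc[symmetric] power_mult_distrib[symmetric])
  then have "hpoly (Suc s) ?e n = hpoly (Suc s) e n + c" for n
    unfolding hpoly_upd using e(1)[of "Suc s"] by simp
  then have "\<forall>\<^sub>F n in sequentially. f n = hpoly (Suc s) ?e n"
    using c by (auto elim: eventually_mono)
  moreover have "\<forall>i>Suc s. ?e i = 0" using e(1) by simp
  ultimately show ?case by blast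
qed

text \<open>The differences determine all coefficients but the last, which is the remaining constant
  up to sign.\<close>

lemma hpoly_unique:
  assumes "\<forall>\<^sub>F n in sequentially. hpoly s e n = hpoly s e' n" "i \<le> s"
  shows "e i = e' i"
  using assms
proof (induct s arbitrary: i)
  case 0
  then show ?case by (simp add: hpoly_0)
next
  case (Suc s)
  have "\<forall>\<^sub>F n in sequentially. hpoly (Suc s) e (Suc n) = hpoly (Suc s) e' (Suc n)"
    using Suc(2) by (subst eventually_sequentially_Suc)
  with Suc(2) have "\<forall>\<^sub>F n in sequentially. hpoly s e (Suc n) = hpoly s e' (Suc n)"
  proof eventually_elim
    case (elim n)
    then show ?case using fdiff_hpoly[of s e n] fdiff_hpoly[of s e' n] by (simp add: fdiff_def)
  qed
  then have "\<forall>\<^sub>F n in sequentially. hpoly s e n = hpoly s e' n"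
    by (subst (asm) eventually_sequentially_Suc)
  from Suc(1)[OF this] have le: "e i = e' i" if "i \<le> s" for i using that .
  obtain n where n: "hpoly (Suc s) e n = hpoly (Suc s) e' n"
    using eventually_happens[OF Suc(2)] by auto
  have "hpoly (Suc s) e n = hpoly (Suc s) (e'(Suc s := e (Suc s))) n"
    by (rule hpoly_cong) (auto simp: le le_Suc_eq)
  then have "e (Suc s) = e' (Suc s)" using n by (simp add: hpoly_upd)
  then show ?case using le Suc(3) by (auto simp: le_Suc_eq)
qed

section \<open>Lengths of quotient modules\<close>

lemma (in cring) submodule_quot_module:
  assumes J: "ideal J R"
  shows "submodule N R (quot_module R J) \<longleftrightarrow> ideal N (R Quot J)"
proof -
  interpret J: ideal J R by fact
  have am: "subgroup N (add_monoid (quot_module R J)) \<longleftrightarrow> subgroup N (add_monoid (R Quot J))"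
    by (simp add: subgroup_def m_inv_def quot_module_def ring.defs)
  have sm: "a \<odot>\<^bsub>quot_module R J\<^esub> A = (J +> a) \<otimes>\<^bsub>R Quot J\<^esub> A" for a A
    by (simp add: quot_module_def ring.defs)
  have cr: "carrier (R Quot J) = (+>) J ` carrier R"
    by (auto simp: FactRing_def A_RCOSETS_def')
  interpret Q: cring "R Quot J" by (rule J.quotient_is_cring[OF is_cring])
  show ?thesis
  proof
    assume "submodule N R (quot_module R J)"
    then have N: "subgroup N (add_monoid (R Quot J))"
      and c: "\<And>a A. a \<in> carrier R \<Longrightarrow> A \<in> N \<Longrightarrow> (J +> a) \<otimes>\<^bsub>R Quot J\<^esub> A \<in> N"
      unfolding submodule_def submodule_axioms_def am sm by auto
    show "ideal N (R Quot J)"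
    proof (rule idealI[OF Q.ring_axioms N])
      fix A B assume AB: "A \<in> N" "B \<in> carrier (R Quot J)"
      then show "B \<otimes>\<^bsub>R Quot J\<^esub> A \<in> N" using c cr by auto
      then show "A \<otimes>\<^bsub>R Quot J\<^esub> B \<in> N"
        using AB Q.m_comm[of A B] subgroup.subset[OF N] by auto
    qed
  next
    assume N: "ideal N (R Quot J)"
    then show "submodule N R (quot_module R J)"
      unfolding submodule_def submodule_axioms_def am sm
      using additive_subgroup.a_subgroup[OF ideal.axioms(1)[OF N]] ideal.I_l_closed[OF N] cr by auto
  qed
qed

text \<open>The correspondence theorem; the inverse of \<open>K \<mapsto> K/J\<close> takes the
  union of the cosets.\<close>

lemma (in cring) module_length_quot_module:
  assumes J: "ideal J R"
  shows "module_length R (quot_module R J) = ilen R J (carrier R)"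
proof -
  have bij: "bij_betw (\<lambda>K. (+>) J ` K) {K. ideal K R \<and> J \<subseteq> K} {K. ideal K (R Quot J)}"
    by (rule quot_ideal_correspondence[OF J])
  have ib: "ideals_between R J (carrier R) = {K. ideal K R \<and> J \<subseteq> K}"
    using idl_sub by (auto simp: ideals_between_def)
  have U: "\<Union> ((+>) J ` K) = K" if "ideal K R" "J \<subseteq> K" for K
    using ideal_incl_iff[OF J that(1)] that by simp
  have inv: "\<exists>K. ideal K R \<and> J \<subseteq> K \<and> N = (+>) J ` K" if "ideal N (R Quot J)" for N
    using bij that unfolding bij_betw_def by blast
  show ?thesis
    unfolding module_length_def ilen_def submodule_quot_module[OF J] ib
  proof (rule antisym)
    show "chain_length {N. ideal N (R Quot J)} \<le> chain_length {K. ideal K R \<and> J \<subseteq> K}"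
    proof (rule chain_length_mono[where f = Union])
      fix N assume "N \<in> {N. ideal N (R Quot J)}"
      then show "\<Union>N \<in> {K. ideal K R \<and> J \<subseteq> K}" using inv U by fastforce
    next
      fix N N' assume N: "N \<in> {N. ideal N (R Quot J)}" "N' \<in> {N. ideal N (R Quot J)}" "N \<subset> N'"
      obtain K where K: "ideal K R" "J \<subseteq> K" "N = (+>) J ` K" using inv[of N] N(1) by auto
      moreover obtain K' where K': "ideal K' R" "J \<subseteq> K'" "N' = (+>) J ` K'" using inv[of N'] N(2) by auto
      ultimately have "\<Union>N = K" "\<Union>N' = K'" using U by simp_all
      then show "\<Union>N \<subset> \<Union>N'" using N(3) K(3) K'(3) Union_mono[of N N'] by (metis psubsetE psubsetI)
    qed
    show "chain_length {K. ideal K R \<and> J \<subseteq> K} \<le> chain_length {N. ideal N (R Quot J)}"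
    proof (rule chain_length_mono[where f = "\<lambda>K. (+>) J ` K"])
      fix K assume "K \<in> {K. ideal K R \<and> J \<subseteq> K}"
      then show "(+>) J ` K \<in> {N. ideal N (R Quot J)}" using bij unfolding bij_betw_def by blast
    next
      fix K K' assume K: "K \<in> {K. ideal K R \<and> J \<subseteq> K}" "K' \<in> {K. ideal K R \<and> J \<subseteq> K}" "K \<subset> K'"
      then have "\<Union> ((+>) J ` K) \<noteq> \<Union> ((+>) J ` K')" using U[of K] U[of K'] by simp
      then show "(+>) J ` K \<subset> (+>) J ` K'" using K(3) image_mono[of K K' "(+>) J"] by auto
    qed
  qed
qed

text \<open>Discharges the definite description: existence comes from the degree bound, uniqueness
  from \<open>hpoly_unique\<close> up to \<open>s\<close> and from the vanishing convention beyond
  \<open>s\<close>. The dimension has to be exactly \<open>s\<close>, as the description uses it as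
  the degree.\<close>

lemma (in cring) hilbert_coeff_hpoly:
  assumes Q: "ideal Q R" and s: "krull_dim R = enat s"
    and fin: "\<And>n. ilen R (ideal_power R Q n) (carrier R) \<noteq> \<infinity>"
    and np: "npoly (Suc s) (\<lambda>n. ilen_int R (ideal_power R Q n) (carrier R))"
  shows "\<forall>\<^sub>F n in sequentially. ilen_int R (ideal_power R Q n) (carrier R) = hpoly s (hilbert_coeff R Q) n"
proof -
  let ?P = "\<lambda>e. (\<forall>i>s. e i = 0) \<and>
    (\<forall>\<^sub>F n in sequentially. ilen_int R (ideal_power R Q n) (carrier R) = hpoly s e n)"
  have "(\<exists>l. module_length R (quot_module R (ideal_power R Q n)) = enat l \<and> int l = k) \<longleftrightarrow>
      ilen_int R (ideal_power R Q n) (carrier R) = k" for n k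
    using fin[of n] by (auto simp: module_length_quot_module[OF ideal_power_ideal[OF Q]] ilen_int_def)
  then have eq: "hilbert_coeff R Q = (THE e. ?P e)"
    unfolding hilbert_coeff_def Let_def s hpoly_def by simp
  obtain e where e: "?P e" using npoly_hpoly[OF np] by blast
  have "e' = e" if "?P e'" for e'
  proof
    fix i
    have "\<forall>\<^sub>F n in sequentially. hpoly s e' n = hpoly s e n"
      using conjunct2[OF e] conjunct2[OF that] by eventually_elim simp
    then show "e' i = e i" using hpoly_unique[of s e' e i] e that by (cases "i \<le> s") auto
  qed
  then have "?P (THE e. ?P e)" using e by (intro theI[of ?P e])
  then show ?thesis unfolding eq by blast
qed

text \<open>The description refers to large powers only, so the two defining conditions are
  equivalent, whether or not they can be satisfied.\<close>

lemma hilbert_coeff_cong: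
  assumes "\<forall>\<^sub>F n in sequentially. ideal_power A Q n = ideal_power A Q' n"
  shows "hilbert_coeff A Q = hilbert_coeff A Q'"
proof -
  show ?thesis
    unfolding hilbert_coeff_def Let_def
    by (intro arg_cong[where f = The] ext arg_cong2[where f = "(\<and>)"] refl eventually_cong[OF assms]) simp
qed

section \<open>Ideals of finite colength in local rings\<close>

lemma (in cring) ilen_int_eqD:
  assumes "ideal V R" "ideal V' R" "V \<subseteq> V'" "ilen R V (carrier R) \<noteq> \<infinity>"
    and "ilen_int R V (carrier R) = ilen_int R V' (carrier R)"
  shows "V = V'"
proof (rule ccontr)
  assume "V \<noteq> V'"
  note a = ilen_int_add[OF assms(1,2) oneideal assms(3) idl_sub[OF assms(2)] assms(4)]
  have "ilen R V V' \<ge> 1" using assms \<open>V \<noteq> V'\<close> by (intro ilen_pos) auto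
  then have "ilen_int R V V' \<ge> 1"
    using a(2) by (cases "ilen R V V'") (auto simp: ilen_int_def one_enat_def)
  then show False using a(1) assms(5) by simp
qed

lemma (in noetherian_ring) finite_generators:
  assumes "ideal Q R"
  obtains x s where "\<And>i. i < (s::nat) \<Longrightarrow> x i \<in> carrier R" "Q = Idl (x ` {..<s})"
proof -
  obtain G where G: "G \<subseteq> carrier R" "finite G" "Q = Idl G" using finetely_gen[OF assms] by blast
  obtain x where "x ` {..<card G} = G"
    using ex_bij_betw_nat_finite[OF G(2)] by (auto simp: bij_betw_def atLeast0LessThan)
  then show ?thesis using that[of "card G" x] G by auto
qed

sublocale noetherian_local_ring \<subseteq> noetherian_cring ..

context noetherian_local_ring
begin

lemma mm_ideal: "ideal \<mm> R"
  using maximalideal_mm by (rule maximalideal.axioms)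

lemma mm_proper: "\<mm> \<noteq> carrier R"
  using maximalideal.I_notcarr[OF maximalideal_mm] by simp

lemma proper_ideal_sub_mm:
  assumes "ideal J R" "J \<noteq> carrier R" shows "J \<subseteq> \<mm>"
proof -
  let ?F = "{K. ideal K R \<and> J \<subseteq> K \<and> K \<noteq> carrier R}"
  have "J \<in> ?F" using assms by auto
  then have "?F \<noteq> {}" by blast
  then obtain M where M: "M \<in> ?F" "\<And>K. K \<in> ?F \<Longrightarrow> \<not> M \<subset> K"
    by (rule ideal_maximal_element) (simp, rule that)
  have "maximalideal M R"
  proof (rule maximalidealI)
    fix K assume K: "ideal K R" "M \<subseteq> K" "K \<subseteq> carrier R"
    show "K = M \<or> K = carrier R"
    proof (rule ccontr)
      assume "\<not> ?thesis"
      then have "K \<in> ?F" "M \<subset> K" using K M(1) by auto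
      then show False using M(2) by blast
    qed
  qed (use M(1) in auto)
  then show ?thesis using unique_maximalideal M by blast
qed

lemma unit_outside_mm:
  assumes "a \<in> carrier R" "a \<notin> \<mm>"
  obtains b where "b \<in> carrier R" "b \<otimes> a = \<one>"
proof -
  have "PIdl a = carrier R"
    using proper_ideal_sub_mm[OF cgenideal_ideal[OF assms(1)]] cgenideal_self[OF assms(1)] assms(2) by blast
  then have "\<one> \<in> PIdl a" by simp
  then show ?thesis using that by (auto simp: cgenideal_def)
qed

lemma prime_sub_mm: "primeideal P R \<Longrightarrow> P \<subseteq> \<mm>"
  using proper_ideal_sub_mm primeideal.I_notcarr primeideal.axioms(1) by blast

text \<open>As \<open>\<mm>u \<subseteq> V\<close>, the quotient is zero or simple: an element
  outside \<open>V\<close> has the form \<open>v + au\<close> with \<open>a\<close> a unit, and so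
  generates everything modulo \<open>V\<close>. A chain of length 2 cannot exist.\<close>

lemma ilen_principal_step:
  assumes V: "ideal V R" and u: "u \<in> carrier R" and mu: "\<And>a. a \<in> \<mm> \<Longrightarrow> a \<otimes> u \<in> V"
  shows "ilen R V (V <+> PIdl u) \<noteq> \<infinity>"
proof
  assume inf: "ilen R V (V <+> PIdl u) = \<infinity>"
  have ne: "ideals_between R V (V <+> PIdl u) \<noteq> {}"
    using V set_add_l[OF V cgenideal_ideal[OF u]] by (auto simp: ideals_between_def)
  have "enat 2 \<le> ilen R V (V <+> PIdl u)" using inf by simp
  then obtain C where C: "strict_chain (ideals_between R V (V <+> PIdl u)) 2 C"
    unfolding ilen_def chain_length_ge_iff[OF ne] by blast
  have C1: "ideal (C 1) R" "V \<subseteq> C 1" "C 1 \<subseteq> V <+> PIdl u" and C2: "C 2 \<subseteq> V <+> PIdl u" and C0: "V \<subseteq> C 0"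
    using C by (auto simp: strict_chain_def ideals_between_def)
  have "C 0 \<subset> C (Suc 0)" "C (Suc 0) \<subset> C (Suc (Suc 0))"
    using C unfolding strict_chain_def by (auto simp del: One_nat_def)
  then have s: "C 0 \<subset> C 1" "C 1 \<subset> C 2" by (simp_all add: numeral_2_eq_2)
  obtain w where w: "w \<in> C 1" "w \<notin> V" using s(1) C0 by blast
  then have "w \<in> V <+> PIdl u" using C1 by blast
  then obtain v a where va: "v \<in> V" "a \<in> carrier R" "w = v \<oplus> a \<otimes> u"
    by (auto simp: set_add_mem cgenideal_def)
  have "a \<notin> \<mm>" using mu[of a] va w(2) idl_add[OF V] by auto
  then obtain b where b: "b \<in> carrier R" "b \<otimes> a = \<one>" using unit_outside_mm va(2) by blast
  have "a \<otimes> u \<in> C 1"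
    by (rule idl_add_cancel[OF C1(1), of v]) (use va w C1(2) u in auto)
  then have "b \<otimes> (a \<otimes> u) \<in> C 1" using idl_l[OF C1(1)] b by blast
  then have "u \<in> C 1" using b u va(2) m_assoc[of b a u] by simp
  then have "V <+> PIdl u \<subseteq> C 1" using C1 cgenideal_minimal by (intro set_add_least) auto
  then show False using s(2) C2 by blast
qed

text \<open>\<open>U / V\<close> is a finitely generated vector space over the residue field.
  Instead of a basis, a maximal \<open>W\<close> of finite length over \<open>V\<close> is taken; if
  \<open>W \<noteq> U\<close>, one more generator enlarges it.\<close>

lemma ilen_finite_step:
  assumes V: "ideal V R" and U: "ideal U R" and VU: "V \<subseteq> U"
    and mu: "\<And>a u. a \<in> \<mm> \<Longrightarrow> u \<in> U \<Longrightarrow> a \<otimes> u \<in> V"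
  shows "ilen R V U \<noteq> \<infinity>"
proof -
  let ?F = "{W. ideal W R \<and> V \<subseteq> W \<and> W \<subseteq> U \<and> ilen R V W \<noteq> \<infinity>}"
  have "V \<in> ?F" using V VU ilen_self[OF V] by (simp add: zero_enat_def)
  then have "?F \<noteq> {}" by blast
  then obtain W where W: "W \<in> ?F" "\<And>K. K \<in> ?F \<Longrightarrow> \<not> W \<subset> K"
    by (rule ideal_maximal_element) (simp, rule that)
  have "W = U"
  proof (rule ccontr)
    assume "W \<noteq> U"
    then obtain u where u: "u \<in> U" "u \<notin> W" using W by blast
    have uc: "u \<in> carrier R" using u U idl_carr by blast
    let ?K = "W <+> PIdl u"
    have iW: "ideal W R" and pu: "ideal (PIdl u) R" using W cgenideal_ideal[OF uc] by auto
    have WK: "W \<subseteq> ?K" "u \<in> ?K"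
      using set_add_l[OF iW pu] set_add_r[OF iW pu] cgenideal_self[OF uc] by auto
    have "ilen R W ?K \<noteq> \<infinity>" by (rule ilen_principal_step[OF iW uc]) (use mu u W in blast)
    then have "ilen R V ?K \<noteq> \<infinity>"
      using ilen_add[OF V iW add_ideals[OF iW pu]] W WK plus_eq_infty_iff_enat by force
    moreover have "?K \<subseteq> U" using W cgenideal_minimal[OF U u(1)] by (intro set_add_least[OF U]) auto
    ultimately have "?K \<in> ?F" using W WK add_ideals[OF iW pu] by auto
    then show False using W(2)[of ?K] WK u by blast
  qed
  then show ?thesis using W by blast
qed

lemma ilen_mm_power: "ilen R (ideal_power R \<mm> n) (carrier R) \<noteq> \<infinity>"
proof (induct n)
  case 0
  then show ?case by (simp add: ideal_power_0 ilen_self oneideal)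
next
  case (Suc n)
  note i = ideal_power_ideal[OF mm_ideal]
  have "ilen R (ideal_power R \<mm> (Suc n)) (ideal_power R \<mm> n) \<noteq> \<infinity>"
    by (rule ilen_finite_step[OF i i ideal_power_Suc_subset[OF mm_ideal]])
      (rule ideal_power_Suc_mem[OF mm_ideal])
  then show ?case
    using Suc ilen_add[OF i i oneideal ideal_power_Suc_subset[OF mm_ideal] idl_sub[OF i], of n]
    by (metis plus_eq_infty_iff_enat)
qed

lemma ilen_primary_power:
  assumes "ideal_power R \<mm> k \<subseteq> Q"
  shows "ilen R (ideal_power R Q n) (carrier R) \<noteq> \<infinity>"
proof (rule ilen_finite_mono[OF ilen_mm_power _ subset_refl])
  show "ideal_power R \<mm> (k * n) \<subseteq> ideal_power R Q n"
    using ideal_power_mono[OF assms] ideal_power_mult[OF mm_ideal] by metis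
qed

text \<open>Krull's height theorem for the maximal ideal.\<close>

lemma primary_dim_le:
  assumes x: "\<And>i. i < s \<Longrightarrow> x i \<in> \<mm>" and mk: "ideal_power R \<mm> k \<subseteq> Idl (x ` {..<s})"
  shows "krull_dim R \<le> enat s"
proof -
  have xc: "i < s \<Longrightarrow> x i \<in> carrier R" for i using x idl_carr[OF mm_ideal] by blast
  interpret fin_colength_ideal R x s "Idl (x ` {..<s})"
    using ilen_primary_power[OF mk] by unfold_locales (auto intro: xc)
  show ?thesis
    by (rule krull_dim_le[OF mm_ideal mm_proper _ prime_sub_mm])
      (rule genideal_minimal[OF mm_ideal], use x in auto)
qed

text \<open>\<open>Q\<close> may need more than \<open>s\<close> generators, and these bound the
  degree only by their own number \<open>t\<close>. The bound \<open>s\<close> comes from comparison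
  with the smaller ideal generated by \<open>x\<close>, whose powers have larger colength.\<close>

lemma primary_npoly:
  assumes x: "\<And>i. i < s \<Longrightarrow> x i \<in> \<mm>" and mk: "ideal_power R \<mm> k \<subseteq> Idl (x ` {..<s})"
    and Q: "ideal Q R" "Idl (x ` {..<s}) \<subseteq> Q"
  shows "npoly (Suc s) (\<lambda>n. ilen_int R (ideal_power R Q n) (carrier R))"
proof -
  have z: "{\<zero>} <+> J = J" if "ideal J R" for J
    using that idl_carr[OF that] by (auto simp: set_add_mem)
  have mkQ: "ideal_power R \<mm> k \<subseteq> Q" using mk Q by blast
  obtain y t where y: "\<And>i. i < (t::nat) \<Longrightarrow> y i \<in> carrier R" "Q = Idl (y ` {..<t})"
    using finite_generators[OF Q(1)] by blast
  have xc: "i < s \<Longrightarrow> x i \<in> carrier R" for i using x idl_carr[OF mm_ideal] by blast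
  interpret J: fin_colength_ideal R x s "Idl (x ` {..<s})"
    using ilen_primary_power[OF mk] by unfold_locales (auto intro: xc)
  interpret Q: fin_colength_ideal R y t Q
    using ilen_primary_power[OF mkQ] y by unfold_locales auto
  have 1: "npoly (Suc t) (\<lambda>n. ilen_int R (ideal_power R Q n) (carrier R))"
    using Q.npoly_hf[OF zeroideal] z[OF Q.qp_ideal] by (simp add: Q.hf_def[abs_def])
  have 2: "npoly (Suc s) (\<lambda>n. ilen_int R (ideal_power R (Idl (x ` {..<s})) n) (carrier R))"
    using J.npoly_hf[OF zeroideal] z[OF J.qp_ideal] by (simp add: J.hf_def[abs_def])
  show ?thesis
  proof (rule npoly_comparison[OF 1 2])
    have "ilen_int R (ideal_power R Q n) (carrier R) \<le>
        ilen_int R (ideal_power R (Idl (x ` {..<s})) n) (carrier R)" for n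
      by (rule ilen_int_mono[OF ideal_power_mono[OF Q(2)] subset_refl J.fin])
    then show "\<forall>\<^sub>F n in sequentially. ilen_int R (ideal_power R Q n) (carrier R) \<le>
        ilen_int R (ideal_power R (Idl (x ` {..<s})) n) (carrier R)" by simp
  qed simp
qed

end

section \<open>The Ratliff--Rush closure\<close>

context cring
begin

lemma ideal_pow_mem: "ideal I R \<Longrightarrow> a \<in> I \<Longrightarrow> a [^] n \<in> ideal_power R I n"
  by (induct n) (simp_all add: ideal_power_0 ideal_power_Suc nat_pow_Suc ideal_prod.prod)

lemma regular_pow:
  assumes "regular_element R a" shows "regular_element R (a [^] (n::nat))"
proof (induct n)
  case (Suc n)
  have a: "a \<in> carrier R" using assms by (simp add: regular_element_def)
  have "x = \<zero>" if x: "x \<in> carrier R" "a [^] Suc n \<otimes> x = \<zero>" for x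
  proof -
    have "a [^] n \<otimes> (a \<otimes> x) = \<zero>" using x a by (simp add: nat_pow_Suc m_assoc)
    then have "a \<otimes> x = \<zero>" using Suc a x by (auto simp: regular_element_def)
    then show ?thesis using assms x by (auto simp: regular_element_def)
  qed
  then show ?case using a by (auto simp: regular_element_def)
qed (simp add: regular_element_def)

lemma regular_cancel:
  assumes "regular_element R b" "x \<in> carrier R" "y \<in> carrier R" "b \<otimes> x = b \<otimes> y" shows "x = y"
proof -
  have b: "b \<in> carrier R" using assms by (simp add: regular_element_def)
  have "b \<otimes> (x \<ominus> y) = b \<otimes> x \<ominus> b \<otimes> y" using b assms(2,3) by algebra
  also have "\<dots> = \<zero>" unfolding assms(4) using b assms(3) by algebra
  finally have "x \<ominus> y = \<zero>" using assms by (auto simp: regular_element_def)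
  then show ?thesis using assms by simp
qed

lemma ideal_colon_ideal:
  assumes "ideal I R" "ideal J R" shows "ideal (ideal_colon R I J) R"
  unfolding ideal_colon_def
  by (rule cring_idealI)
    (use assms in \<open>auto simp: idl_carr idl_zero idl_add idl_l l_distr m_assoc\<close>)

lemma ideal_colon_prod:
  assumes "ideal I R" shows "ideal_colon R I J \<cdot> J \<subseteq> I"
  by (rule ideal_prod_least[OF assms]) (auto simp: ideal_colon_def)

end

context noetherian_cring
begin

text \<open>
  Let \<open>K\<close> be the closure, so that \<open>K I^N \<subseteq> I^(N+1)\<close> and hence \<open>K^j I^N \<subseteq> I^(N+j)\<close>. Multiplying by a regular
  element of \<open>I^N\<close>, the Artin--Rees lemma gives \<open>K^(n+c) \<subseteq> I^n\<close>. Hence \<open>\<Oplus>n. K^(n+c)\<close> is finitely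
  generated over the Rees algebra of \<open>I\<close>, that is, \<open>K^(n+1) = I K^n\<close> for large \<open>n\<close>.
\<close>

lemma ratliff_rush_closure:
  assumes I: "ideal I R" and a: "a \<in> I" "regular_element R a"
  shows "ideal (ratliff_rush R I) R" "I \<subseteq> ratliff_rush R I"
    "\<exists>N. \<forall>n\<ge>N. ideal_power R (ratliff_rush R I) n = ideal_power R I n"
    "\<And>n. n \<ge> 1 \<Longrightarrow> ideal_colon R (ideal_power R I (n + 1)) (ideal_power R I n) \<subseteq> ratliff_rush R I"
proof -
  let ?C = "\<lambda>n. ideal_colon R (ideal_power R I (n + 1)) (ideal_power R I n)"
  note iI = ideal_power_ideal[OF I]
  have C: "ideal (?C n) R" for n by (rule ideal_colon_ideal[OF iI iI])
  have CSuc: "?C n \<subseteq> ?C (Suc n)" for n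
  proof
    fix x assume x: "x \<in> ?C n"
    then have xc: "x \<in> carrier R" by (simp add: ideal_colon_def)
    let ?D = "{y \<in> carrier R. x \<otimes> y \<in> ideal_power R I (Suc n + 1)}"
    have "ideal_power R I n \<cdot> I \<subseteq> ?D"
    proof (rule ideal_prod_least)
      show "ideal ?D R" by (rule ideal_colon_elt[OF oneideal iI xc])
      fix i j assume ij: "i \<in> ideal_power R I n" "j \<in> I"
      have c: "i \<in> carrier R" "j \<in> carrier R" using ij I iI idl_carr by auto
      have "(x \<otimes> i) \<otimes> j \<in> ideal_power R I (Suc n + 1)"
        using x ij unfolding ideal_power_Suc[of R I "n + 1", simplified] ideal_colon_def
        by (auto intro: ideal_prod.prod simp: ideal_power_Suc)
      then show "i \<otimes> j \<in> ?D" using c xc by (simp add: m_assoc)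
    qed
    then show "x \<in> ?C (Suc n)" using xc by (auto simp: ideal_colon_def ideal_power_Suc)
  qed
  obtain N0 where N0: "\<And>n. n \<ge> N0 \<Longrightarrow> ?C n = ?C N0"
    using ascending_ideals_stationary[of ?C, OF C CSuc] by blast
  \<comment> \<open>A successor, because the union in \<open>ratliff_rush\<close> starts at
    1.\<close>
  define N where "N = Suc N0"
  have mono: "m \<le> n \<Longrightarrow> ?C m \<subseteq> ?C n" for m n
    by (rule lift_Suc_mono_le[of ?C]) (use CSuc in auto)
  have CN: "?C n \<subseteq> ?C N" for n
    using mono[of n "max n N"] N0[of "max n N"] N0[of N] by (auto simp: N_def)
  define K where "K = ratliff_rush R I"
  have K: "K = ?C N" unfolding K_def ratliff_rush_def using CN by (auto simp: N_def)
  show "\<And>n. n \<ge> 1 \<Longrightarrow> ?C n \<subseteq> ratliff_rush R I" using CN K unfolding K_def by auto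
  have iK: "ideal K R" unfolding K by (rule C)
  then show "ideal (ratliff_rush R I) R" by (simp add: K_def)
  have IK: "I \<subseteq> K"
  proof
    fix x assume x: "x \<in> I"
    then have "x \<in> ?C N"
      using idl_carr[OF I x] ideal_power_Suc_mem[OF I x] by (auto simp: ideal_colon_def)
    then show "x \<in> K" by (simp add: K)
  qed
  then show "I \<subseteq> ratliff_rush R I" by (simp add: K_def)
  note iKp = ideal_power_ideal[OF iK]
  let ?I = "ideal_power R I" and ?K = "ideal_power R K"
  have "K \<cdot> ?I N \<subseteq> ?I (Suc N)" unfolding K using ideal_colon_prod[OF iI, of "N + 1" "?I N"] by simp
  have KI: "?K j \<cdot> ?I N \<subseteq> ?I (N + j)" for j
  proof (induct j)
    case 0
    show ?case using ideal_prod_inter[OF iKp iI, of 0 N] by simp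
  next
    case (Suc j)
    have "?K (Suc j) \<cdot> ?I N = ?K j \<cdot> (K \<cdot> ?I N)"
      using ideal_prod_assoc[OF iKp iK iI] by (simp add: ideal_power_Suc)
    also have "\<dots> \<subseteq> ?K j \<cdot> (?I N \<cdot> I)"
      using \<open>K \<cdot> ?I N \<subseteq> ?I (Suc N)\<close> by (intro ideal_prod_mono[OF subset_refl]) (simp add: ideal_power_Suc)
    also have "\<dots> = (?K j \<cdot> ?I N) \<cdot> I" using ideal_prod_assoc[OF iKp iI I] by simp
    also have "\<dots> \<subseteq> ?I (N + j) \<cdot> I" by (rule ideal_prod_mono[OF Suc subset_refl])
    finally show ?case by (simp add: ideal_power_Suc)
  qed
  define b where "b = a [^] N"
  have bI: "b \<in> ?I N" and br: "regular_element R b"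
    unfolding b_def using ideal_pow_mem[OF I a(1)] regular_pow[OF a(2)] by auto
  then have bc: "b \<in> carrier R" by (simp add: regular_element_def)
  obtain x t where x: "\<And>i. i < (t::nat) \<Longrightarrow> x i \<in> carrier R" "I = Idl (x ` {..<t})"
    using finite_generators[OF I] by blast
  interpret G: fin_gen_ideal R x t I by unfold_locales (use x in auto)
  obtain c where c: "\<And>n. n \<ge> c \<Longrightarrow> ?I n \<inter> ({\<zero>} <+> PIdl b) \<subseteq> {\<zero>} <+> (\<otimes>) b ` ?I (n - c)"
    using G.artin_rees[OF zeroideal bc] by blast
  \<comment> \<open>For \<open>y \<in> K^(n+c)\<close>, the product \<open>by\<close> lies in
    \<open>I^(N+n+c)\<close> and in \<open>bR\<close>, hence in \<open>b I^(N+n)\<close>; the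
    regular element \<open>b\<close> cancels.\<close>
  have KcI: "?K (n + c) \<subseteq> ?I n" for n
  proof
    fix y assume y: "y \<in> ?K (n + c)"
    then have yc: "y \<in> carrier R" using iKp idl_carr by blast
    have "b \<otimes> y \<in> ?I (N + (n + c))"
      using subsetD[OF KI[of "n + c"] ideal_prod.prod[OF y bI]] m_comm[OF yc bc] by simp
    moreover have "b \<otimes> y = \<zero> \<oplus> y \<otimes> b" using yc bc m_comm by simp
    then have "b \<otimes> y \<in> {\<zero>} <+> PIdl b" using yc by (auto simp: set_add_mem cgenideal_def)
    ultimately have "b \<otimes> y \<in> {\<zero>} <+> (\<otimes>) b ` ?I (N + (n + c) - c)" using c[of "N + (n + c)"] by auto
    then obtain z where z: "z \<in> ?I (N + n)" "b \<otimes> y = \<zero> \<oplus> b \<otimes> z" by (auto simp: set_add_mem)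
    have zc: "z \<in> carrier R" using z(1) iI idl_carr by blast
    then have "y = z" using regular_cancel[OF br yc] z(2) bc by simp
    then show "y \<in> ?I n" using z(1) ideal_power_antimono[OF I, of n "N + n"] by auto
  qed
  \<comment> \<open>The shift by \<open>c\<close> embeds the powers of \<open>K\<close> into the
    Rees algebra of \<open>I\<close>, where graded submodules are finitely generated.\<close>
  have "fin_gen R x t (\<lambda>_. {\<zero>}) (\<lambda>n. ?K (n + c))"
  proof (rule graded_noetherian[OF order_refl x(1) G.qp_graded])
    show "graded_sub R x t (\<lambda>_. {\<zero>})" using x(1) by (auto simp: graded_sub_def zeroideal)
    show "graded_sub R x t (\<lambda>n. ?K (n + c))"
      unfolding graded_sub_def
      using iKp ideal_power_Suc_mem[OF iK subsetD[OF IK G.x_mem]] by simp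
    show "{\<zero>} \<subseteq> ?K (n + c)" for n using idl_zero[OF iKp] by simp
    show "fin_gen R x t (\<lambda>_. {\<zero>}) ?I" unfolding fin_gen_def using G.qp_gen_at by blast
  qed (use KcI in auto)
  then obtain M0 where M0: "\<And>n. n \<ge> M0 \<Longrightarrow> gen_at R x t (\<lambda>_. {\<zero>}) (\<lambda>n. ?K (n + c)) n"
    unfolding fin_gen_def by blast
  define M where "M = M0 + c"
  have step: "?K (Suc n) \<subseteq> I \<cdot> ?K n" if "n \<ge> M" for n
  proof -
    have iT: "ideal (I \<cdot> ?K n) R" by (rule ideal_prod_is_ideal[OF I iKp])
    have n: "n - c + c = n" "Suc (n - c) + c = Suc n" using that by (auto simp: M_def)
    have "?K (Suc (n - c) + c) \<subseteq> I \<cdot> ?K n"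
      by (rule gen_atD[OF M0 iT])
        (use that idl_zero[OF iT] G.x_mem in \<open>auto simp: M_def intro: ideal_prod.prod\<close>)
    then show ?thesis unfolding n .
  qed
  have pow: "?K (M + i) \<subseteq> ?I i \<cdot> ?K M" for i
  proof (induct i)
    case 0
    show ?case using ideal_prod_commute[OF oneideal iKp, of M] iKp by (simp add: ideal_power_0 ideal_prod_one)
  next
    case (Suc i)
    have "?K (M + Suc i) \<subseteq> I \<cdot> ?K (M + i)" using step[of "M + i"] by simp
    also have "\<dots> \<subseteq> I \<cdot> (?I i \<cdot> ?K M)" by (rule ideal_prod_mono[OF subset_refl Suc])
    also have "\<dots> = (?I i \<cdot> I) \<cdot> ?K M"
      using ideal_prod_assoc[OF I iI iKp] ideal_prod_commute[OF I iI] by simp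
    finally show ?case by (simp add: ideal_power_Suc)
  qed
  \<comment> \<open>With \<open>n = M + i + N\<close>, repeated use of
    \<open>K^(m+1) \<subseteq> I K^m\<close> gives \<open>K^n \<subseteq> I^i I^N K^M\<close>, and
    \<open>I^N K^M \<subseteq> I^(N+M)\<close>.\<close>
  have "?K n = ?I n" if "n \<ge> M + N" for n
  proof
    define i where "i = n - M - N"
    have n: "n = M + (i + N)" using that by (simp add: i_def)
    have "?K n \<subseteq> (?I i \<cdot> ?I N) \<cdot> ?K M" using pow[of "i + N"] ideal_power_add[OF I] by (simp add: n)
    also have "\<dots> = ?I i \<cdot> (?K M \<cdot> ?I N)"
      using ideal_prod_assoc[OF iI iI iKp] ideal_prod_commute[OF iI iKp] by simp
    also have "\<dots> \<subseteq> ?I i \<cdot> ?I (N + M)" by (rule ideal_prod_mono[OF subset_refl KI])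
    also have "\<dots> = ?I n" by (simp add: n ideal_power_add[OF I, symmetric] add.commute add.left_commute)
    finally show "?K n \<subseteq> ?I n" .
    show "?I n \<subseteq> ?K n" by (rule ideal_power_mono[OF IK])
  qed
  then show "\<exists>N. \<forall>n\<ge>N. ideal_power R (ratliff_rush R I) n = ideal_power R I n"
    unfolding K_def by blast
qed

end

section \<open>Primary decomposition\<close>

text \<open>The contraction to \<open>R\<close> of the extension of \<open>J\<close> to
  \<open>R_P\<close>; for \<open>P\<close> minimal over \<open>J\<close> it is the
  \<open>P\<close>-primary component.\<close>

definition saturation :: "('a, 'b) ring_scheme \<Rightarrow> 'a set \<Rightarrow> 'a set \<Rightarrow> 'a set" where
  "saturation R P J = {x \<in> carrier R. \<exists>u \<in> carrier R - P. u \<otimes>\<^bsub>R\<^esub> x \<in> J}"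

context cring
begin

text \<open>The factor \<open>c\<close> collects what has been split off: each step moves one factor
  \<open>a\<close> or \<open>b\<close> from the power of the sum into \<open>c\<close>. This
  replaces the binomial expansion.\<close>

lemma pow_add_mem:
  assumes J: "ideal J R" and ab: "a \<in> carrier R" "b \<in> carrier R"
    and "c \<in> carrier R" "c \<otimes> a [^] (n::nat) \<in> J" "c \<otimes> b [^] (m::nat) \<in> J"
  shows "c \<otimes> (a \<oplus> b) [^] (n + m) \<in> J"
  using assms(4-)
proof (induct "n + m" arbitrary: n m c rule: less_induct)
  case less
  note c = less(2)
  show ?case
  proof (cases "n = 0 \<or> m = 0")
    case True
    then have "c \<in> J" using less(3,4) c by auto
    then show ?thesis using ab J by (auto intro: idl_r)
  next
    case False
    then obtain n' m' where nm: "n = Suc n'" "m = Suc m'" by (metis not0_implies_Suc)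
    have 1: "(c \<otimes> a) \<otimes> (a \<oplus> b) [^] (n' + m) \<in> J"
    proof (rule less(1))
      show "c \<otimes> a \<otimes> a [^] n' \<in> J" using less(3) ab c by (simp add: nm nat_pow_Suc m_ac)
      have "a \<otimes> (c \<otimes> b [^] m) \<in> J" using less(4) ab J by (auto intro: idl_l)
      then show "c \<otimes> a \<otimes> b [^] m \<in> J" using ab c by (simp add: m_ac)
    qed (use nm ab c in auto)
    have 2: "(c \<otimes> b) \<otimes> (a \<oplus> b) [^] (n + m') \<in> J"
    proof (rule less(1))
      show "c \<otimes> b \<otimes> b [^] m' \<in> J" using less(4) ab c by (simp add: nm nat_pow_Suc m_ac)
      have "b \<otimes> (c \<otimes> a [^] n) \<in> J" using less(3) ab J by (auto intro: idl_l)
      then show "c \<otimes> b \<otimes> a [^] n \<in> J" using ab c by (simp add: m_ac)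
    qed (use nm ab c in auto)
    define p where "p = (a \<oplus> b) [^] (n' + m)"
    have pc: "p \<in> carrier R" using ab by (simp add: p_def)
    have e: "n + m = Suc (n' + m)" "n + m' = n' + m" using nm by auto
    have "c \<otimes> (a \<oplus> b) [^] (n + m) = c \<otimes> a \<otimes> p \<oplus> c \<otimes> b \<otimes> p"
      unfolding e(1) nat_pow_Suc p_def[symmetric] using ab c pc by (simp add: r_distr m_ac)
    moreover have "c \<otimes> b \<otimes> p \<in> J" using 2 unfolding e(2) p_def .
    ultimately show ?thesis using 1 idl_add[OF J] by (simp add: p_def)
  qed
qed

lemma radical_ideal:
  assumes J: "ideal J R" shows "ideal (radical R J) R"
proof (rule cring_idealI)
  fix x y assume "x \<in> radical R J" "y \<in> radical R J"
  then obtain n m :: nat where "x \<in> carrier R" "y \<in> carrier R" "x [^] n \<in> J" "y [^] m \<in> J"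
    by (auto simp: radical_def)
  then show "x \<oplus> y \<in> radical R J"
    using pow_add_mem[OF J, of x y \<one> n m] idl_carr[OF J] by (auto simp: radical_def)
next
  have "\<zero> [^] Suc 0 \<in> J" using idl_zero[OF J] by (simp add: nat_pow_Suc)
  then show "\<zero> \<in> radical R J" unfolding radical_def by blast
next
  fix a x assume "a \<in> carrier R" "x \<in> radical R J"
  then obtain n :: nat where x: "x \<in> carrier R" "x [^] n \<in> J" by (auto simp: radical_def)
  then have "(a \<otimes> x) [^] n \<in> J"
    using idl_l[OF J x(2)] \<open>a \<in> carrier R\<close> by (simp add: nat_pow_distrib)
  then show "a \<otimes> x \<in> radical R J"
    using x(1) \<open>a \<in> carrier R\<close> by (auto simp: radical_def)
qed (auto simp: radical_def)

lemma radical_sub: "ideal J R \<Longrightarrow> J \<subseteq> radical R J"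
  using idl_carr[of J] by (auto simp: radical_def intro!: exI[of _ "1::nat"] simp: nat_pow_Suc)

lemma prime_powD:
  assumes "primeideal P R" "a \<in> carrier R" "a [^] (n::nat) \<in> P" shows "a \<in> P"
  using assms(3)
proof (induct n)
  case 0
  then show ?case using assms(1,2)
    by (metis nat_pow_0 ideal.one_imp_carrier primeideal.axioms(1))
next
  case (Suc n)
  then show ?case
    using primeideal.I_prime[OF assms(1), of "a [^] n" a] assms(2) by (auto simp: nat_pow_Suc)
qed

lemma radical_sub_prime: "primeideal P R \<Longrightarrow> J \<subseteq> P \<Longrightarrow> radical R J \<subseteq> P"
  using prime_powD by (auto simp: radical_def)

lemma primary_radical_prime:
  assumes Q: "primary_ideal R Q" shows "primeideal (radical R Q) R"
proof -
  have iQ: "ideal Q R" and nQ: "Q \<noteq> carrier R"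
    and pQ: "\<And>a b. a \<in> carrier R \<Longrightarrow> b \<in> carrier R \<Longrightarrow> a \<otimes> b \<in> Q \<Longrightarrow> a \<in> Q \<or> b \<in> radical R Q"
    using Q by (auto simp: primary_ideal_def)
  show ?thesis
  proof (rule primeidealI[OF radical_ideal[OF iQ] is_cring])
    have "\<one> \<notin> radical R Q" using nQ ideal.one_imp_carrier[OF iQ] by (auto simp: radical_def)
    then show "carrier R \<noteq> radical R Q" by auto
  next
    fix a b assume ab: "a \<in> carrier R" "b \<in> carrier R" "a \<otimes> b \<in> radical R Q"
    then obtain n :: nat where "(a \<otimes> b) [^] n \<in> Q" by (auto simp: radical_def)
    then have "a [^] n \<otimes> b [^] n \<in> Q" using ab by (simp add: nat_pow_distrib)
    then consider "a [^] n \<in> Q" | m :: nat where "(b [^] n) [^] m \<in> Q"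
      using pQ[of "a [^] n" "b [^] n"] ab by (auto simp: radical_def)
    then show "a \<in> radical R Q \<or> b \<in> radical R Q"
      using ab by cases (auto simp: radical_def nat_pow_pow)
  qed
qed

lemma pow_mem_mono:
  assumes "ideal J R" "b \<in> carrier R" "b [^] (n::nat) \<in> J" "n \<le> m" shows "b [^] m \<in> J"
proof -
  have "b [^] m = b [^] n \<otimes> b [^] (m - n)" using assms by (simp add: nat_pow_mult)
  then show ?thesis using assms by (simp add: idl_r)
qed

lemma primary_inter:
  assumes Q: "primary_ideal R Q" and Q': "primary_ideal R Q'" and eq: "radical R Q = radical R Q'"
  shows "primary_ideal R (Q \<inter> Q')"
proof -
  have i: "ideal Q R" "ideal Q' R" using Q Q' by (auto simp: primary_ideal_def)
  have rad: "b \<in> radical R (Q \<inter> Q')" if "b \<in> radical R Q" for b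
  proof -
    have "b \<in> radical R Q'" using that eq by simp
    then obtain m :: nat where "b \<in> carrier R" "b [^] m \<in> Q'" by (auto simp: radical_def)
    moreover obtain n :: nat where "b [^] n \<in> Q" using \<open>b \<in> radical R Q\<close> by (auto simp: radical_def)
    ultimately have "b [^] (max n m) \<in> Q \<inter> Q'"
      using pow_mem_mono[OF i(1), of b n "max n m"] pow_mem_mono[OF i(2), of b m "max n m"] by simp
    then show ?thesis using \<open>b \<in> carrier R\<close> by (auto simp: radical_def)
  qed
  have "Q \<inter> Q' \<noteq> carrier R" using Q idl_sub[OF i(1)] by (auto simp: primary_ideal_def)
  moreover have "a \<in> Q \<inter> Q' \<or> b \<in> radical R (Q \<inter> Q')"
    if "a \<in> carrier R" "b \<in> carrier R" "a \<otimes> b \<in> Q \<inter> Q'" for a b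
    using that Q Q' rad eq unfolding primary_ideal_def by blast
  ultimately show ?thesis using ideal_inter[OF i] by (simp add: primary_ideal_def)
qed

lemma prime_contains_factor:
  assumes P: "primeideal P R" and "finite \<Q>" "\<And>Q. Q \<in> \<Q> \<Longrightarrow> ideal Q R" "carrier R \<inter> \<Inter>\<Q> \<subseteq> P"
  shows "\<exists>Q\<in>\<Q>. Q \<subseteq> P"
proof (rule ccontr)
  assume neg: "\<not> ?thesis"
  have one: "\<one> \<notin> P" using P ideal.one_imp_carrier[of P R] by (auto dest: primeideal.axioms primeideal.I_notcarr)
  have "\<F> \<subseteq> \<Q> \<Longrightarrow> \<exists>u\<in>carrier R \<inter> \<Inter>\<F>. u \<notin> P" if "finite \<F>" for \<F>
    using that
  proof (induct \<F>)
    case empty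
    then show ?case using one by auto
  next
    case (insert Q \<F>)
    then obtain u where u: "u \<in> carrier R" "u \<in> \<Inter>\<F>" "u \<notin> P" by auto
    obtain v where v: "v \<in> Q" "v \<notin> P" using neg insert by blast
    have iQ: "ideal Q R" and iF: "\<And>Q'. Q' \<in> \<F> \<Longrightarrow> ideal Q' R" using insert(4) assms(3) by auto
    have vc: "v \<in> carrier R" using v iQ idl_carr by blast
    have "u \<otimes> v \<notin> P" using primeideal.I_prime[OF P u(1) vc] u v by blast
    moreover have "u \<otimes> v \<in> carrier R \<inter> \<Inter>(insert Q \<F>)"
      using u vc idl_l[OF iQ v(1) u(1)] idl_r[OF iF _ vc] by auto
    ultimately show ?case by blast
  qed
  from this[OF assms(2)] assms(4) show False by blast
qed

lemma primary_saturation: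
  assumes Q: "primary_ideal R Q" and u: "u \<in> carrier R" "u \<notin> radical R Q" "x \<in> carrier R" "u \<otimes> x \<in> Q"
  shows "x \<in> Q"
  using assms m_comm[of u x] unfolding primary_ideal_def by metis

text \<open>Elements outside \<open>P\<close> can be cancelled modulo the \<open>P\<close>-primary
  ideal \<open>Q\<close>. Conversely, no other component is contained in \<open>P\<close>, because
  \<open>P\<close> is minimal and the radicals are distinct; so some \<open>u \<notin> P\<close>
  lies in all of them, and \<open>uQ \<subseteq> J\<close>.\<close>

lemma primary_component_mem:
  assumes dec: "primary_decomposition R J \<Q>" and P: "P \<in> min_primes R J"
    and Q: "Q \<in> \<Q>" "radical R Q = P"
  shows "Q = saturation R P J"
proof -
  have fin: "finite \<Q>" and prim: "\<And>Q. Q \<in> \<Q> \<Longrightarrow> primary_ideal R Q" and J: "J = carrier R \<inter> \<Inter>\<Q>"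
    and inj: "inj_on (radical R) \<Q>"
    using dec by (auto simp: primary_decomposition_def)
  have pP: "primeideal P R" using P by (simp add: min_primes_def)
  have iQ: "ideal Q R" using prim[OF Q(1)] by (simp add: primary_ideal_def)
  show ?thesis
  proof
    show "saturation R P J \<subseteq> Q"
    proof
      fix x assume "x \<in> saturation R P J"
      then obtain u where "x \<in> carrier R" "u \<in> carrier R" "u \<notin> P" "u \<otimes> x \<in> J"
        by (auto simp: saturation_def)
      then show "x \<in> Q" using primary_saturation[OF prim[OF Q(1)], of u x] Q J by auto
    qed
    have no: "\<not> Q' \<subseteq> P" if "Q' \<in> \<Q> - {Q}" for Q'
    proof
      assume "Q' \<subseteq> P"
      then have "radical R Q' \<subseteq> P" by (rule radical_sub_prime[OF pP])
      moreover have "primeideal (radical R Q') R" using prim that by (auto intro: primary_radical_prime)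
      moreover have "ideal Q' R" using prim[of Q'] that by (auto simp: primary_ideal_def)
      then have "J \<subseteq> radical R Q'" using radical_sub[of Q'] that J by blast
      ultimately have "radical R Q' = P" using P by (auto simp: min_primes_def)
      then show False using inj Q that by (auto simp: inj_on_def)
    qed
    have "\<not> carrier R \<inter> \<Inter>(\<Q> - {Q}) \<subseteq> P"
    proof
      assume "carrier R \<inter> \<Inter>(\<Q> - {Q}) \<subseteq> P"
      then have "\<exists>Q'\<in>\<Q> - {Q}. Q' \<subseteq> P"
        using fin prim by (intro prime_contains_factor[OF pP]) (auto simp: primary_ideal_def)
      then show False using no by blast
    qed
    then obtain u where u: "u \<in> carrier R" "u \<in> \<Inter>(\<Q> - {Q})" "u \<notin> P" by auto
    show "Q \<subseteq> saturation R P J"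
    proof
      fix x assume x: "x \<in> Q"
      then have xc: "x \<in> carrier R" using iQ idl_carr by blast
      have "u \<otimes> x \<in> Q'" if "Q' \<in> \<Q>" for Q'
      proof (cases "Q' = Q")
        case False
        have "ideal Q' R" using prim[OF that] by (simp add: primary_ideal_def)
        then show ?thesis using u xc that False by (auto intro: idl_r)
      qed (use x u iQ in \<open>auto intro: idl_l\<close>)
      then have "u \<otimes> x \<in> J" using J u xc by auto
      then show "x \<in> saturation R P J" using u xc by (auto simp: saturation_def)
    qed
  qed
qed

end

section \<open>Existence of primary decompositions, and unmixed parts\<close>

context noetherian_cring
begin

text \<open>A maximal counterexample \<open>J\<close> is not primary, as some
  \<open>ab \<in> J\<close> shows. For large \<open>n\<close> it is the intersection of the strictly
  larger ideals \<open>J : b^n\<close> and \<open>J + b^n R\<close>, which do have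
  decompositions.\<close>

lemma primary_family_exists:
  assumes "ideal J R"
  shows "\<exists>\<Q>. finite \<Q> \<and> (\<forall>Q\<in>\<Q>. primary_ideal R Q) \<and> J = carrier R \<inter> \<Inter>\<Q>"
proof (rule ccontr)
  define \<F> where "\<F> = {J. ideal J R \<and> \<not> (\<exists>\<Q>. finite \<Q> \<and> (\<forall>Q\<in>\<Q>. primary_ideal R Q) \<and> J = carrier R \<inter> \<Inter>\<Q>)}"
  assume "\<not> ?thesis"
  then have "\<F> \<noteq> {}" using assms by (auto simp: \<F>_def)
  then obtain J where J: "J \<in> \<F>" and max: "\<And>K. K \<in> \<F> \<Longrightarrow> \<not> J \<subset> K"
    by (rule ideal_maximal_element) (simp_all add: \<F>_def that)
  have iJ: "ideal J R" using J by (simp add: \<F>_def)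
  have no: False if "finite \<Q>" "\<forall>Q\<in>\<Q>. primary_ideal R Q" "J = carrier R \<inter> \<Inter>\<Q>" for \<Q>
    using J that by (auto simp: \<F>_def)
  have big: "\<exists>\<Q>. finite \<Q> \<and> (\<forall>Q\<in>\<Q>. primary_ideal R Q) \<and> K = carrier R \<inter> \<Inter>\<Q>"
    if "ideal K R" "J \<subset> K" for K using max[of K] that by (auto simp: \<F>_def)
  have "J \<noteq> carrier R" using no[of "{}"] by auto
  moreover have "\<not> primary_ideal R J" using no[of "{J}"] idl_sub[OF iJ] by auto
  ultimately obtain a b where ab: "a \<in> carrier R" "b \<in> carrier R" "a \<otimes> b \<in> J" "a \<notin> J" "b \<notin> radical R J"
    using iJ by (auto simp: primary_ideal_def)
  let ?C = "\<lambda>n::nat. {x \<in> carrier R. b [^] n \<otimes> x \<in> J}"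
  have iC: "ideal (?C n) R" for n by (rule ideal_colon_elt[OF oneideal iJ]) (simp add: ab)
  have "?C n \<subseteq> ?C (Suc n)" for n
  proof
    fix x assume x: "x \<in> ?C n"
    then have "b [^] Suc n \<otimes> x = b \<otimes> (b [^] n \<otimes> x)" using ab by (simp add: nat_pow_Suc m_ac)
    then show "x \<in> ?C (Suc n)" using x ab idl_l[OF iJ] by simp
  qed
  then obtain N where N: "\<And>n. n \<ge> N \<Longrightarrow> ?C n = ?C N"
    using ascending_ideals_stationary[of ?C, OF iC] by blast
  \<comment> \<open>Past the point of stability, and positive, so that \<open>ab \<in> J\<close>
    places \<open>a\<close> in \<open>J : b^n\<close>.\<close>
  define n where "n = Suc N"
  let ?b = "b [^] n"
  have bc: "?b \<in> carrier R" using ab by simp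
  let ?D = "J <+> PIdl ?b"
  have iD: "ideal ?D R" using iJ bc by (simp add: add_ideals cgenideal_ideal)
  have JC: "J \<subseteq> ?C n" using idl_l[OF iJ] bc idl_carr[OF iJ] by auto
  have "a \<in> ?C n"
  proof -
    have "?b \<otimes> a = b [^] N \<otimes> (a \<otimes> b)" using ab by (simp add: n_def nat_pow_Suc m_ac)
    then show ?thesis using idl_l[OF iJ ab(3)] ab by auto
  qed
  then have "J \<subset> ?C n" using JC ab by blast
  have JD: "J \<subseteq> ?D" "?b \<in> ?D"
    using set_add_l[OF iJ cgenideal_ideal[OF bc]] set_add_r[OF iJ cgenideal_ideal[OF bc]]
      cgenideal_self[OF bc] by auto
  moreover have "?b \<notin> J" using ab by (auto simp: radical_def)
  ultimately have "J \<subset> ?D" by blast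
  have "?C n \<inter> ?D \<subseteq> J"
  proof
    fix x assume x: "x \<in> ?C n \<inter> ?D"
    then obtain j c where jc: "j \<in> J" "c \<in> carrier R" "x = j \<oplus> c \<otimes> ?b"
      by (auto simp: set_add_mem cgenideal_def)
    have jR: "j \<in> carrier R" using jc iJ idl_carr by blast
    have "?b \<otimes> j \<oplus> b [^] (n + n) \<otimes> c = ?b \<otimes> x"
      unfolding jc(3) using jR jc bc ab by (simp add: r_distr nat_pow_mult[symmetric] m_ac)
    then have "?b \<otimes> j \<oplus> b [^] (n + n) \<otimes> c \<in> J" using x by simp
    then have "b [^] (n + n) \<otimes> c \<in> J"
      by (rule idl_add_cancel[OF iJ idl_l[OF iJ jc(1) bc], rotated]) (use ab jc in simp)
    then have "c \<in> ?C (n + n)" using jc by simp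
    moreover have "?C (n + n) = ?C n"
      by (rule trans[OF N N[symmetric]]) (auto simp: n_def)
    ultimately have "c \<in> ?C n" by blast
    then show "x \<in> J" using jc bc idl_add[OF iJ] m_comm[of c ?b] by simp
  qed
  then have eq: "J = ?C n \<inter> ?D" using JC JD by blast
  obtain \<Q>1 where 1: "finite \<Q>1" "\<forall>Q\<in>\<Q>1. primary_ideal R Q" "?C n = carrier R \<inter> \<Inter>\<Q>1"
    using big[OF iC \<open>J \<subset> ?C n\<close>] by blast
  obtain \<Q>2 where 2: "finite \<Q>2" "\<forall>Q\<in>\<Q>2. primary_ideal R Q" "?D = carrier R \<inter> \<Inter>\<Q>2"
    using big[OF iD \<open>J \<subset> ?D\<close>] by blast
  have "?C n \<inter> ?D = carrier R \<inter> \<Inter>(\<Q>1 \<union> \<Q>2)" unfolding 1(3) 2(3) by blast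
  with eq have "J = carrier R \<inter> \<Inter>(\<Q>1 \<union> \<Q>2)" by (rule trans)
  then show False using no[of "\<Q>1 \<union> \<Q>2"] 1(1,2) 2(1,2) by blast
qed

text \<open>A family of least cardinality is minimal: two components with the same radical could be
  merged into their intersection, and a redundant one dropped.\<close>

lemma primary_decomposition_exists:
  assumes "ideal J R"
  shows "\<exists>\<Q>. primary_decomposition R J \<Q>"
proof -
  let ?P = "\<lambda>\<Q>. finite \<Q> \<and> (\<forall>Q\<in>\<Q>. primary_ideal R Q) \<and> J = carrier R \<inter> \<Inter>\<Q>"
  obtain \<Q> where \<Q>: "?P \<Q>" and least: "\<And>\<Q>'. ?P \<Q>' \<Longrightarrow> card \<Q> \<le> card \<Q>'"
    using ex_has_least_nat[of ?P _ card] primary_family_exists[OF assms] by metis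
  have "inj_on (radical R) \<Q>"
  proof (rule inj_onI, rule ccontr)
    fix Q Q' assume Q: "Q \<in> \<Q>" "Q' \<in> \<Q>" "radical R Q = radical R Q'" "Q \<noteq> Q'"
    let ?F = "insert (Q \<inter> Q') (\<Q> - {Q, Q'})"
    have "?P ?F" using \<Q> Q primary_inter[of Q Q'] by auto
    then have "card \<Q> \<le> card ?F" by (rule least)
    also have "\<dots> \<le> Suc (card (\<Q> - {Q, Q'}))" by (rule card_insert_le_m1) auto
    also have "card (\<Q> - {Q, Q'}) = card \<Q> - 2" using Q \<Q> by (subst card_Diff_subset) auto
    finally have "card \<Q> \<le> Suc (card \<Q> - 2)" .
    moreover have "card {Q, Q'} \<le> card \<Q>" using Q \<Q> by (intro card_mono) auto
    ultimately show False using Q by simp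
  qed
  moreover have "\<not> carrier R \<inter> \<Inter>(\<Q> - {Q}) \<subseteq> Q" if "Q \<in> \<Q>" for Q
  proof
    assume "carrier R \<inter> \<Inter>(\<Q> - {Q}) \<subseteq> Q"
    then have "(carrier R \<inter> \<Inter>(\<Q> - {Q})) \<inter> Q = carrier R \<inter> \<Inter>(\<Q> - {Q})" by (rule Int_absorb2)
    moreover have "carrier R \<inter> \<Inter>\<Q> = (carrier R \<inter> \<Inter>(\<Q> - {Q})) \<inter> Q" using that by blast
    ultimately have "J = carrier R \<inter> \<Inter>(\<Q> - {Q})" using \<Q> by metis
    then have "?P (\<Q> - {Q})" using conjunct1[OF \<Q>] conjunct1[OF conjunct2[OF \<Q>]] by simp
    then have "card \<Q> \<le> card (\<Q> - {Q})" by (rule least)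
    then show False using card_Diff1_less[OF conjunct1[OF \<Q>] that] by simp
  qed
  ultimately show ?thesis using \<Q> unfolding primary_decomposition_def by blast
qed

lemma decomposition_prime:
  assumes dec: "primary_decomposition R J \<Q>" and P: "primeideal P R" "J \<subseteq> P"
  shows "\<exists>Q\<in>\<Q>. radical R Q \<subseteq> P"
  using prime_contains_factor[OF P(1), of \<Q>] radical_sub_prime[OF P(1)] dec P(2)
  unfolding primary_decomposition_def primary_ideal_def by metis

lemma decomposition_radical:
  assumes dec: "primary_decomposition R J \<Q>" and Q: "Q \<in> \<Q>"
  shows "primeideal (radical R Q) R" "J \<subseteq> radical R Q"
proof -
  have Q': "primary_ideal R Q" "J \<subseteq> Q" using assms by (auto simp: primary_decomposition_def)
  then show "primeideal (radical R Q) R" by (intro primary_radical_prime)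
  have "ideal Q R" using Q' by (simp add: primary_ideal_def)
  then show "J \<subseteq> radical R Q" using radical_sub Q'(2) by blast
qed

text \<open>Every prime over \<open>J\<close> contains the radical of some component, so a minimal
  one among these finitely many radicals below \<open>P\<close> is a minimal prime of
  \<open>J\<close>.\<close>

lemma min_prime_below:
  assumes J: "ideal J R" and P: "primeideal P R" "J \<subseteq> P"
  shows "\<exists>P'\<in>min_primes R J. P' \<subseteq> P"
proof -
  obtain \<Q> where dec: "primary_decomposition R J \<Q>" using primary_decomposition_exists[OF J] by blast
  let ?F = "{radical R Q | Q. Q \<in> \<Q> \<and> radical R Q \<subseteq> P}"
  have "finite ?F" using dec by (simp add: primary_decomposition_def)
  moreover have "?F \<noteq> {}" using decomposition_prime[OF dec P] by auto
  ultimately have "\<exists>M\<in>?F. \<forall>K\<in>?F. K \<subseteq> M \<longrightarrow> M = K" by (rule finite_has_minimal)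
  then obtain M where M: "M \<in> ?F" "\<And>K. K \<in> ?F \<Longrightarrow> K \<subseteq> M \<Longrightarrow> M = K"
    by (elim bexE) (rule that, assumption, simp)
  then obtain Q where Q: "Q \<in> \<Q>" "M = radical R Q" "M \<subseteq> P" by blast
  have "P' = M" if P': "primeideal P' R" "J \<subseteq> P'" "P' \<subseteq> M" for P'
  proof -
    obtain Q' where "Q' \<in> \<Q>" "radical R Q' \<subseteq> P'" using decomposition_prime[OF dec P'(1,2)] by blast
    then show ?thesis using M(2)[of "radical R Q'"] P' Q by blast
  qed
  then have "M \<in> min_primes R J" using decomposition_radical[OF dec Q(1)] Q by (auto simp: min_primes_def)
  then show ?thesis using Q by blast
qed

lemma primary_component_eq:
  assumes J: "ideal J R" and P: "P \<in> min_primes R J"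
  shows "primary_component R J P = saturation R P J"
proof -
  obtain \<Q> where dec: "primary_decomposition R J \<Q>" using primary_decomposition_exists[OF J] by blast
  have pP: "primeideal P R" "J \<subseteq> P" using P by (auto simp: min_primes_def)
  obtain Q where Q: "Q \<in> \<Q>" "radical R Q \<subseteq> P" using decomposition_prime[OF dec pP] by blast
  then have rP: "radical R Q = P" using decomposition_radical[OF dec Q(1)] P by (auto simp: min_primes_def)
  show ?thesis
    unfolding primary_component_def
  proof (rule the_equality)
    show "\<exists>\<Q>. primary_decomposition R J \<Q> \<and> saturation R P J \<in> \<Q> \<and> radical R (saturation R P J) = P"
      using dec Q(1) primary_component_mem[OF dec P Q(1) rP] rP by metis
  next
    fix Q assume "\<exists>\<Q>. primary_decomposition R J \<Q> \<and> Q \<in> \<Q> \<and> radical R Q = P"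
    then show "Q = saturation R P J" using primary_component_mem[OF _ P] by metis
  qed
qed

lemma unmixed_part_eq:
  assumes J: "ideal J R"
  shows "unmixed_part R J = {x \<in> carrier R. \<forall>P\<in>min_primes R J. x \<in> saturation R P J}"
  using primary_component_eq[OF J] by (auto simp: unmixed_part_def)

lemma saturation_ideal:
  assumes J: "ideal J R" and P: "primeideal P R"
  shows "ideal (saturation R P J) R" "J \<subseteq> saturation R P J"
proof -
  have one: "\<one> \<in> carrier R - P"
    using P ideal.one_imp_carrier[of P R] by (auto dest: primeideal.axioms primeideal.I_notcarr)
  then show JS: "J \<subseteq> saturation R P J"
    using idl_carr[OF J] by (auto simp: saturation_def intro!: bexI[of _ \<one>])
  show "ideal (saturation R P J) R"
  proof (rule cring_idealI)
    show "\<zero> \<in> saturation R P J" using JS idl_zero[OF J] by blast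
  next
    fix x y assume "x \<in> saturation R P J" "y \<in> saturation R P J"
    then obtain u v where u: "x \<in> carrier R" "u \<in> carrier R" "u \<notin> P" "u \<otimes> x \<in> J"
      and v: "y \<in> carrier R" "v \<in> carrier R" "v \<notin> P" "v \<otimes> y \<in> J" by (auto simp: saturation_def)
    have "u \<otimes> v \<notin> P" using primeideal.I_prime[OF P u(2) v(2)] u v by blast
    moreover have "(u \<otimes> v) \<otimes> (x \<oplus> y) = v \<otimes> (u \<otimes> x) \<oplus> u \<otimes> (v \<otimes> y)"
      using u v by (simp add: r_distr m_ac)
    then have "(u \<otimes> v) \<otimes> (x \<oplus> y) \<in> J" using idl_add[OF J] idl_l[OF J] u v by simp
    ultimately show "x \<oplus> y \<in> saturation R P J"
      using u v unfolding saturation_def by blast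
  next
    fix a x assume "a \<in> carrier R" "x \<in> saturation R P J"
    then obtain u where u: "a \<in> carrier R" "x \<in> carrier R" "u \<in> carrier R" "u \<notin> P" "u \<otimes> x \<in> J"
      by (auto simp: saturation_def)
    have "u \<otimes> (a \<otimes> x) \<in> J" using idl_l[OF J u(5,1)] u by (simp add: m_lcomm)
    then show "a \<otimes> x \<in> saturation R P J" using u by (auto simp: saturation_def)
  qed (auto simp: saturation_def)
qed

lemma unmixed_part_ideal:
  assumes J: "ideal J R"
  shows "ideal (unmixed_part R J) R" "J \<subseteq> unmixed_part R J"
proof -
  have P: "P \<in> min_primes R J \<Longrightarrow> primeideal P R" for P by (simp add: min_primes_def)
  note s = saturation_ideal[OF J P]
  show "J \<subseteq> unmixed_part R J"
    unfolding unmixed_part_eq[OF J] using s(2) idl_carr[OF J] by auto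
  show "ideal (unmixed_part R J) R"
    unfolding unmixed_part_eq[OF J]
    by (rule cring_idealI)
      (use s(1) in \<open>auto simp: idl_zero idl_add idl_l\<close>)
qed

lemma min_primes_unmixed_part:
  assumes J: "ideal J R" shows "min_primes R (unmixed_part R J) = min_primes R J"
proof -
  let ?U = "unmixed_part R J"
  have U: "J \<subseteq> ?U" by (rule unmixed_part_ideal(2)[OF J])
  have UP: "?U \<subseteq> P" if "P \<in> min_primes R J" for P
  proof
    fix x assume "x \<in> ?U"
    then have "x \<in> saturation R P J" using that by (simp add: unmixed_part_eq[OF J])
    then obtain u where u: "x \<in> carrier R" "u \<in> carrier R" "u \<notin> P" "u \<otimes> x \<in> J"
      by (auto simp: saturation_def)
    moreover have "primeideal P R" "J \<subseteq> P" using that by (auto simp: min_primes_def)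
    ultimately show "x \<in> P" using primeideal.I_prime[of P R u x] by blast
  qed
  show ?thesis
  proof
    show "min_primes R J \<subseteq> min_primes R ?U"
    proof
      fix P assume P: "P \<in> min_primes R J"
      have "Q = P" if "primeideal Q R" "?U \<subseteq> Q" "Q \<subseteq> P" for Q
        using P that subset_trans[OF U that(2)] by (simp add: min_primes_def)
      then show "P \<in> min_primes R ?U" using P UP[OF P] by (simp add: min_primes_def)
    qed
    show "min_primes R ?U \<subseteq> min_primes R J"
    proof
      fix P assume P: "P \<in> min_primes R ?U"
      then have pP: "primeideal P R" "J \<subseteq> P" using U by (auto simp: min_primes_def)
      then obtain P' where P': "P' \<in> min_primes R J" "P' \<subseteq> P" using min_prime_below[OF J] by blast
      then have "P' = P" using P UP[OF P'(1)] by (auto simp: min_primes_def)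
      then show "P \<in> min_primes R J" using P' by simp
    qed
  qed
qed

text \<open>Saturation at \<open>P\<close> is idempotent, since products of elements outside
  \<open>P\<close> stay outside \<open>P\<close>, and both passages use the same minimal
  primes.\<close>

lemma unmixed_unmixed_part:
  assumes J: "ideal J R" shows "unmixed_ideal R (unmixed_part R J)"
proof -
  let ?U = "unmixed_part R J"
  note U = unmixed_part_ideal[OF J]
  have "unmixed_part R ?U \<subseteq> ?U"
  proof
    fix x assume "x \<in> unmixed_part R ?U"
    then have x: "x \<in> carrier R" "\<And>P. P \<in> min_primes R J \<Longrightarrow> x \<in> saturation R P ?U"
      by (auto simp: unmixed_part_eq[OF U(1)] min_primes_unmixed_part[OF J])
    have "x \<in> saturation R P J" if P: "P \<in> min_primes R J" for P
    proof -
      obtain u where u: "u \<in> carrier R" "u \<notin> P" "u \<otimes> x \<in> ?U" using x(2)[OF P] by (auto simp: saturation_def)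
      then have "u \<otimes> x \<in> saturation R P J" using P by (simp add: unmixed_part_eq[OF J])
      then obtain v where v: "v \<in> carrier R" "v \<notin> P" "v \<otimes> (u \<otimes> x) \<in> J"
        by (auto simp: saturation_def)
      have "primeideal P R" using P by (simp add: min_primes_def)
      then have "v \<otimes> u \<notin> P" using primeideal.I_prime[of P R v u] u v by blast
      moreover have "(v \<otimes> u) \<otimes> x \<in> J" using v u x(1) by (simp add: m_assoc)
      ultimately show ?thesis using u v x(1) unfolding saturation_def by blast
    qed
    then show "x \<in> ?U" using x(1) by (simp add: unmixed_part_eq[OF J])
  qed
  then show ?thesis using U unmixed_part_ideal(2)[OF U(1)] by (auto simp: unmixed_ideal_def)
qed

text \<open>A maximal counterexample is not prime. If it contains \<open>ab\<close> but neither
  factor, then \<open>J + aR\<close> and \<open>J + bR\<close> contain powers of \<open>M\<close>,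
  and the product of these two ideals lies in \<open>J\<close>.\<close>

lemma power_sub_of_primes:
  assumes M: "ideal M R" and J: "ideal J R" and "\<And>P. primeideal P R \<Longrightarrow> J \<subseteq> P \<Longrightarrow> M \<subseteq> P"
  shows "\<exists>k. ideal_power R M k \<subseteq> J"
proof (rule ccontr)
  define \<F> where "\<F> = {J. ideal J R \<and> (\<forall>P. primeideal P R \<longrightarrow> J \<subseteq> P \<longrightarrow> M \<subseteq> P) \<and>
    (\<forall>k. \<not> ideal_power R M k \<subseteq> J)}"
  assume "\<not> ?thesis"
  then have "J \<in> \<F>" using assms by (simp add: \<F>_def)
  then have "\<F> \<noteq> {}" by blast
  then obtain J where J: "J \<in> \<F>" and max: "\<And>K. K \<in> \<F> \<Longrightarrow> \<not> J \<subset> K"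
    by (rule ideal_maximal_element) (simp_all add: \<F>_def that)
  have iJ: "ideal J R" and pJ: "\<And>P. primeideal P R \<Longrightarrow> J \<subseteq> P \<Longrightarrow> M \<subseteq> P"
    and nJ: "\<And>k. \<not> ideal_power R M k \<subseteq> J" using J by (auto simp: \<F>_def)
  have "J \<noteq> carrier R" using nJ[of 0] by (simp add: ideal_power_0)
  moreover have "\<not> primeideal J R" using pJ[of J] nJ[of "Suc 0"] ideal_power_1[OF M] by auto
  ultimately obtain a b where ab: "a \<in> carrier R" "b \<in> carrier R" "a \<otimes> b \<in> J" "a \<notin> J" "b \<notin> J"
    using iJ primeidealI[OF iJ is_cring] by metis
  have big: "\<exists>k. ideal_power R M k \<subseteq> J <+> PIdl c" if "c \<in> carrier R" "c \<notin> J" for c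
  proof -
    have "J \<subset> J <+> PIdl c"
      using set_add_l[OF iJ cgenideal_ideal[OF that(1)]] set_add_r[OF iJ cgenideal_ideal[OF that(1)]]
        cgenideal_self[OF that(1)] that(2) by blast
    then show ?thesis
      using max[of "J <+> PIdl c"] pJ add_ideals[OF iJ cgenideal_ideal[OF that(1)]] by (auto simp: \<F>_def)
  qed
  obtain k l where k: "ideal_power R M k \<subseteq> J <+> PIdl a" and l: "ideal_power R M l \<subseteq> J <+> PIdl b"
    using big ab by meson
  have "(J <+> PIdl a) \<cdot> (J <+> PIdl b) \<subseteq> J"
  proof (rule ideal_prod_least[OF iJ])
    fix x y assume "x \<in> J <+> PIdl a" "y \<in> J <+> PIdl b"
    then obtain i c j d where x: "i \<in> J" "c \<in> carrier R" "x = i \<oplus> c \<otimes> a"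
      and y: "j \<in> J" "d \<in> carrier R" "y = j \<oplus> d \<otimes> b" by (auto simp: set_add_mem cgenideal_def)
    have ij: "i \<in> carrier R" "j \<in> carrier R" using x y iJ idl_carr by auto
    have "x \<otimes> y = i \<otimes> (j \<oplus> d \<otimes> b) \<oplus> ((c \<otimes> a) \<otimes> j \<oplus> (c \<otimes> d) \<otimes> (a \<otimes> b))"
      unfolding x y using ij x(2) y(2) ab(1,2) by algebra
    moreover have "i \<otimes> (j \<oplus> d \<otimes> b) \<in> J" using ij x y ab by (intro idl_r[OF iJ]) auto
    moreover have "(c \<otimes> a) \<otimes> j \<in> J" using x y ab by (intro idl_l[OF iJ]) auto
    moreover have "(c \<otimes> d) \<otimes> (a \<otimes> b) \<in> J" by (rule idl_l[OF iJ ab(3)]) (use x y in simp)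
    ultimately show "x \<otimes> y \<in> J" using idl_add[OF iJ] by simp
  qed
  then have "ideal_power R M (k + l) \<subseteq> J"
    using ideal_prod_mono[OF k l] ideal_power_add[OF M] by auto
  then show False using nJ by blast
qed

end

section \<open>Localization at a prime ideal\<close>

locale localization_at = noetherian_cring R + P: primeideal P R for R (structure) and P
begin

abbreviation S where "S \<equiv> carrier R - P"

abbreviation fr where "fr \<equiv> loc_frac R S"

abbreviation Loc where "Loc \<equiv> local_at R P"

lemma P_ideal: "ideal P R" ..

lemma P_prime: "primeideal P R" ..

lemma one_S: "\<one> \<in> S"
  using P.I_notcarr P.one_imp_carrier by auto

lemma mult_S: "s \<in> S \<Longrightarrow> t \<in> S \<Longrightarrow> s \<otimes> t \<in> S"
  using P.I_prime by blast

lemma S_carr: "s \<in> S \<Longrightarrow> s \<in> carrier R"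
  by blast

lemma equiv_loc_rel: "equiv (carrier R \<times> S) (loc_rel R S)"
proof (rule equivI)
  show "loc_rel R S \<subseteq> (carrier R \<times> S) \<times> (carrier R \<times> S)" by (auto simp: loc_rel_def)
  show "refl_on (carrier R \<times> S) (loc_rel R S)"
    using one_S by (intro refl_onI) (auto simp: loc_rel_def)
  show "sym (loc_rel R S)"
  proof (rule symI, clarify)
    fix a s b t assume "((a, s), (b, t)) \<in> loc_rel R S"
    then show "((b, t), (a, s)) \<in> loc_rel R S" unfolding loc_rel_def by simp metis
  qed
  show "trans (loc_rel R S)"
  proof (rule transI, clarify)
    fix a s b t c w assume "((a, s), (b, t)) \<in> loc_rel R S" "((b, t), (c, w)) \<in> loc_rel R S"
    then obtain u v where m: "a \<in> carrier R" "b \<in> carrier R" "c \<in> carrier R" "s \<in> S" "t \<in> S" "w \<in> S"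
      "u \<in> S" "v \<in> S" and e: "u \<otimes> (a \<otimes> t) = u \<otimes> (b \<otimes> s)" "v \<otimes> (b \<otimes> w) = v \<otimes> (c \<otimes> t)"
      by (auto simp: loc_rel_def)
    note c = m(1-3) m(4-8)[THEN S_carr]
    have "(u \<otimes> v \<otimes> t) \<otimes> (a \<otimes> w) = (v \<otimes> w) \<otimes> (u \<otimes> (a \<otimes> t))" using c by (simp add: m_ac)
    also have "\<dots> = (u \<otimes> s) \<otimes> (v \<otimes> (b \<otimes> w))" unfolding e(1) using c by (simp add: m_ac)
    also have "\<dots> = (u \<otimes> v \<otimes> t) \<otimes> (c \<otimes> s)" unfolding e(2) using c by (simp add: m_ac)
    finally show "((a, s), (c, w)) \<in> loc_rel R S"
      using m mult_S[OF mult_S[OF m(7,8)] m(5)] by (auto simp: loc_rel_def)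
  qed
qed

lemma fr_eq_iff:
  assumes "a \<in> carrier R" "s \<in> S" "b \<in> carrier R" "t \<in> S"
  shows "fr a s = fr b t \<longleftrightarrow> (\<exists>u\<in>S. u \<otimes> (a \<otimes> t) = u \<otimes> (b \<otimes> s))"
proof -
  have "fr a s = fr b t \<longleftrightarrow> ((a, s), (b, t)) \<in> loc_rel R S"
    unfolding loc_frac_def using assms by (intro eq_equiv_class_iff[OF equiv_loc_rel]) auto
  then show ?thesis using assms by (auto simp: loc_rel_def)
qed

lemma fr_eqI:
  assumes "a \<in> carrier R" "s \<in> S" "b \<in> carrier R" "t \<in> S" "a \<otimes> t = b \<otimes> s"
  shows "fr a s = fr b t"
  using fr_eq_iff[OF assms(1-4)] one_S assms(5) by metis

lemma fr_mem_iff: "(b, t) \<in> fr a s \<longleftrightarrow> ((a, s), (b, t)) \<in> loc_rel R S"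
  by (auto simp: loc_frac_def)

lemma fr_memD:
  assumes "a \<in> carrier R" "s \<in> S" "(b, t) \<in> fr a s"
  shows "b \<in> carrier R" "t \<in> S" "\<exists>u\<in>S. u \<otimes> (a \<otimes> t) = u \<otimes> (b \<otimes> s)"
  using assms by (auto simp: fr_mem_iff loc_rel_def)

lemma fr_self: "a \<in> carrier R \<Longrightarrow> s \<in> S \<Longrightarrow> (a, s) \<in> fr a s"
  using one_S by (auto simp: fr_mem_iff loc_rel_def)

lemma fr_carr: "a \<in> carrier R \<Longrightarrow> s \<in> S \<Longrightarrow> fr a s \<in> carrier Loc"
  by (auto simp: local_at_def localization_def)

lemma carr_fr:
  assumes "A \<in> carrier Loc" obtains a s where "a \<in> carrier R" "s \<in> S" "A = fr a s"
  using assms by (auto simp: local_at_def localization_def)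

text \<open>Operations on fractions are defined as unions over all representatives; for a
  well-defined operation all members of the union coincide.\<close>

lemma UN_fr:
  assumes "a \<in> carrier R" "s \<in> S" "b \<in> carrier R" "t \<in> S"
    and "\<And>a' s' b' t'. (a', s') \<in> fr a s \<Longrightarrow> (b', t') \<in> fr b t \<Longrightarrow> F a' s' b' t' = C"
  shows "(\<Union>(a', s')\<in>fr a s. \<Union>(b', t')\<in>fr b t. F a' s' b' t') = C"
proof -
  have "(\<Union>(a', s')\<in>fr a s. \<Union>(b', t')\<in>fr b t. F a' s' b' t') \<subseteq> C" using assms(5) by fastforce
  moreover have "C \<subseteq> (\<Union>(a', s')\<in>fr a s. \<Union>(b', t')\<in>fr b t. F a' s' b' t')"
    using assms(5)[OF fr_self[OF assms(1,2)] fr_self[OF assms(3,4)]]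
      fr_self[OF assms(1,2)] fr_self[OF assms(3,4)] by fastforce
  ultimately show ?thesis by blast
qed

lemma fr_mult:
  assumes "a \<in> carrier R" "s \<in> S" "b \<in> carrier R" "t \<in> S"
  shows "fr a s \<otimes>\<^bsub>Loc\<^esub> fr b t = fr (a \<otimes> b) (s \<otimes> t)"
proof -
  have "fr (a' \<otimes> b') (s' \<otimes> t') = fr (a \<otimes> b) (s \<otimes> t)"
    if h: "(a', s') \<in> fr a s" "(b', t') \<in> fr b t" for a' s' b' t'
  proof -
    obtain u v where u: "u \<in> S" "u \<otimes> (a \<otimes> s') = u \<otimes> (a' \<otimes> s)"
      and v: "v \<in> S" "v \<otimes> (b \<otimes> t') = v \<otimes> (b' \<otimes> t)"
      using fr_memD(3)[OF assms(1,2) h(1)] fr_memD(3)[OF assms(3,4) h(2)] by blast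
    note m = fr_memD(1,2)[OF assms(1,2) h(1)] fr_memD(1,2)[OF assms(3,4) h(2)]
    note c = assms(1,3) m(1,3) assms(2,4)[THEN S_carr] m(2,4)[THEN S_carr] u(1)[THEN S_carr] v(1)[THEN S_carr]
    have "(u \<otimes> v) \<otimes> ((a' \<otimes> b') \<otimes> (s \<otimes> t)) = (u \<otimes> (a' \<otimes> s)) \<otimes> (v \<otimes> (b' \<otimes> t))" using c by (simp add: m_ac)
    also have "\<dots> = (u \<otimes> v) \<otimes> ((a \<otimes> b) \<otimes> (s' \<otimes> t'))"
      unfolding u(2)[symmetric] v(2)[symmetric] using c by (simp add: m_ac)
    finally show ?thesis
      using fr_eq_iff[of "a' \<otimes> b'" "s' \<otimes> t'" "a \<otimes> b" "s \<otimes> t"] mult_S m u(1) v(1) assms by blast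
  qed
  then show ?thesis
    unfolding local_at_def localization_def by simp (rule UN_fr[OF assms])
qed

lemma fr_add:
  assumes "a \<in> carrier R" "s \<in> S" "b \<in> carrier R" "t \<in> S"
  shows "fr a s \<oplus>\<^bsub>Loc\<^esub> fr b t = fr (a \<otimes> t \<oplus> b \<otimes> s) (s \<otimes> t)"
proof -
  have "fr (a' \<otimes> t' \<oplus> b' \<otimes> s') (s' \<otimes> t') = fr (a \<otimes> t \<oplus> b \<otimes> s) (s \<otimes> t)"
    if h: "(a', s') \<in> fr a s" "(b', t') \<in> fr b t" for a' s' b' t'
  proof -
    obtain u v where u: "u \<in> S" "u \<otimes> (a \<otimes> s') = u \<otimes> (a' \<otimes> s)"
      and v: "v \<in> S" "v \<otimes> (b \<otimes> t') = v \<otimes> (b' \<otimes> t)"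
      using fr_memD(3)[OF assms(1,2) h(1)] fr_memD(3)[OF assms(3,4) h(2)] by blast
    note m = fr_memD(1,2)[OF assms(1,2) h(1)] fr_memD(1,2)[OF assms(3,4) h(2)]
    note c = assms(1,3) m(1,3) assms(2,4)[THEN S_carr] m(2,4)[THEN S_carr] u(1)[THEN S_carr] v(1)[THEN S_carr]
    have "(u \<otimes> v) \<otimes> ((a' \<otimes> t' \<oplus> b' \<otimes> s') \<otimes> (s \<otimes> t)) =
        (u \<otimes> (a' \<otimes> s)) \<otimes> (v \<otimes> t' \<otimes> t) \<oplus> (v \<otimes> (b' \<otimes> t)) \<otimes> (u \<otimes> s' \<otimes> s)"
      using c by algebra
    also have "\<dots> = (u \<otimes> v) \<otimes> ((a \<otimes> t \<oplus> b \<otimes> s) \<otimes> (s' \<otimes> t'))"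
      unfolding u(2)[symmetric] v(2)[symmetric] using c by algebra
    finally show ?thesis
      using fr_eq_iff[of "a' \<otimes> t' \<oplus> b' \<otimes> s'" "s' \<otimes> t'" "a \<otimes> t \<oplus> b \<otimes> s" "s \<otimes> t"]
        mult_S m u(1) v(1) assms by blast
  qed
  then show ?thesis
    unfolding local_at_def localization_def by simp (rule UN_fr[OF assms])
qed

lemma Loc_one: "\<one>\<^bsub>Loc\<^esub> = fr \<one> \<one>" and Loc_zero: "\<zero>\<^bsub>Loc\<^esub> = fr \<zero> \<one>"
  by (simp_all add: local_at_def localization_def)

lemma Loc_cring: "cring Loc"
proof (rule cringI)
  show "abelian_group Loc"
  proof (rule abelian_groupI)
    fix x y assume "x \<in> carrier Loc" "y \<in> carrier Loc"
    then obtain a s b t where x: "a \<in> carrier R" "s \<in> S" "x = fr a s"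
      and y: "b \<in> carrier R" "t \<in> S" "y = fr b t" by (metis carr_fr)
    show "x \<oplus>\<^bsub>Loc\<^esub> y \<in> carrier Loc"
      using x y mult_S by (simp add: fr_add fr_carr)
    show "x \<oplus>\<^bsub>Loc\<^esub> y = y \<oplus>\<^bsub>Loc\<^esub> x"
      using x y by (simp add: fr_add a_comm m_comm)
    fix z assume "z \<in> carrier Loc"
    then obtain c w where z: "c \<in> carrier R" "w \<in> S" "z = fr c w" by (metis carr_fr)
    have cs: "s \<in> carrier R" "t \<in> carrier R" "w \<in> carrier R" using x y z by auto
    show "x \<oplus>\<^bsub>Loc\<^esub> y \<oplus>\<^bsub>Loc\<^esub> z = x \<oplus>\<^bsub>Loc\<^esub> (y \<oplus>\<^bsub>Loc\<^esub> z)"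
    proof -
      have "(a \<otimes> t \<oplus> b \<otimes> s) \<otimes> w \<oplus> c \<otimes> (s \<otimes> t) = a \<otimes> (t \<otimes> w) \<oplus> (b \<otimes> w \<oplus> c \<otimes> t) \<otimes> s"
        using x(1) y(1) z(1) cs by algebra
      then show ?thesis
        unfolding x(3) y(3) z(3)
        using x(1,2) y(1,2) z(1,2) mult_S[OF x(2) y(2)] mult_S[OF y(2) z(2)] cs
        by (simp add: fr_add m_assoc)
    qed
  next
    show "\<zero>\<^bsub>Loc\<^esub> \<in> carrier Loc" unfolding Loc_zero using one_S by (simp add: fr_carr)
  next
    fix x assume "x \<in> carrier Loc"
    then obtain a s where x: "a \<in> carrier R" "s \<in> S" "x = fr a s" by (metis carr_fr)
    show "\<zero>\<^bsub>Loc\<^esub> \<oplus>\<^bsub>Loc\<^esub> x = x" unfolding Loc_zero using x one_S by (simp add: fr_add)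
    have "fr (\<ominus> a) s \<oplus>\<^bsub>Loc\<^esub> x = fr (\<ominus> a \<otimes> s \<oplus> a \<otimes> s) (s \<otimes> s)"
      unfolding x(3) using x(1,2) by (intro fr_add) auto
    also have "\<dots> = \<zero>\<^bsub>Loc\<^esub>"
      unfolding Loc_zero by (rule fr_eqI) (use x mult_S one_S in \<open>auto simp: l_minus l_neg\<close>)
    finally show "\<exists>y\<in>carrier Loc. y \<oplus>\<^bsub>Loc\<^esub> x = \<zero>\<^bsub>Loc\<^esub>"
      using x fr_carr[of "\<ominus> a" s] by blast
  qed
next
  show "comm_monoid Loc"
  proof (rule comm_monoidI)
    fix x y assume "x \<in> carrier Loc" "y \<in> carrier Loc"
    then obtain a s b t where x: "a \<in> carrier R" "s \<in> S" "x = fr a s"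
      and y: "b \<in> carrier R" "t \<in> S" "y = fr b t" by (metis carr_fr)
    show "x \<otimes>\<^bsub>Loc\<^esub> y \<in> carrier Loc"
      using x y mult_S by (simp add: fr_mult fr_carr)
    show "x \<otimes>\<^bsub>Loc\<^esub> y = y \<otimes>\<^bsub>Loc\<^esub> x"
      using x y by (simp add: fr_mult m_comm)
    fix z assume "z \<in> carrier Loc"
    then obtain c w where z: "c \<in> carrier R" "w \<in> S" "z = fr c w" by (metis carr_fr)
    show "x \<otimes>\<^bsub>Loc\<^esub> y \<otimes>\<^bsub>Loc\<^esub> z = x \<otimes>\<^bsub>Loc\<^esub> (y \<otimes>\<^bsub>Loc\<^esub> z)"
      unfolding x(3) y(3) z(3)
      using x(1,2) y(1,2) z(1,2) mult_S[OF x(2) y(2)] mult_S[OF y(2) z(2)]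
      by (simp add: fr_mult m_assoc)
  next
    show "\<one>\<^bsub>Loc\<^esub> \<in> carrier Loc" unfolding Loc_one using one_S by (simp add: fr_carr)
  next
    fix x assume "x \<in> carrier Loc"
    then obtain a s where x: "a \<in> carrier R" "s \<in> S" "x = fr a s" by (metis carr_fr)
    then show "\<one>\<^bsub>Loc\<^esub> \<otimes>\<^bsub>Loc\<^esub> x = x" unfolding Loc_one using one_S by (simp add: fr_mult)
  qed
next
  fix x y z assume "x \<in> carrier Loc" "y \<in> carrier Loc" "z \<in> carrier Loc"
  then obtain a s b t c w where x: "a \<in> carrier R" "s \<in> S" "x = fr a s"
    and y: "b \<in> carrier R" "t \<in> S" "y = fr b t" and z: "c \<in> carrier R" "w \<in> S" "z = fr c w"
    by (metis carr_fr)
  note st = mult_S[OF x(2) y(2)] and sw = mult_S[OF x(2) z(2)] and tw = mult_S[OF y(2) z(2)]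
  have cs: "s \<in> carrier R" "t \<in> carrier R" "w \<in> carrier R" using x y z by auto
  have "(x \<oplus>\<^bsub>Loc\<^esub> y) \<otimes>\<^bsub>Loc\<^esub> z = fr ((a \<otimes> t \<oplus> b \<otimes> s) \<otimes> c) ((s \<otimes> t) \<otimes> w)"
    unfolding x(3) y(3) z(3) using x(1,2) y(1,2) z(1,2) cs st by (simp add: fr_add fr_mult)
  moreover have "x \<otimes>\<^bsub>Loc\<^esub> z \<oplus>\<^bsub>Loc\<^esub> y \<otimes>\<^bsub>Loc\<^esub> z =
      fr ((a \<otimes> c) \<otimes> (t \<otimes> w) \<oplus> (b \<otimes> c) \<otimes> (s \<otimes> w)) ((s \<otimes> w) \<otimes> (t \<otimes> w))"
    unfolding x(3) y(3) z(3) using x(1,2) y(1,2) z(1,2) cs sw tw by (simp add: fr_add fr_mult)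
  moreover have "fr ((a \<otimes> t \<oplus> b \<otimes> s) \<otimes> c) ((s \<otimes> t) \<otimes> w) =
      fr ((a \<otimes> c) \<otimes> (t \<otimes> w) \<oplus> (b \<otimes> c) \<otimes> (s \<otimes> w)) ((s \<otimes> w) \<otimes> (t \<otimes> w))"
  proof (rule fr_eqI)
    show "(a \<otimes> t \<oplus> b \<otimes> s) \<otimes> c \<otimes> (s \<otimes> w \<otimes> (t \<otimes> w)) =
        (a \<otimes> c \<otimes> (t \<otimes> w) \<oplus> b \<otimes> c \<otimes> (s \<otimes> w)) \<otimes> (s \<otimes> t \<otimes> w)"
      using x(1) y(1) z(1) cs by algebra
  qed (use x y z cs mult_S[OF st z(2)] mult_S[OF sw tw] in auto)
  ultimately show "(x \<oplus>\<^bsub>Loc\<^esub> y) \<otimes>\<^bsub>Loc\<^esub> z = x \<otimes>\<^bsub>Loc\<^esub> z \<oplus>\<^bsub>Loc\<^esub> y \<otimes>\<^bsub>Loc\<^esub> z" by simp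
qed

section \<open>Extension and contraction of ideals\<close>

sublocale L: cring Loc
  by (rule Loc_cring)

abbreviation ext where "ext \<equiv> extend_at R P"

lemma fr_split: "a \<in> carrier R \<Longrightarrow> s \<in> S \<Longrightarrow> fr a s = fr \<one> s \<otimes>\<^bsub>Loc\<^esub> fr a \<one>"
  using one_S by (simp add: fr_mult)

lemma ext_eq:
  assumes J: "ideal J R" shows "ext J = {fr a s | a s. a \<in> J \<and> s \<in> S}" (is "_ = ?E")
proof
  have Jc: "a \<in> J \<Longrightarrow> a \<in> carrier R" for a using J idl_carr by blast
  have "ideal ?E Loc"
  proof (rule L.cring_idealI)
    show "?E \<subseteq> carrier Loc" using Jc fr_carr by auto
    show "\<zero>\<^bsub>Loc\<^esub> \<in> ?E" unfolding Loc_zero using idl_zero[OF J] one_S by blast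
  next
    fix x y assume "x \<in> ?E" "y \<in> ?E"
    then obtain a s b t where x: "a \<in> J" "s \<in> S" "x = fr a s" and y: "b \<in> J" "t \<in> S" "y = fr b t" by blast
    have "x \<oplus>\<^bsub>Loc\<^esub> y = fr (a \<otimes> t \<oplus> b \<otimes> s) (s \<otimes> t)"
      unfolding x(3) y(3) by (rule fr_add[OF Jc[OF x(1)] x(2) Jc[OF y(1)] y(2)])
    moreover have "a \<otimes> t \<oplus> b \<otimes> s \<in> J"
      using x y S_carr by (intro idl_add[OF J] idl_r[OF J]) auto
    ultimately show "x \<oplus>\<^bsub>Loc\<^esub> y \<in> ?E" using mult_S[OF x(2) y(2)] by blast
  next
    fix x y assume "x \<in> carrier Loc" "y \<in> ?E"
    then obtain a s b t where x: "a \<in> carrier R" "s \<in> S" "x = fr a s" and y: "b \<in> J" "t \<in> S" "y = fr b t"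
      by (auto elim: carr_fr)
    have "x \<otimes>\<^bsub>Loc\<^esub> y = fr (a \<otimes> b) (s \<otimes> t)"
      unfolding x(3) y(3) by (rule fr_mult[OF x(1,2) Jc[OF y(1)] y(2)])
    then show "x \<otimes>\<^bsub>Loc\<^esub> y \<in> ?E" using idl_l[OF J y(1) x(1)] mult_S[OF x(2) y(2)] by blast
  qed
  then show "ext J \<subseteq> ?E" unfolding extend_at_def by (rule L.genideal_minimal) (use one_S in blast)
  have c: "(\<lambda>a. fr a \<one>) ` J \<subseteq> carrier Loc" using Jc one_S fr_carr by auto
  note g = L.genideal_ideal[OF c] L.genideal_self[OF c]
  show "?E \<subseteq> ext J"
  proof
    fix x assume "x \<in> ?E"
    then obtain a s where x: "a \<in> J" "s \<in> S" "x = fr a s" by blast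
    have "fr a \<one> \<in> ext J" unfolding extend_at_def using g(2) x(1) by blast
    then have "fr \<one> s \<otimes>\<^bsub>Loc\<^esub> fr a \<one> \<in> ext J"
      unfolding extend_at_def using x(2) by (intro L.idl_l[OF g(1)] fr_carr) auto
    then show "x \<in> ext J" using fr_split[OF Jc[OF x(1)] x(2)] x(3) by simp
  qed
qed

lemma ext_ideal: "ideal J R \<Longrightarrow> ideal (ext J) Loc"
  unfolding extend_at_def
  using idl_carr[of J] one_S fr_carr by (intro L.genideal_ideal) auto

text \<open>Turns membership in an extended ideal into a statement about \<open>R\<close>. The
  numerator need not lie in \<open>J\<close> itself, as fractions are equal only up to a factor
  outside \<open>P\<close>.\<close>

lemma ext_mem_iff:
  assumes J: "ideal J R" and a: "a \<in> carrier R" "s \<in> S"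
  shows "fr a s \<in> ext J \<longleftrightarrow> a \<in> saturation R P J"
proof
  assume "fr a s \<in> ext J"
  then obtain b t where b: "b \<in> J" "t \<in> S" "fr a s = fr b t" unfolding ext_eq[OF J] by blast
  have bc: "b \<in> carrier R" using b J idl_carr by blast
  obtain u where u: "u \<in> S" "u \<otimes> (a \<otimes> t) = u \<otimes> (b \<otimes> s)"
    using b(3) fr_eq_iff[OF a bc b(2)] by blast
  have "(u \<otimes> t) \<otimes> a = u \<otimes> (a \<otimes> t)" using u a b by (simp add: m_ac)
  also have "\<dots> \<in> J" unfolding u(2) using u a b by (intro idl_l[OF J] idl_r[OF J]) auto
  finally show "a \<in> saturation R P J" using mult_S[OF u(1) b(2)] a unfolding saturation_def by blast
next
  assume "a \<in> saturation R P J"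
  then obtain u where u: "u \<in> S" "u \<otimes> a \<in> J" by (auto simp: saturation_def)
  have "fr a s = fr (u \<otimes> a) (u \<otimes> s)"
    by (rule fr_eqI) (use a u mult_S in \<open>auto simp: m_ac\<close>)
  then show "fr a s \<in> ext J" unfolding ext_eq[OF J] using u mult_S[OF u(1) a(2)] by blast
qed

lemma ext_memI: "ideal J R \<Longrightarrow> a \<in> J \<Longrightarrow> fr a \<one> \<in> ext J"
  unfolding ext_eq using one_S by blast

lemma ext_mono: "J \<subseteq> J' \<Longrightarrow> ideal J R \<Longrightarrow> ideal J' R \<Longrightarrow> ext J \<subseteq> ext J'"
  unfolding ext_eq by blast

lemma fr_hom: "(\<lambda>a. fr a \<one>) \<in> ring_hom R Loc"
  using one_S by (intro ring_hom_memI) (auto simp: fr_carr fr_mult fr_add Loc_one)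

definition contr where "contr W = {a \<in> carrier R. fr a \<one> \<in> W}"

lemma contr_ideal:
  assumes "ideal W Loc" shows "ideal (contr W) R"
proof -
  interpret ring_hom_ring R Loc "\<lambda>a. fr a \<one>"
    by (rule ring_hom_ringI2[OF ring_axioms L.ring_axioms fr_hom])
  show ?thesis unfolding contr_def by (rule ideal_vimage[OF assms])
qed

lemma ext_contr:
  assumes W: "ideal W Loc" shows "ext (contr W) = W"
proof
  show "ext (contr W) \<subseteq> W"
    unfolding extend_at_def by (rule L.genideal_minimal[OF W]) (auto simp: contr_def)
  show "W \<subseteq> ext (contr W)"
  proof
    fix x assume x: "x \<in> W"
    then obtain a s where a: "a \<in> carrier R" "s \<in> S" "x = fr a s"
      using L.idl_carr[OF W] by (metis carr_fr)
    have "fr s \<one> \<otimes>\<^bsub>Loc\<^esub> x \<in> W" using x a one_S by (intro L.idl_l[OF W] fr_carr) auto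
    moreover have "fr s \<one> \<otimes>\<^bsub>Loc\<^esub> x = fr a \<one>"
    proof -
      have "fr s \<one> \<otimes>\<^bsub>Loc\<^esub> fr a s = fr (s \<otimes> a) (\<one> \<otimes> s)"
        by (rule fr_mult) (use a one_S in auto)
      also have "\<dots> = fr a \<one>" by (rule fr_eqI) (use a one_S in \<open>auto simp: m_comm\<close>)
      finally show ?thesis unfolding a(3) .
    qed
    ultimately have "a \<in> contr W" using a by (simp add: contr_def)
    then show "x \<in> ext (contr W)" using a unfolding ext_eq[OF contr_ideal[OF W]] by blast
  qed
qed

lemma ext_carrier: "ext (carrier R) = carrier Loc"
  unfolding ext_eq[OF oneideal] by (simp add: local_at_def localization_def)

lemma ext_prod:
  assumes I: "ideal I R" and J: "ideal J R"
  shows "ext (I \<cdot> J) = ext I \<cdot>\<^bsub>Loc\<^esub> ext J"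
proof
  note IJ = ideal_prod_is_ideal[OF I J]
  note pr = L.ideal_prod_is_ideal[OF ext_ideal[OF I] ext_ideal[OF J]]
  have "I \<cdot> J \<subseteq> contr (ext I \<cdot>\<^bsub>Loc\<^esub> ext J)"
  proof (rule ideal_prod_least[OF contr_ideal[OF pr]])
    fix i j assume ij: "i \<in> I" "j \<in> J"
    then have c: "i \<in> carrier R" "j \<in> carrier R" using I J idl_carr by auto
    have "fr i \<one> \<otimes>\<^bsub>Loc\<^esub> fr j \<one> \<in> ext I \<cdot>\<^bsub>Loc\<^esub> ext J"
      by (rule ideal_prod.prod) (use ij I J in \<open>auto intro: ext_memI\<close>)
    then show "i \<otimes> j \<in> contr (ext I \<cdot>\<^bsub>Loc\<^esub> ext J)" using c one_S by (simp add: contr_def fr_mult)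
  qed
  then show "ext (I \<cdot> J) \<subseteq> ext I \<cdot>\<^bsub>Loc\<^esub> ext J"
    using ext_mono[OF _ IJ contr_ideal[OF pr]] ext_contr[OF pr] by simp
  show "ext I \<cdot>\<^bsub>Loc\<^esub> ext J \<subseteq> ext (I \<cdot> J)"
  proof (rule L.ideal_prod_least[OF ext_ideal[OF IJ]])
    fix x y assume "x \<in> ext I" "y \<in> ext J"
    then obtain a s b t where x: "a \<in> I" "s \<in> S" "x = fr a s" and y: "b \<in> J" "t \<in> S" "y = fr b t"
      unfolding ext_eq[OF I] ext_eq[OF J] by blast
    have "x \<otimes>\<^bsub>Loc\<^esub> y = fr (a \<otimes> b) (s \<otimes> t)"
      unfolding x(3) y(3) using idl_carr[OF I x(1)] idl_carr[OF J y(1)] x(2) y(2) by (intro fr_mult)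
    then show "x \<otimes>\<^bsub>Loc\<^esub> y \<in> ext (I \<cdot> J)"
      unfolding ext_eq[OF IJ] using ideal_prod.prod[OF x(1) y(1)] mult_S[OF x(2) y(2)] by blast
  qed
qed

lemma ext_power:
  assumes I: "ideal I R" shows "ext (ideal_power R I n) = ideal_power Loc (ext I) n"
  by (induct n) (simp_all add: ideal_power_0 ideal_power_Suc ext_carrier ext_prod I ideal_power_ideal)

lemma ext_genideal:
  assumes "G \<subseteq> carrier R"
  shows "ext (Idl G) = Idl\<^bsub>Loc\<^esub> ((\<lambda>a. fr a \<one>) ` G)"
proof
  have c: "(\<lambda>a. fr a \<one>) ` G \<subseteq> carrier Loc" using assms one_S fr_carr by auto
  note g = L.genideal_ideal[OF c] L.genideal_self[OF c]
  have "Idl G \<subseteq> contr (Idl\<^bsub>Loc\<^esub> ((\<lambda>a. fr a \<one>) ` G))"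
    by (rule genideal_minimal[OF contr_ideal[OF g(1)]]) (use g(2) assms in \<open>auto simp: contr_def\<close>)
  then show "ext (Idl G) \<subseteq> Idl\<^bsub>Loc\<^esub> ((\<lambda>a. fr a \<one>) ` G)"
    using ext_mono[OF _ genideal_ideal[OF assms] contr_ideal[OF g(1)]] ext_contr[OF g(1)] by simp
  show "Idl\<^bsub>Loc\<^esub> ((\<lambda>a. fr a \<one>) ` G) \<subseteq> ext (Idl G)"
    using genideal_self[OF assms]
    by (intro L.genideal_minimal ext_ideal genideal_ideal assms) (auto intro!: ext_memI genideal_ideal assms)
qed

lemma saturation_prime:
  assumes "primeideal Q R" "Q \<subseteq> P" shows "saturation R P Q = Q"
proof
  show "saturation R P Q \<subseteq> Q"
    using primeideal.I_prime[OF assms(1)] assms(2) unfolding saturation_def by blast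
  show "Q \<subseteq> saturation R P Q" by (rule saturation_ideal(2)[OF primeideal.axioms(1)[OF assms(1)] P_prime])
qed

lemma ext_P_proper: "ext P \<noteq> carrier Loc"
proof
  assume "ext P = carrier Loc"
  then have "fr \<one> \<one> \<in> ext P" using one_S by (simp add: fr_carr)
  then have "\<one> \<in> P"
    using ext_mem_iff[OF P_ideal _ one_S, of \<one>] saturation_prime[OF P_prime subset_refl] by simp
  then show False using one_S by simp
qed

lemma proper_sub_ext_P:
  assumes W: "ideal W Loc" "W \<noteq> carrier Loc" shows "W \<subseteq> ext P"
proof
  fix x assume x: "x \<in> W"
  then obtain a s where a: "a \<in> carrier R" "s \<in> S" "x = fr a s"
    using L.idl_carr[OF W(1)] by (metis carr_fr)
  have "a \<in> P"
  proof (rule ccontr)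
    assume "a \<notin> P"
    then have aS: "a \<in> S" using a by simp
    have "fr s a \<otimes>\<^bsub>Loc\<^esub> x \<in> W" using x a aS by (intro L.idl_l[OF W(1)] fr_carr) auto
    moreover have "fr s a \<otimes>\<^bsub>Loc\<^esub> x = \<one>\<^bsub>Loc\<^esub>"
    proof -
      have "fr s a \<otimes>\<^bsub>Loc\<^esub> fr a s = fr (s \<otimes> a) (a \<otimes> s)"
        by (rule fr_mult) (use a aS in auto)
      also have "\<dots> = fr \<one> \<one>"
        by (rule fr_eqI) (use a aS one_S mult_S[OF aS a(2)] in \<open>auto simp: m_comm\<close>)
      finally show ?thesis unfolding a(3) Loc_one .
    qed
    ultimately show False using ideal.one_imp_carrier[OF W(1)] W(2) by simp
  qed
  then show "x \<in> ext P" unfolding ext_eq[OF P_ideal] using a by blast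
qed

lemma Loc_noetherian: "noetherian_ring Loc"
proof (rule L.noetherian_ringI)
  fix W assume W: "ideal W Loc"
  obtain G where G: "G \<subseteq> carrier R" "finite G" "contr W = Idl G"
    using finetely_gen[OF contr_ideal[OF W]] by blast
  then have "W = Idl\<^bsub>Loc\<^esub> ((\<lambda>a. fr a \<one>) ` G)" using ext_genideal[OF G(1)] ext_contr[OF W] by simp
  moreover have "(\<lambda>a. fr a \<one>) ` G \<subseteq> carrier Loc" using G(1) one_S fr_carr by auto
  ultimately show "\<exists>A\<subseteq>carrier Loc. finite A \<and> W = Idl\<^bsub>Loc\<^esub> A" using G(2) by blast
qed

lemma Loc_local: "noetherian_local_ring Loc (ext P)"
proof -
  have max: "maximalideal (ext P) Loc"
  proof (rule maximalidealI[OF ext_ideal[OF P_ideal]])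
    fix J assume "ideal J Loc" "ext P \<subseteq> J" "J \<subseteq> carrier Loc"
    then show "J = ext P \<or> J = carrier Loc" using proper_sub_ext_P[of J] by blast
  qed (use ext_P_proper in simp)
  have "M = ext P" if M: "maximalideal M Loc" for M
  proof -
    have iM: "ideal M Loc" and nM: "M \<noteq> carrier Loc"
      using maximalideal.axioms(1)[OF M] maximalideal.I_notcarr[OF M] by auto
    have "ext P = M \<or> ext P = carrier Loc"
      by (rule maximalideal.I_maximal[OF M ext_ideal[OF P_ideal] proper_sub_ext_P[OF iM nM]
            L.idl_sub[OF ext_ideal[OF P_ideal]]])
    then show ?thesis using ext_P_proper by simp
  qed
  with max show ?thesis
    unfolding noetherian_local_ring_def noetherian_local_ring_axioms_def
    using Loc_cring Loc_noetherian by blast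
qed

lemma ext_prime:
  assumes Q: "primeideal Q R" "Q \<subseteq> P" shows "primeideal (ext Q) Loc"
proof -
  have iQ: "ideal Q R" using Q by (rule_tac primeideal.axioms)
  have mem: "fr a s \<in> ext Q \<longleftrightarrow> a \<in> Q" if "a \<in> carrier R" "s \<in> S" for a s
    using ext_mem_iff[OF iQ that] saturation_prime[OF Q] by simp
  show ?thesis
  proof (rule primeidealI[OF ext_ideal[OF iQ] Loc_cring])
    show "carrier Loc \<noteq> ext Q"
      using ext_mono[OF Q(2) iQ P_ideal] ext_P_proper L.idl_sub[OF ext_ideal[OF P_ideal]] by blast
  next
    fix x y assume "x \<in> carrier Loc" "y \<in> carrier Loc" and xy: "x \<otimes>\<^bsub>Loc\<^esub> y \<in> ext Q"
    then obtain a s b t where x: "a \<in> carrier R" "s \<in> S" "x = fr a s"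
      and y: "b \<in> carrier R" "t \<in> S" "y = fr b t" by (metis carr_fr)
    have "a \<otimes> b \<in> Q" using xy x y mult_S mem[of "a \<otimes> b" "s \<otimes> t"] by (simp add: fr_mult)
    then show "x \<in> ext Q \<or> y \<in> ext Q"
      using primeideal.I_prime[OF Q(1) x(1) y(1)] mem x y by simp
  qed
qed

lemma contr_prime:
  assumes W: "primeideal W Loc" shows "primeideal (contr W) R" "contr W \<subseteq> P"
proof -
  have iW: "ideal W Loc" and nW: "W \<noteq> carrier Loc"
    using W primeideal.I_notcarr[OF W] by (auto dest: primeideal.axioms)
  show sub: "contr W \<subseteq> P"
  proof
    fix a assume "a \<in> contr W"
    then have a: "a \<in> carrier R" "fr a \<one> \<in> ext P" using proper_sub_ext_P[OF iW nW] by (auto simp: contr_def)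
    then show "a \<in> P"
      using ext_mem_iff[OF P_ideal a(1) one_S] saturation_prime[OF P_prime subset_refl] by simp
  qed
  show "primeideal (contr W) R"
  proof (rule primeidealI[OF contr_ideal[OF iW] is_cring])
    show "carrier R \<noteq> contr W" using sub one_S by auto
    fix a b assume ab: "a \<in> carrier R" "b \<in> carrier R" "a \<otimes> b \<in> contr W"
    then have "fr a \<one> \<otimes>\<^bsub>Loc\<^esub> fr b \<one> \<in> W" using one_S by (simp add: contr_def fr_mult)
    then show "a \<in> contr W \<or> b \<in> contr W"
      using primeideal.I_prime[OF W, of "fr a \<one>" "fr b \<one>"] ab one_S fr_carr by (auto simp: contr_def)
  qed
qed

text \<open>Primes inside \<open>P\<close> are saturated, so distinct ones have distinct
  extensions.\<close>

lemma prime_height_le_krull_dim: "prime_height R P \<le> krull_dim Loc"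
  unfolding prime_height_def krull_dim_def
proof (rule chain_length_mono[where f = ext])
  fix Q assume "Q \<in> {Q. primeideal Q R \<and> Q \<subseteq> P}"
  then show "ext Q \<in> {P. primeideal P Loc}" using ext_prime by simp
next
  fix Q Q' assume Q: "Q \<in> {Q. primeideal Q R \<and> Q \<subseteq> P}" "Q' \<in> {Q. primeideal Q R \<and> Q \<subseteq> P}" "Q \<subset> Q'"
  then have i: "ideal Q R" "ideal Q' R" by (auto dest: primeideal.axioms)
  obtain a where a: "a \<in> Q'" "a \<notin> Q" using Q(3) by blast
  have "fr a \<one> \<in> ext Q'" using a i by (intro ext_memI)
  moreover have "fr a \<one> \<notin> ext Q"
    using ext_mem_iff[OF i(1) idl_carr[OF i(2) a(1)] one_S] saturation_prime[of Q] Q a by simp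
  ultimately show "ext Q \<subset> ext Q'" using ext_mono[OF _ i] Q(3) by blast
qed

text \<open>A prime of \<open>R_P\<close> over the extension of \<open>I\<close> contracts to a
  prime between \<open>I\<close> and \<open>P\<close>, which is \<open>P\<close> by minimality. So
  it is the maximal ideal.\<close>

lemma ext_power_primary:
  assumes I: "ideal I R" and P: "P \<in> min_primes R I"
  shows "\<exists>k. ideal_power Loc (ext P) k \<subseteq> ext I"
proof -
  interpret LL: noetherian_local_ring Loc "ext P" by (rule Loc_local)
  show ?thesis
  proof (rule LL.power_sub_of_primes[OF ext_ideal[OF P_ideal] ext_ideal[OF I]])
    fix W assume W: "primeideal W Loc" "ext I \<subseteq> W"
    have iW: "ideal W Loc" using W by (auto dest: primeideal.axioms)
    have "I \<subseteq> contr W" using W(2) ext_memI[OF I] idl_carr[OF I] by (auto simp: contr_def)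
    then have "contr W = P" using contr_prime[OF W(1)] P by (auto simp: min_primes_def)
    then show "ext P \<subseteq> W" using ext_contr[OF iW] by simp
  qed
qed

end

section \<open>Homogeneous ideals of the Rees algebra\<close>

text \<open>A homogeneous ideal of \<open>\<Oplus>n. I^n\<close> is given by the sequence of its components.\<close>

definition hom_ideal :: "('a, 'b) ring_scheme \<Rightarrow> 'a set \<Rightarrow> (nat \<Rightarrow> 'a set) \<Rightarrow> bool" where
  "hom_ideal R I H \<longleftrightarrow> (\<forall>n. ideal (H n) R \<and> H n \<subseteq> ideal_power R I n) \<and>
     (\<forall>m n. \<forall>a\<in>ideal_power R I m. \<forall>h\<in>H n. a \<otimes>\<^bsub>R\<^esub> h \<in> H (m + n))"

text \<open>Primality is required of homogeneous elements only; \<open>fiber_prime\<close> extends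
  it to arbitrary elements of the fiber cone. The condition on \<open>p 0\<close> keeps 1 out of the
  ideal.\<close>

definition hom_prime :: "('a, 'b) ring_scheme \<Rightarrow> 'a set \<Rightarrow> (nat \<Rightarrow> 'a set) \<Rightarrow> bool" where
  "hom_prime R I p \<longleftrightarrow> hom_ideal R I p \<and> p 0 \<noteq> carrier R \<and>
     (\<forall>m n. \<forall>a\<in>ideal_power R I m. \<forall>b\<in>ideal_power R I n.
        a \<otimes>\<^bsub>R\<^esub> b \<in> p (m + n) \<longrightarrow> a \<in> p m \<or> b \<in> p n)"

text \<open>The homogeneous ideal generated by \<open>H\<close> and the element \<open>a\<close> of
  degree \<open>d\<close>. Degrees below \<open>d\<close> are treated apart because
  \<open>n - d\<close> is truncated there.\<close>

definition hom_add :: "('a, 'b) ring_scheme \<Rightarrow> 'a set \<Rightarrow> (nat \<Rightarrow> 'a set) \<Rightarrow> nat \<Rightarrow> 'a \<Rightarrow> nat \<Rightarrow> 'a set" where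
  "hom_add R I H d a n =
     (if n < d then H n else H n <+>\<^bsub>R\<^esub> (\<otimes>\<^bsub>R\<^esub>) a ` ideal_power R I (n - d))"

lemma hom_idealD:
  assumes "hom_ideal R I H"
  shows "ideal (H n) R" "H n \<subseteq> ideal_power R I n"
    "a \<in> ideal_power R I m \<Longrightarrow> h \<in> H n \<Longrightarrow> a \<otimes>\<^bsub>R\<^esub> h \<in> H (m + n)"
  using assms by (auto simp: hom_ideal_def)

lemma hom_primeD:
  assumes "hom_prime R I p"
  shows "hom_ideal R I p" "p 0 \<noteq> carrier R"
    "a \<in> ideal_power R I m \<Longrightarrow> b \<in> ideal_power R I n \<Longrightarrow> a \<otimes>\<^bsub>R\<^esub> b \<in> p (m + n) \<Longrightarrow> a \<in> p m \<or> b \<in> p n"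
  using assms by (auto simp: hom_prime_def)

locale noetherian_cring_ideal = noetherian_cring +
  fixes I assumes I_ideal: "ideal I R"
begin

abbreviation "Ip \<equiv> ideal_power R I"

lemma Ip_ideal: "ideal (Ip n) R"
  by (rule ideal_power_ideal[OF I_ideal])

lemma Ip_carr: "a \<in> Ip n \<Longrightarrow> a \<in> carrier R"
  using Ip_ideal idl_carr by blast

lemma hom_ideal_add:
  assumes H: "hom_ideal R I H" and a: "a \<in> Ip d"
  shows "hom_ideal R I (hom_add R I H d a)" "H n \<subseteq> hom_add R I H d a n" "a \<in> hom_add R I H d a d"
proof -
  note H = hom_idealD[OF H]
  have ac: "a \<in> carrier R" using a Ip_carr by blast
  note aI = ideal_smult[OF Ip_ideal ac]
  let ?A = "hom_add R I H d a"
  show HA: "H n \<subseteq> ?A n" for n using set_add_l[OF H(1) aI] by (simp add: hom_add_def)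
  have "a = a \<otimes> \<one>" using ac by simp
  then have "a \<in> (\<otimes>) a ` Ip (d - d)" by (simp add: ideal_power_0 image_iff) (metis one_closed)
  then show "a \<in> ?A d" using set_add_r[OF H(1) aI] by (auto simp: hom_add_def)
  show "hom_ideal R I ?A"
    unfolding hom_ideal_def
  proof (intro conjI allI ballI)
    fix n
    show "ideal (?A n) R" using H(1) aI add_ideals by (simp add: hom_add_def)
    have "(\<otimes>) a ` Ip (n - d) \<subseteq> Ip n" if "\<not> n < d"
      using that ideal_power_mult_mem[OF I_ideal a, of _ "n - d"] by auto
    then show "?A n \<subseteq> Ip n"
      using H(2) by (auto simp: hom_add_def dest!: set_add_least[OF Ip_ideal H(2), THEN subsetD, rotated])
  next
    fix m n b h assume b: "b \<in> Ip m" and h: "h \<in> ?A n"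
    show "b \<otimes> h \<in> ?A (m + n)"
    proof (cases "n < d")
      case True
      then have "b \<otimes> h \<in> H (m + n)" using h H(3)[OF b] by (simp add: hom_add_def)
      then show ?thesis using HA by blast
    next
      case False
      then obtain h' u where hu: "h' \<in> H n" "u \<in> Ip (n - d)" "h = h' \<oplus> a \<otimes> u"
        using h by (auto simp: hom_add_def set_add_mem)
      have c: "b \<in> carrier R" "h' \<in> carrier R" "u \<in> carrier R"
        using b hu H(1) idl_carr Ip_carr by auto
      have "b \<otimes> h = b \<otimes> h' \<oplus> a \<otimes> (b \<otimes> u)" unfolding hu(3) using c ac by (simp add: r_distr m_lcomm)
      moreover have "b \<otimes> u \<in> Ip (m + n - d)"
        using ideal_power_mult_mem[OF I_ideal b hu(2)] False by simp
      ultimately show ?thesis using False H(3)[OF b hu(1)] by (auto simp: hom_add_def set_add_mem)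
    qed
  qed
qed

lemma hom_add_least:
  assumes G: "hom_ideal R I G" and "\<And>n. H n \<subseteq> G n" "a \<in> G d"
  shows "hom_add R I H d a n \<subseteq> G n"
proof (cases "n < d")
  case False
  note G = hom_idealD[OF G]
  have "(\<otimes>) a ` Ip (n - d) \<subseteq> G n"
  proof clarify
    fix u assume u: "u \<in> Ip (n - d)"
    have "a \<otimes> u = u \<otimes> a" using Ip_carr[OF u] idl_carr[OF G(1) assms(3)] m_comm by simp
    then show "a \<otimes> u \<in> G n" using G(3)[OF u assms(3)] False by simp
  qed
  then show ?thesis using False assms(2) set_add_least[OF G(1)] by (simp add: hom_add_def)
qed (use assms(2) in \<open>simp add: hom_add_def\<close>)

text \<open>Of the four partial products of elements of \<open>H + (a)\<close> and
  \<open>H + (b)\<close>, three have a factor in \<open>H\<close> and the fourth is a multiple of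
  \<open>ab\<close>.\<close>

lemma hom_add_mult:
  assumes H: "hom_ideal R I H" and a: "a \<in> Ip m" and b: "b \<in> Ip n" and ab: "a \<otimes> b \<in> H (m + n)"
    and u: "u \<in> hom_add R I H m a k" and v: "v \<in> hom_add R I H n b l"
  shows "u \<otimes> v \<in> H (k + l)"
proof -
  note A = hom_ideal_add[OF H a] and B = hom_ideal_add[OF H b]
  have uI: "u \<in> Ip k" and vI: "v \<in> Ip l" using u v hom_idealD(2)[OF A(1)] hom_idealD(2)[OF B(1)] by blast+
  note c = Ip_carr[OF uI] Ip_carr[OF vI] Ip_carr[OF a] Ip_carr[OF b]
  note H = hom_idealD[OF H]
  have left: "x \<otimes> v \<in> H (k + l)" if "x \<in> H k" for x
    using H(3)[OF vI that] m_comm[OF c(2) idl_carr[OF H(1) that]] by (simp add: add.commute)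
  have right: "u \<otimes> x \<in> H (k + l)" if "x \<in> H l" for x
    using H(3)[OF uI that] .
  show ?thesis
  proof (cases "k < m \<or> l < n")
    case True
    then show ?thesis using left right u v by (auto simp: hom_add_def)
  next
    case False
    then obtain x y where xy: "x \<in> H k" "y \<in> Ip (k - m)" "u = x \<oplus> a \<otimes> y"
      using u by (auto simp: hom_add_def set_add_mem)
    obtain z w where zw: "z \<in> H l" "w \<in> Ip (l - n)" "v = z \<oplus> b \<otimes> w"
      using v False by (auto simp: hom_add_def set_add_mem)
    note c' = idl_carr[OF H(1) xy(1)] Ip_carr[OF xy(2)] idl_carr[OF H(1) zw(1)] Ip_carr[OF zw(2)]
    have ay: "a \<otimes> y \<in> Ip k" using ideal_power_mult_mem[OF I_ideal a xy(2)] False by simp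
    have "(y \<otimes> w) \<otimes> (a \<otimes> b) \<in> H ((k - m + (l - n)) + (m + n))"
      by (rule H(3)[OF ideal_power_mult_mem[OF I_ideal xy(2) zw(2)] ab])
    then have 1: "(y \<otimes> w) \<otimes> (a \<otimes> b) \<in> H (k + l)" using False by (simp add: algebra_simps)
    have "u \<otimes> v = x \<otimes> v \<oplus> (a \<otimes> y) \<otimes> v" unfolding xy(3) using c c' by (simp add: l_distr)
    also have "(a \<otimes> y) \<otimes> v = (a \<otimes> y) \<otimes> z \<oplus> (y \<otimes> w) \<otimes> (a \<otimes> b)"
      unfolding zw(3) using c c' by (simp add: r_distr m_ac)
    finally show ?thesis
      using left[OF xy(1)] H(3)[OF ay zw(1)] 1 idl_add[OF H(1)] by simp
  qed
qed

text \<open>The Noetherian property of the Rees algebra for homogeneous ideals: an infinite sequence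
  of proper enlargements would contradict \<open>graded_acc\<close>.\<close>

lemma hom_ideal_maximal:
  assumes "H0 \<in> \<F>" and hom: "\<And>H. H \<in> \<F> \<Longrightarrow> hom_ideal R I H"
  obtains M where "M \<in> \<F>" "\<And>H. H \<in> \<F> \<Longrightarrow> (\<And>n. M n \<subseteq> H n) \<Longrightarrow> H = M"
proof -
  have "\<exists>M\<in>\<F>. \<forall>H\<in>\<F>. (\<forall>n. M n \<subseteq> H n) \<longrightarrow> H = M"
  proof (rule ccontr)
    assume neg: "\<not> ?thesis"
    have "\<exists>H. H \<in> \<F> \<and> (\<forall>n. M n \<subseteq> H n) \<and> H \<noteq> M" if "M \<in> \<F>" for M
      using neg that by blast
    then obtain g where g: "\<And>M. M \<in> \<F> \<Longrightarrow> g M \<in> \<F> \<and> (\<forall>n. M n \<subseteq> g M n) \<and> g M \<noteq> M" by metis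
    define Z where "Z = rec_nat H0 (\<lambda>_. g)"
    have Z: "Z k \<in> \<F>" for k by (induct k) (use assms(1) g in \<open>auto simp: Z_def\<close>)
    have ZS: "Z k n \<subseteq> Z (Suc k) n" "Z (Suc k) \<noteq> Z k" for k n
      using g[OF Z[of k]] by (auto simp: Z_def)
    obtain x t where x: "\<And>i. i < (t::nat) \<Longrightarrow> x i \<in> carrier R" "I = Idl (x ` {..<t})"
      using finite_generators[OF I_ideal] by blast
    interpret G: fin_gen_ideal R x t I by unfold_locales (use x in auto)
    have gr: "graded_sub R x t H" if "H \<in> \<F>" for H
      unfolding graded_sub_def
      using hom_idealD[OF hom[OF that]] hom_idealD(3)[OF hom[OF that], of _ 1] G.x_mem
      by (simp add: ideal_power_1[OF I_ideal])
    have "\<exists>k0. \<forall>k\<ge>k0. \<forall>n. Z k n = Z k0 n"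
    proof (rule graded_acc[where V = "\<lambda>_. {\<zero>}" and x = x and s = t])
      fix W assume W: "graded_sub R x t W" "\<And>n. {\<zero>} \<subseteq> W n" "\<And>n. W n \<subseteq> (\<Union>k. Z k n)"
      show "fin_gen R x t (\<lambda>_. {\<zero>}) W"
      proof (rule graded_noetherian[OF order_refl x(1) G.qp_graded _ W(1,2)])
        show "graded_sub R x t (\<lambda>_. {\<zero>})" using x(1) by (auto simp: graded_sub_def zeroideal)
        show "W n \<subseteq> Ip n" for n using W(3)[of n] hom_idealD(2)[OF hom[OF Z]] by blast
        show "fin_gen R x t (\<lambda>_. {\<zero>}) Ip" unfolding fin_gen_def using G.qp_gen_at by blast
      qed auto
    next
      fix n show "{\<zero>} \<subseteq> Z 0 n" using idl_zero[OF hom_idealD(1)[OF hom[OF Z]]] by simp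
    qed (use gr[OF Z] ZS in auto)
    then obtain k0 where "\<And>n. Z (Suc k0) n = Z k0 n" by (meson le_SucI order_refl)
    then show False using ZS(2)[of k0] by blast
  qed
  then show ?thesis using that by metis
qed

text \<open>Noetherian induction. A proper homogeneous ideal that is not prime contains a product
  \<open>ab\<close> of homogeneous elements but neither factor, and adjoining either factor gives a
  strictly larger ideal.\<close>

lemma hom_ideal_induct [consumes 1, case_names unit prime product]:
  assumes "hom_ideal R I H"
    and unit: "\<And>H. hom_ideal R I H \<Longrightarrow> H 0 = carrier R \<Longrightarrow> Q H"
    and prime: "\<And>H. hom_prime R I H \<Longrightarrow> Q H"
    and product: "\<And>H m n a b. hom_ideal R I H \<Longrightarrow> a \<in> Ip m \<Longrightarrow> b \<in> Ip n \<Longrightarrow> a \<otimes> b \<in> H (m + n) \<Longrightarrow>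
      Q (hom_add R I H m a) \<Longrightarrow> Q (hom_add R I H n b) \<Longrightarrow> Q H"
  shows "Q H"
proof (rule ccontr)
  assume "\<not> Q H"
  then have "H \<in> {H. hom_ideal R I H \<and> \<not> Q H}" using assms(1) by simp
  then obtain M where M: "M \<in> {H. hom_ideal R I H \<and> \<not> Q H}"
    and max: "\<And>H. H \<in> {H. hom_ideal R I H \<and> \<not> Q H} \<Longrightarrow> (\<And>n. M n \<subseteq> H n) \<Longrightarrow> H = M"
    by (rule hom_ideal_maximal) (simp, rule that, assumption, blast)
  have hM: "hom_ideal R I M" and nQ: "\<not> Q M" using M by auto
  have Qadd: "Q (hom_add R I M d a)" if "a \<in> Ip d" "a \<notin> M d" for a d
  proof (rule ccontr)
    assume "\<not> ?thesis"
    then have "hom_add R I M d a = M"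
      using hom_ideal_add(1,2)[OF hM that(1)] by (intro max) simp_all
    then show False using hom_ideal_add(3)[OF hM that(1)] that(2) by simp
  qed
  have "\<not> hom_prime R I M" "M 0 \<noteq> carrier R" using nQ prime unit hM by auto
  then obtain m n a b where "a \<in> Ip m" "b \<in> Ip n" "a \<otimes> b \<in> M (m + n)" "a \<notin> M m" "b \<notin> M n"
    using hM unfolding hom_prime_def by blast
  then show False using product[OF hM, of a m b n] Qadd nQ by blast
qed

text \<open>A prime over \<open>H\<close> contains one of the factors of \<open>ab \<in> H\<close>,
  so in the product case the two finite sets are united. The result includes all minimal homogeneous
  primes over \<open>H\<close>.\<close>

lemma finite_hom_primes:
  assumes "hom_ideal R I H"
  shows "\<exists>\<P>. finite \<P> \<and> (\<forall>p\<in>\<P>. hom_prime R I p \<and> H \<le> p) \<and>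
    (\<forall>p. hom_prime R I p \<longrightarrow> H \<le> p \<longrightarrow> (\<exists>q\<in>\<P>. q \<le> p))"
  using assms
proof (induct rule: hom_ideal_induct)
  case (unit H)
  have "\<not> H \<le> p" if "hom_prime R I p" for p
  proof
    assume "H \<le> p"
    then have "carrier R \<subseteq> p 0" using unit(2) by (simp add: le_fun_def) metis
    then show False
      using hom_primeD(2)[OF that] idl_sub[OF hom_idealD(1)[OF hom_primeD(1)[OF that]]] by blast
  qed
  then show ?case by (intro exI[of _ "{}"]) auto
next
  case (prime H)
  then show ?case by (intro exI[of _ "{H}"]) auto
next
  case (product H m n a b)
  obtain \<P>1 where P1: "finite \<P>1" "\<forall>p\<in>\<P>1. hom_prime R I p \<and> hom_add R I H m a \<le> p"
    "\<forall>p. hom_prime R I p \<longrightarrow> hom_add R I H m a \<le> p \<longrightarrow> (\<exists>q\<in>\<P>1. q \<le> p)" using product(5) by blast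
  obtain \<P>2 where P2: "finite \<P>2" "\<forall>p\<in>\<P>2. hom_prime R I p \<and> hom_add R I H n b \<le> p"
    "\<forall>p. hom_prime R I p \<longrightarrow> hom_add R I H n b \<le> p \<longrightarrow> (\<exists>q\<in>\<P>2. q \<le> p)" using product(6) by blast
  have le: "H \<le> hom_add R I H m a" "H \<le> hom_add R I H n b"
    using hom_ideal_add(2)[OF product(1,2)] hom_ideal_add(2)[OF product(1,3)] by (auto simp: le_fun_def)
  have "\<exists>q\<in>\<P>1 \<union> \<P>2. q \<le> p" if p: "hom_prime R I p" "H \<le> p" for p
  proof -
    have Hp: "H n \<subseteq> p n" for n using p(2) by (simp add: le_fun_def)
    then have "a \<in> p m \<or> b \<in> p n" using hom_primeD(3)[OF p(1) product(2,3)] product(4) by blast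
    then show ?thesis
    proof
      assume "a \<in> p m"
      then have "hom_add R I H m a \<le> p"
        unfolding le_fun_def using hom_add_least[OF hom_primeD(1)[OF p(1)] Hp] by blast
      then show ?thesis using P1(3) p(1) by blast
    next
      assume "b \<in> p n"
      then have "hom_add R I H n b \<le> p"
        unfolding le_fun_def using hom_add_least[OF hom_primeD(1)[OF p(1)] Hp] by blast
      then show ?thesis using P2(3) p(1) by blast
    qed
  qed
  moreover have "\<forall>p\<in>\<P>1 \<union> \<P>2. hom_prime R I p \<and> H \<le> p" using P1(2) P2(2) le by (meson UnE order_trans)
  ultimately show ?case using P1(1) P2(1) by (intro exI[of _ "\<P>1 \<union> \<P>2"]) blast
qed

text \<open>The graded analogue of \<open>power_sub_of_primes\<close>: a prime allows
  \<open>N = 1\<close>, and the exponents add up in the product case.\<close>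

lemma irrelevant_power:
  assumes "hom_ideal R I H" "\<And>p. hom_prime R I p \<Longrightarrow> H \<le> p \<Longrightarrow> I \<subseteq> p 1"
  shows "\<exists>N. Ip N \<subseteq> H N"
  using assms
proof (induct rule: hom_ideal_induct)
  case (unit H)
  then show ?case by (intro exI[of _ 0]) (simp add: ideal_power_0)
next
  case (prime H)
  then show ?case using ideal_power_1[OF I_ideal] by (intro exI[of _ 1]) simp
next
  case (product H m n a b)
  have le: "H \<le> hom_add R I H m a" "H \<le> hom_add R I H n b"
    using hom_ideal_add(2)[OF product(1,2)] hom_ideal_add(2)[OF product(1,3)] by (auto simp: le_fun_def)
  obtain N1 where N1: "Ip N1 \<subseteq> hom_add R I H m a N1" using product(5,7) le(1) order_trans by blast
  obtain N2 where N2: "Ip N2 \<subseteq> hom_add R I H n b N2" using product(6,7) le(2) order_trans by blast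
  have "Ip N1 \<cdot> Ip N2 \<subseteq> H (N1 + N2)"
    by (rule ideal_prod_least[OF hom_idealD(1)[OF product(1)]])
      (use hom_add_mult[OF product(1-4)] N1 N2 in blast)
  then show ?case unfolding ideal_power_add[OF I_ideal, symmetric] by blast
qed

end

section \<open>The fiber cone\<close>

lemma (in cring) idl_finsum:
  assumes "ideal J R" "finite A" "\<And>i. i \<in> A \<Longrightarrow> f i \<in> J"
  shows "(\<Oplus>i\<in>A. f i) \<in> J"
  using assms(2,3)
proof (induct A)
  case empty
  then show ?case using idl_zero[OF assms(1)] by simp
next
  case (insert x A)
  then have "f \<in> A \<rightarrow> carrier R" "f x \<in> carrier R" using idl_carr[OF assms(1)] by auto
  then show ?case using insert idl_add[OF assms(1)] by simp
qed

text \<open>Transports the ring axioms along a surjection, which spares checking them for the fiber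
  cone. Zero is matched separately because \<open>ring_hom\<close> prescribes only sums, products
  and 1.\<close>

lemma cring_surj:
  assumes S: "cring S" and h: "h \<in> ring_hom S F" and surj: "h ` carrier S = carrier F"
    and zero: "h \<zero>\<^bsub>S\<^esub> = \<zero>\<^bsub>F\<^esub>"
  shows "cring F"
proof -
  interpret S: cring S by fact
  have "F\<lparr>carrier := h ` carrier S, zero := h \<zero>\<^bsub>S\<^esub>\<rparr> = F" unfolding surj zero by simp
  then interpret F: ring F using S.ring_hom_imp_img_ring[OF h] by simp
  show ?thesis
  proof (rule cring.intro[OF F.ring_axioms], rule F.monoid_comm_monoidI)
    fix x y assume "x \<in> carrier F" "y \<in> carrier F"
    then obtain a b where "a \<in> carrier S" "b \<in> carrier S" "x = h a" "y = h b" using surj by blast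
    then show "x \<otimes>\<^bsub>F\<^esub> y = y \<otimes>\<^bsub>F\<^esub> x"
      using ring_hom_mult[OF h, of a b] ring_hom_mult[OF h, of b a] S.m_comm by simp
  qed
qed

locale local_ring_ideal = noetherian_local_ring R \<mm> + noetherian_cring_ideal R I
  for R (structure) and \<mm> and I
begin

abbreviation "Jn n \<equiv> \<mm> \<cdot> Ip n"

abbreviation "F \<equiv> fiber_cone R \<mm> I"

text \<open>The Rees algebra as the subring \<open>R[It]\<close> of the polynomial ring; the fiber
  cone is its image under \<open>proj\<close> and inherits the ring axioms from it.\<close>

definition rees_carrier :: "(nat \<Rightarrow> 'a) set" where
  "rees_carrier = {a \<in> up R. \<forall>n. a n \<in> Ip n}"

definition proj :: "(nat \<Rightarrow> 'a) \<Rightarrow> nat \<Rightarrow> 'a set" where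
  "proj a n = Jn n +> a n"

lemma Jn_ideal: "ideal (Jn n) R"
  by (rule ideal_prod_is_ideal[OF mm_ideal Ip_ideal])

lemma Jn_sub: "Jn n \<subseteq> Ip n"
  using ideal_prod_inter[OF mm_ideal Ip_ideal] by blast

lemma Jn_mult: "a \<in> Ip m \<Longrightarrow> j \<in> Jn n \<Longrightarrow> a \<otimes> j \<in> Jn (m + n)"
proof -
  assume a: "a \<in> Ip m" and j: "j \<in> Jn n"
  have "Ip m \<cdot> (\<mm> \<cdot> Ip n) = \<mm> \<cdot> Ip (m + n)"
    using ideal_prod_assoc[OF Ip_ideal mm_ideal Ip_ideal, of m n]
      ideal_prod_assoc[OF mm_ideal Ip_ideal Ip_ideal, of m n]
      ideal_prod_commute[OF Ip_ideal mm_ideal, of m] by (simp add: ideal_power_add[OF I_ideal])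
  then show ?thesis using ideal_prod.prod[OF a j, of R] by simp
qed

lemma hom_ideal_Jn: "hom_ideal R I (\<lambda>n. Jn n)"
  using Jn_ideal Jn_sub Jn_mult by (auto simp: hom_ideal_def)

lemma rees_cring: "cring (UP R\<lparr>carrier := rees_carrier\<rparr>)"
proof -
  interpret P: UP_cring R "UP R" by unfold_locales
  have "subring rees_carrier (UP R)"
  proof (rule P.P.subringI)
    show "rees_carrier \<subseteq> carrier (UP R)" by (auto simp: rees_carrier_def UP_def)
    have "(if n = 0 then \<one> else \<zero>) \<in> Ip n" for n
      using idl_zero[OF Ip_ideal] by (cases n) (simp_all add: ideal_power_0)
    then show "\<one>\<^bsub>UP R\<^esub> \<in> rees_carrier"
      unfolding rees_carrier_def UP_def using up_one_closed by simp
  next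
    fix a assume a: "a \<in> rees_carrier"
    then have "\<ominus>\<^bsub>UP R\<^esub> a = (\<lambda>n. \<ominus> a n)"
    proof (intro P.P.minus_equality[symmetric, THEN sym])
      show "(\<lambda>n. \<ominus> a n) \<oplus>\<^bsub>UP R\<^esub> a = \<zero>\<^bsub>UP R\<^esub>"
        using a up_a_inv_closed by (auto simp: rees_carrier_def UP_def l_neg mem_upD)
    qed (use a up_a_inv_closed in \<open>auto simp: rees_carrier_def UP_def\<close>)
    then show "\<ominus>\<^bsub>UP R\<^esub> a \<in> rees_carrier"
      using a up_a_inv_closed idl_neg[OF Ip_ideal] by (auto simp: rees_carrier_def)
  next
    fix a b assume ab: "a \<in> rees_carrier" "b \<in> rees_carrier"
    have m: "a i \<otimes> b (n - i) \<in> Ip n" if "i \<le> n" for i n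
      using ab that ideal_power_mult_mem[OF I_ideal, of "a i" i "b (n - i)" "n - i"]
      by (simp add: rees_carrier_def)
    have "(\<Oplus>i\<in>{..n}. a i \<otimes> b (n - i)) \<in> Ip n" for n
      by (rule idl_finsum[OF Ip_ideal]) (use m in auto)
    then show "a \<otimes>\<^bsub>UP R\<^esub> b \<in> rees_carrier"
      using ab up_mult_closed by (simp add: rees_carrier_def UP_def)
    show "a \<oplus>\<^bsub>UP R\<^esub> b \<in> rees_carrier"
      using ab up_add_closed idl_add[OF Ip_ideal] by (auto simp: rees_carrier_def UP_def)
  qed
  then show ?thesis using P.P.subcringI' P.P.subcring_iff subringE(1) by blast
qed

lemma rees_mem: "a \<in> rees_carrier \<Longrightarrow> a n \<in> Ip n"
  by (simp add: rees_carrier_def)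

lemma proj_carrier:
  assumes "a \<in> rees_carrier" shows "proj a \<in> carrier F"
proof -
  interpret J: ideal "Jn n" R for n by (rule Jn_ideal)
  have "proj a n \<in> carrier (R Quot Jn n)" for n
    using Ip_carr[OF rees_mem[OF assms]] by (auto simp: proj_def FactRing_def A_RCOSETS_def')
  moreover have "proj a n \<subseteq> Ip n" for n
    using idl_add[OF Ip_ideal subsetD[OF Jn_sub] rees_mem[OF assms]] by (auto simp: proj_def a_r_coset_def')
  moreover have "finite {n. proj a n \<noteq> Jn n}"
  proof -
    obtain k where k: "bound \<zero> k a" using assms by (auto simp: rees_carrier_def)
    have "proj a n = Jn n" if "k < n" for n
      using bound.bound[OF k that] J.a_rcos_const[OF J.zero_closed] by (simp add: proj_def)
    then have "{n. proj a n \<noteq> Jn n} \<subseteq> {..k}" by (auto simp: not_less[symmetric])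
    then show ?thesis by (rule finite_subset) simp
  qed
  ultimately show ?thesis by (simp add: fiber_cone_def Let_def FactRing_def)
qed

lemma proj_surj: "proj ` rees_carrier = carrier F"
proof
  show "proj ` rees_carrier \<subseteq> carrier F" using proj_carrier by blast
  show "carrier F \<subseteq> proj ` rees_carrier"
  proof
    fix f assume f: "f \<in> carrier F"
    interpret J: ideal "Jn n" R for n by (rule Jn_ideal)
    have fc: "f n \<in> carrier (R Quot Jn n)" "f n \<subseteq> Ip n" and fin: "finite {n. f n \<noteq> Jn n}" for n
      using f by (auto simp: fiber_cone_def Let_def FactRing_def)
    \<comment> \<open>Zero classes are represented by 0, so that the lift has only finitely many
      nonzero coefficients.\<close>
    have "\<exists>a. a \<in> Ip n \<and> f n = Jn n +> a \<and> (f n = Jn n \<longrightarrow> a = \<zero>)" for n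
    proof (cases "f n = Jn n")
      case True
      then show ?thesis using idl_zero[OF Ip_ideal] J.a_rcos_const[OF J.zero_closed] by metis
    next
      case False
      obtain a where a: "a \<in> carrier R" "f n = Jn n +> a"
        using fc(1)[of n] by (auto simp: FactRing_def A_RCOSETS_def')
      then have "a \<in> f n" using J.a_rcos_self by simp
      then show ?thesis using a fc(2)[of n] False by blast
    qed
    then obtain a where a: "\<And>n. a n \<in> Ip n" "\<And>n. f n = Jn n +> a n" "\<And>n. f n = Jn n \<Longrightarrow> a n = \<zero>"
      by metis
    obtain k where k: "\<And>n. f n \<noteq> Jn n \<Longrightarrow> n \<le> k" using finite_nat_set_iff_bounded_le[THEN iffD1, OF fin] by auto
    have "bound \<zero> k a" using a(3) k by (intro bound.intro) (metis leD)
    then have "a \<in> up R" using Ip_carr[OF a(1)] by (intro mem_upI) auto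
    then have "a \<in> rees_carrier" using a(1) by (simp add: rees_carrier_def)
    moreover have "f = proj a" using a(2) by (auto simp: proj_def)
    ultimately show "f \<in> proj ` rees_carrier" by blast
  qed
qed

lemma proj_add:
  assumes "a \<in> rees_carrier" "b \<in> rees_carrier"
  shows "proj (a \<oplus>\<^bsub>UP R\<^esub> b) = proj a \<oplus>\<^bsub>F\<^esub> proj b"
proof -
  interpret J: ideal "Jn n" R for n by (rule Jn_ideal)
  show ?thesis
    using assms Ip_carr[OF rees_mem[OF assms(1)]] Ip_carr[OF rees_mem[OF assms(2)]]
    by (auto simp: proj_def UP_def rees_carrier_def fiber_cone_def Let_def FactRing_def J.a_rcos_sum)
qed

text \<open>Changing \<open>a\<close> and \<open>b\<close> by elements \<open>x\<close> and
  \<open>y\<close> of their moduli changes the product by \<open>b'x + ay\<close>, which lies in the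
  modulus of degree \<open>i + j\<close>. Hence all cosets in the union defining
  \<open>rcoset_mult\<close> are equal.\<close>

lemma rcoset_mult_proj:
  assumes "a \<in> Ip i" "b \<in> Ip j"
  shows "rcoset_mult R (Jn (i + j)) (Jn i +> a) (Jn j +> b) = Jn (i + j) +> (a \<otimes> b)"
proof -
  interpret J: ideal "Jn n" R for n by (rule Jn_ideal)
  have c: "a \<in> carrier R" "b \<in> carrier R" using assms Ip_carr by auto
  have "Jn (i + j) +> (a' \<otimes> b') = Jn (i + j) +> (a \<otimes> b)"
    if "a' \<in> Jn i +> a" "b' \<in> Jn j +> b" for a' b'
  proof -
    obtain x y where x: "x \<in> Jn i" "a' = x \<oplus> a" and y: "y \<in> Jn j" "b' = y \<oplus> b"
      using \<open>a' \<in> Jn i +> a\<close> \<open>b' \<in> Jn j +> b\<close> by (auto simp: a_r_coset_def')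
    have c': "x \<in> carrier R" "y \<in> carrier R" using x y J.a_Hcarr by auto
    have b': "b' \<in> Ip j" unfolding y(2) using y(1) Jn_sub assms by (blast intro: idl_add[OF Ip_ideal])
    have "b' \<otimes> x \<in> Jn (i + j)" using Jn_mult[OF b' x(1)] by (simp add: add.commute)
    moreover have "a \<otimes> y \<in> Jn (i + j)" by (rule Jn_mult[OF assms(1) y(1)])
    ultimately have "b' \<otimes> x \<oplus> a \<otimes> y \<in> Jn (i + j)" by (rule idl_add[OF Jn_ideal])
    moreover have "a' \<otimes> b' = (b' \<otimes> x \<oplus> a \<otimes> y) \<oplus> a \<otimes> b"
      unfolding x(2) y(2) using c c' by algebra
    ultimately have "a' \<otimes> b' \<in> Jn (i + j) +> (a \<otimes> b)" by (auto simp: a_r_coset_def')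
    then show ?thesis by (rule J.a_repr_independence'[symmetric]) (use c in simp)
  qed
  moreover have "a \<in> Jn i +> a" "b \<in> Jn j +> b" using J.a_rcos_self c by auto
  ultimately show ?thesis unfolding rcoset_mult_def by blast
qed

lemma proj_mult:
  assumes "a \<in> rees_carrier" "b \<in> rees_carrier"
  shows "proj (a \<otimes>\<^bsub>UP R\<^esub> b) = proj a \<otimes>\<^bsub>F\<^esub> proj b"
proof
  fix n
  interpret J: ideal "Jn n" R by (rule Jn_ideal)
  interpret h: ring_hom_cring R "R Quot Jn n" "(+>) (Jn n)"
    by (rule J.rcos_ring_hom_cring[OF is_cring])
  have m: "a i \<otimes> b (n - i) \<in> carrier R" for i
    using Ip_carr[OF rees_mem[OF assms(1)]] Ip_carr[OF rees_mem[OF assms(2)]] by simp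
  have "proj (a \<otimes>\<^bsub>UP R\<^esub> b) n = Jn n +> (\<Oplus>i\<in>{..n}. a i \<otimes> b (n - i))"
    using assms by (simp add: proj_def UP_def rees_carrier_def)
  also have "\<dots> = (\<Oplus>\<^bsub>R Quot Jn n\<^esub>i\<in>{..n}. Jn n +> (a i \<otimes> b (n - i)))"
    using m by (subst h.hom_finsum) (auto simp: o_def)
  also have "\<dots> = (\<Oplus>\<^bsub>R Quot Jn n\<^esub>i\<in>{..n}. rcoset_mult R (Jn n) (proj a i) (proj b (n - i)))"
  proof (rule h.S.finsum_cong')
    have eq: "Jn n +> (a i \<otimes> b (n - i)) = rcoset_mult R (Jn n) (proj a i) (proj b (n - i))"
      if "i \<in> {..n}" for i
      using rcoset_mult_proj[OF rees_mem[OF assms(1)] rees_mem[OF assms(2)], of i "n - i"] that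
      by (simp add: proj_def)
    then show "\<And>i. i \<in> {..n} \<Longrightarrow>
      Jn n +> (a i \<otimes> b (n - i)) = rcoset_mult R (Jn n) (proj a i) (proj b (n - i))" .
    show "(\<lambda>i. rcoset_mult R (Jn n) (proj a i) (proj b (n - i))) \<in> {..n} \<rightarrow> carrier (R Quot Jn n)"
    proof
      fix i assume "i \<in> {..n}"
      from eq[OF this] h.hom_closed[OF m, of i]
      show "rcoset_mult R (Jn n) (proj a i) (proj b (n - i)) \<in> carrier (R Quot Jn n)" by simp
    qed
  qed simp
  finally show "proj (a \<otimes>\<^bsub>UP R\<^esub> b) n = (proj a \<otimes>\<^bsub>F\<^esub> proj b) n"
    by (simp add: fiber_cone_def Let_def)
qed

lemma proj_one: "proj \<one>\<^bsub>UP R\<^esub> = \<one>\<^bsub>F\<^esub>" and proj_zero: "proj \<zero>\<^bsub>UP R\<^esub> = \<zero>\<^bsub>F\<^esub>"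
proof -
  interpret J: ideal "Jn n" R for n by (rule Jn_ideal)
  have z: "Jn n +> \<zero> = Jn n" for n by (rule J.a_rcos_const[OF J.zero_closed])
  show "proj \<one>\<^bsub>UP R\<^esub> = \<one>\<^bsub>F\<^esub>"
  proof
    fix n show "proj \<one>\<^bsub>UP R\<^esub> n = \<one>\<^bsub>F\<^esub> n"
      using z[of n] by (cases n) (simp_all add: proj_def UP_def fiber_cone_def Let_def FactRing_def)
  qed
  show "proj \<zero>\<^bsub>UP R\<^esub> = \<zero>\<^bsub>F\<^esub>"
  proof
    fix n show "proj \<zero>\<^bsub>UP R\<^esub> n = \<zero>\<^bsub>F\<^esub> n"
      using z[of n] by (simp add: proj_def UP_def fiber_cone_def Let_def FactRing_def)
  qed
qed

lemma fiber_cone_cring: "cring F"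
  by (rule cring_surj[OF rees_cring, of proj])
    (use proj_carrier proj_mult proj_add proj_one proj_zero proj_surj in
      \<open>auto intro!: ring_hom_memI\<close>)

definition fiber_ideal :: "(nat \<Rightarrow> 'a set) \<Rightarrow> (nat \<Rightarrow> 'a set) set" where
  "fiber_ideal p = {f \<in> carrier F. \<forall>n. f n \<subseteq> p n}"

lemma proj_mem_iff:
  assumes "hom_ideal R I p" "(\<lambda>n. Jn n) \<le> p" "a \<in> rees_carrier"
  shows "proj a \<in> fiber_ideal p \<longleftrightarrow> (\<forall>n. a n \<in> p n)"
proof -
  interpret J: ideal "Jn n" R for n by (rule Jn_ideal)
  have "Jn n +> a n \<subseteq> p n \<longleftrightarrow> a n \<in> p n" for n
  proof
    assume "Jn n +> a n \<subseteq> p n"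
    then show "a n \<in> p n" using J.a_rcos_self[OF Ip_carr[OF rees_mem[OF assms(3)]]] by blast
  next
    assume "a n \<in> p n"
    moreover have "Jn n \<subseteq> p n" using assms(2) by (simp add: le_fun_def)
    ultimately show "Jn n +> a n \<subseteq> p n"
      using idl_add[OF hom_idealD(1)[OF assms(1)] subsetD[OF \<open>Jn n \<subseteq> p n\<close>]] by (auto simp: a_r_coset_def')
  qed
  then show ?thesis using proj_carrier[OF assms(3)] by (simp add: fiber_ideal_def proj_def)
qed

text \<open>If neither \<open>a\<close> nor \<open>b\<close> lies in \<open>p\<close>, let
  \<open>m\<close> and \<open>n\<close> be the lowest degrees in which they leave it. In degree
  \<open>m + n\<close> of the product, every term other than \<open>a m \<otimes> b n\<close> lies
  in \<open>p\<close>.\<close>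

lemma fiber_prime:
  assumes p: "hom_prime R I p" and Kp: "(\<lambda>n. Jn n) \<le> p"
  shows "primeideal (fiber_ideal p) F"
proof -
  interpret F: cring F by (rule fiber_cone_cring)
  interpret UPR: UP_cring R "UP R" by unfold_locales
  note hp = hom_primeD(1)[OF p]
  note mem = proj_mem_iff[OF hp Kp]
  note pI = hom_idealD[OF hp]
  have rep: "\<exists>a\<in>rees_carrier. f = proj a" if "f \<in> carrier F" for f using that proj_surj by blast
  interpret S: cring "UP R\<lparr>carrier := rees_carrier\<rparr>" by (rule rees_cring)
  have Scl: "a \<oplus>\<^bsub>UP R\<^esub> b \<in> rees_carrier" "a \<otimes>\<^bsub>UP R\<^esub> b \<in> rees_carrier" "\<one>\<^bsub>UP R\<^esub> \<in> rees_carrier"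
    "\<zero>\<^bsub>UP R\<^esub> \<in> rees_carrier" if "a \<in> rees_carrier" "b \<in> rees_carrier" for a b
    using S.a_closed[of a b] S.m_closed[of a b] S.one_closed S.zero_closed that by auto
  have add: "(a \<oplus>\<^bsub>UP R\<^esub> b) n = a n \<oplus> b n" and mult: "(a \<otimes>\<^bsub>UP R\<^esub> b) n = (\<Oplus>i\<in>{..n}. a i \<otimes> b (n - i))"
    if "a \<in> rees_carrier" "b \<in> rees_carrier" for a b n
    using that by (auto simp: UP_def rees_carrier_def)
  have sub: "fiber_ideal p \<subseteq> carrier F" by (auto simp: fiber_ideal_def)
  have zero: "\<zero>\<^bsub>F\<^esub> \<in> fiber_ideal p"
    using mem[of "\<zero>\<^bsub>UP R\<^esub>"] S.zero_closed idl_zero[OF pI(1)] by (simp add: proj_zero[symmetric] UP_def)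
  have id: "ideal (fiber_ideal p) F"
  proof (rule F.cring_idealI[OF sub zero])
    fix f g assume fg: "f \<in> fiber_ideal p" "g \<in> fiber_ideal p"
    obtain a where a: "a \<in> rees_carrier" "f = proj a" using rep[of f] fg(1) sub by auto
    obtain b where b: "b \<in> rees_carrier" "g = proj b" using rep[of g] fg(2) sub by auto
    note ab = a(1) b(1) a(2) b(2)
    have "\<forall>n. a n \<in> p n" "\<forall>n. b n \<in> p n" using fg mem ab by auto
    then have "\<forall>n. (a \<oplus>\<^bsub>UP R\<^esub> b) n \<in> p n" using add[OF ab(1,2)] idl_add[OF pI(1)] by simp
    then show "f \<oplus>\<^bsub>F\<^esub> g \<in> fiber_ideal p"
      using mem[OF Scl(1)[OF ab(1,2)]] proj_add[OF ab(1,2)] ab by simp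
  next
    fix f g assume f: "f \<in> carrier F" and g: "g \<in> fiber_ideal p"
    obtain a where a: "a \<in> rees_carrier" "f = proj a" using rep[OF f] by auto
    obtain b where b: "b \<in> rees_carrier" "g = proj b" using rep[of g] g sub by auto
    note ab = a(1) b(1) a(2) b(2)
    have b: "b n \<in> p n" for n using g mem ab by auto
    have "a i \<otimes> b (n - i) \<in> p n" if "i \<le> n" for i n
      using pI(3)[OF rees_mem[OF ab(1)] b, of i "n - i"] that by simp
    then have "\<forall>n. (a \<otimes>\<^bsub>UP R\<^esub> b) n \<in> p n"
      unfolding mult[OF ab(1,2)] by (auto intro!: idl_finsum[OF pI(1)])
    then show "f \<otimes>\<^bsub>F\<^esub> g \<in> fiber_ideal p"
      using mem[OF Scl(2)[OF ab(1,2)]] proj_mult[OF ab(1,2)] ab by simp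
  qed
  show ?thesis
  proof (rule primeidealI[OF id fiber_cone_cring])
    have "\<one> \<notin> p 0" using hom_primeD(2)[OF p] ideal.one_imp_carrier[OF pI(1)] by blast
    moreover have "(\<one>\<^bsub>UP R\<^esub>) 0 = \<one>" by (simp add: UP_def)
    moreover have "\<one>\<^bsub>UP R\<^esub> \<in> rees_carrier" using S.one_closed by simp
    ultimately have "\<one>\<^bsub>F\<^esub> \<notin> fiber_ideal p"
      unfolding proj_one[symmetric] using mem by metis
    then show "carrier F \<noteq> fiber_ideal p" using F.one_closed by blast
  next
    fix f g assume f: "f \<in> carrier F" and g: "g \<in> carrier F" and fg: "f \<otimes>\<^bsub>F\<^esub> g \<in> fiber_ideal p"
    obtain a where a: "a \<in> rees_carrier" "f = proj a" using rep[OF f] by auto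
    obtain b where b: "b \<in> rees_carrier" "g = proj b" using rep[OF g] by auto
    note ab = a(1) b(1) a(2) b(2)
    show "f \<in> fiber_ideal p \<or> g \<in> fiber_ideal p"
    proof (rule ccontr)
      assume "\<not> ?thesis"
      then obtain m0 n0 where mn0: "a m0 \<notin> p m0" "b n0 \<notin> p n0" using mem ab by auto
      have "\<exists>m. a m \<notin> p m \<and> (\<forall>i<m. \<not> a i \<notin> p i)"
        using mn0(1) by (subst exists_least_iff[symmetric]) (rule exI)
      then obtain m where m: "a m \<notin> p m" "\<And>i. i < m \<Longrightarrow> a i \<in> p i" by blast
      have "\<exists>n. b n \<notin> p n \<and> (\<forall>i<n. \<not> b i \<notin> p i)"
        using mn0(2) by (subst exists_least_iff[symmetric]) (rule exI)
      then obtain n where n: "b n \<notin> p n" "\<And>i. i < n \<Longrightarrow> b i \<in> p i" by blast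
      let ?t = "\<lambda>i. a i \<otimes> b (m + n - i)"
      have tc: "?t i \<in> carrier R" for i
        using Ip_carr[OF rees_mem[OF ab(1)]] Ip_carr[OF rees_mem[OF ab(2)]] by simp
      have other: "?t i \<in> p (m + n)" if "i \<in> {..m + n} - {m}" for i
      proof (cases "i < m")
        case True
        have "b (m + n - i) \<otimes> a i \<in> p (m + n - i + i)"
          by (rule pI(3)[OF rees_mem[OF ab(2)] m(2)[OF True]])
        then show ?thesis
          using that Ip_carr[OF rees_mem[OF ab(1)]] Ip_carr[OF rees_mem[OF ab(2)]] m_comm by simp
      next
        case False
        then have "m + n - i < n" using that by auto
        then have "a i \<otimes> b (m + n - i) \<in> p (i + (m + n - i))"
          by (intro pI(3)[OF rees_mem[OF ab(1)]] n(2))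
        then show ?thesis using that by simp
      qed
      have "proj (a \<otimes>\<^bsub>UP R\<^esub> b) \<in> fiber_ideal p" using fg ab proj_mult by simp
      then have "(\<Oplus>i\<in>{..m + n}. ?t i) \<in> p (m + n)"
        using mem[OF Scl(2)[OF ab(1,2)]] mult[OF ab(1,2)] by simp
      also have "{..m + n} = insert m ({..m + n} - {m})" by auto
      also have "(\<Oplus>i\<in>insert m ({..m + n} - {m}). ?t i) = ?t m \<oplus> (\<Oplus>i\<in>{..m + n} - {m}. ?t i)"
        using tc tc[of m] by (intro finsum_insert) auto
      also have "\<dots> = (\<Oplus>i\<in>{..m + n} - {m}. ?t i) \<oplus> ?t m"
        using tc tc[of m] by (intro a_comm finsum_closed) auto
      finally have sum: "(\<Oplus>i\<in>{..m + n} - {m}. ?t i) \<oplus> ?t m \<in> p (m + n)" .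
      have "(\<Oplus>i\<in>{..m + n} - {m}. ?t i) \<in> p (m + n)" by (rule idl_finsum[OF pI(1) _ other]) auto
      then have "?t m \<in> p (m + n)" by (rule idl_add_cancel[OF pI(1) _ tc sum])
      then have "a m \<otimes> b n \<in> p (m + n)" by simp
      then show False using hom_primeD(3)[OF p rees_mem[OF ab(1)] rees_mem[OF ab(2)]] m n by blast
    qed
  qed
qed

lemma fiber_ideal_strict:
  assumes p: "hom_ideal R I p" "(\<lambda>n. Jn n) \<le> p" and q: "hom_ideal R I q" and pq: "p < q"
  shows "fiber_ideal p \<subset> fiber_ideal q"
proof -
  have le: "p n \<subseteq> q n" for n using pq by (simp add: less_le le_fun_def)
  have "p \<noteq> q" using pq by simp
  then obtain d where "p d \<noteq> q d" by (auto simp: fun_eq_iff)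
  then obtain c where c: "c \<in> q d" "c \<notin> p d" using le by blast
  let ?a = "\<lambda>n. if n = d then c else \<zero>"
  have a: "?a \<in> rees_carrier"
    using subsetD[OF hom_idealD(2)[OF q] c(1)] idl_carr[OF hom_idealD(1)[OF q] c(1)] idl_zero[OF Ip_ideal]
    by (auto simp: rees_carrier_def intro!: mem_upI exI[of _ d] bound.intro)
  have Kq: "(\<lambda>n. Jn n) \<le> q" using p(2) pq by (meson less_le order_trans)
  have "proj ?a \<in> fiber_ideal q"
    using proj_mem_iff[OF q Kq a] c(1) idl_zero[OF hom_idealD(1)[OF q]] by simp
  moreover have "proj ?a \<notin> fiber_ideal p" using proj_mem_iff[OF p a] c(2) by auto
  moreover have "fiber_ideal p \<subseteq> fiber_ideal q" using le by (auto simp: fiber_ideal_def)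
  ultimately show ?thesis by blast
qed

section \<open>Chains of homogeneous primes and generic elements\<close>

definition hom_chain :: "nat \<Rightarrow> (nat \<Rightarrow> nat \<Rightarrow> 'a set) \<Rightarrow> bool" where
  "hom_chain k C \<longleftrightarrow> (\<forall>j\<le>k. hom_prime R I (C j) \<and> (\<lambda>n. Jn n) \<le> C j) \<and> (\<forall>j<k. C j < C (Suc j))"

lemma hom_chain_krull_dim:
  assumes "hom_chain k C" shows "enat k \<le> analytic_spread R \<mm> I"
proof -
  have C: "hom_prime R I (C j)" "(\<lambda>n. Jn n) \<le> C j" if "j \<le> k" for j
    using assms that by (auto simp: hom_chain_def)
  have "strict_chain {P. primeideal P F} k (\<lambda>j. fiber_ideal (C j))"
    unfolding strict_chain_def
  proof (intro conjI allI impI)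
    fix i assume "i < k"
    then show "fiber_ideal (C i) \<subset> fiber_ideal (C (Suc i))"
      using assms C[of i] C[of "Suc i"]
      by (intro fiber_ideal_strict hom_primeD(1)) (auto simp: hom_chain_def)
  qed (use fiber_prime C in simp)
  then show ?thesis
    unfolding analytic_spread_def krull_dim_def chain_length_altdef by (auto intro: Sup_upper)
qed

lemma hom_chain_extend:
  assumes "hom_chain k C" "hom_prime R I p" "C k < p"
  shows "hom_chain (Suc k) (C(Suc k := p))"
proof -
  have "(\<lambda>n. Jn n) \<le> C k" using assms(1) by (simp add: hom_chain_def)
  then have "(\<lambda>n. Jn n) \<le> p" using less_imp_le[OF assms(3)] by (rule order_trans)
  then show ?thesis using assms by (auto simp: hom_chain_def le_Suc_eq less_Suc_eq)
qed

text \<open>Let \<open>v\<close> avoid all the ideals but \<open>V0\<close>, and let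
  \<open>u \<in> I\<close> lie outside \<open>V0\<close>. Among the elements \<open>v + cu\<close>,
  with \<open>c\<close> from infinitely many residue classes, two in the same \<open>V\<close> would
  give \<open>(c - d)u \<in> V\<close> with \<open>c - d\<close> a unit; then \<open>u\<close> and
  hence \<open>v\<close> would lie in \<open>V\<close>.\<close>

lemma avoid_ideals:
  assumes inf: "infinite (carrier (R Quot \<mm>))" and "finite \<V>"
    and "\<And>V. V \<in> \<V> \<Longrightarrow> ideal V R \<and> \<not> I \<subseteq> V"
  shows "\<exists>y\<in>I. \<forall>V\<in>\<V>. y \<notin> V"
  using assms(2,3)
proof (induct \<V>)
  case empty
  then show ?case using idl_zero[OF I_ideal] by auto
next
  case (insert V0 \<V>)
  then obtain v where v: "v \<in> I" "\<And>V. V \<in> \<V> \<Longrightarrow> v \<notin> V" by auto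
  obtain u where u: "u \<in> I" "u \<notin> V0" using insert(4)[of V0] by blast
  have uv: "u \<in> carrier R" "v \<in> carrier R" using u v I_ideal idl_carr by auto
  have cancel: "u \<in> V" if V: "ideal V R" and c: "c \<in> carrier R" "c \<notin> \<mm>" "c \<otimes> u \<in> V" for V c
  proof -
    obtain b where b: "b \<in> carrier R" "b \<otimes> c = \<one>" using unit_outside_mm[OF c(1,2)] by blast
    have "b \<otimes> (c \<otimes> u) = u" using b c uv by (simp add: m_assoc[symmetric])
    then show ?thesis using idl_l[OF V c(3) b(1)] by simp
  qed
  show ?case
  proof (cases "v \<in> V0")
    case False
    then show ?thesis using v by auto
  next
    case True
    interpret M: ideal \<mm> R by (rule mm_ideal)
    have "\<exists>c\<in>carrier R - \<mm>. \<forall>V\<in>\<V>. v \<oplus> c \<otimes> u \<notin> V"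
    proof (rule ccontr)
      assume "\<not> ?thesis"
      then obtain g where g: "\<And>c. c \<in> carrier R - \<mm> \<Longrightarrow> g c \<in> \<V> \<and> v \<oplus> c \<otimes> u \<in> g c" by metis
      \<comment> \<open>Nonzero residue classes only: \<open>c\<close> must be a unit for
        \<open>v + cu\<close> to avoid \<open>V0\<close> as well, which contains \<open>v\<close>
        but not \<open>u\<close>.\<close>
      let ?A = "carrier (R Quot \<mm>) - {\<mm>}"
      have "\<exists>c. c \<in> carrier R \<and> Y = \<mm> +> c" if "Y \<in> carrier (R Quot \<mm>)" for Y
        using that by (auto simp: FactRing_def A_RCOSETS_def')
      then obtain r where r: "\<And>Y. Y \<in> carrier (R Quot \<mm>) \<Longrightarrow> r Y \<in> carrier R \<and> Y = \<mm> +> r Y" by metis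
      have rA: "r Y \<in> carrier R - \<mm>" if "Y \<in> ?A" for Y using r[of Y] that M.a_rcos_const by auto
      have "infinite ?A" using inf by simp
      moreover have "finite ((\<lambda>Y. g (r Y)) ` ?A)"
        by (rule finite_subset[OF _ insert(1)]) (use g rA in blast)
      ultimately obtain Y0 where "infinite {Y \<in> ?A. g (r Y) = g (r Y0)}" "Y0 \<in> ?A"
        using pigeonhole_infinite[of ?A "\<lambda>Y. g (r Y)"] by blast
      then have "infinite ({Y \<in> ?A. g (r Y) = g (r Y0)} - {Y0})" by simp
      then obtain Y1 where Y1: "Y1 \<in> ?A" "g (r Y1) = g (r Y0)" "Y1 \<noteq> Y0"
        using infinite_imp_nonempty by blast
      let ?V = "g (r Y0)" and ?c = "r Y0" and ?d = "r Y1"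
      have V: "?V \<in> \<V>" "v \<oplus> ?c \<otimes> u \<in> ?V" "v \<oplus> ?d \<otimes> u \<in> ?V"
        using g[OF rA[OF \<open>Y0 \<in> ?A\<close>]] g[OF rA[OF Y1(1)]] Y1(2) by auto
      have iV: "ideal ?V R" using insert(4)[of ?V] V(1) by simp
      have cd: "?c \<in> carrier R" "?d \<in> carrier R" using rA \<open>Y0 \<in> ?A\<close> Y1(1) by auto
      have "?c \<ominus> ?d \<notin> \<mm>"
        using quotient_eq_iff_same_a_r_cos[OF mm_ideal cd] r[of Y0] r[of Y1] \<open>Y0 \<in> ?A\<close> Y1 by auto
      moreover have "(?c \<ominus> ?d) \<otimes> u = (v \<oplus> ?c \<otimes> u) \<ominus> (v \<oplus> ?d \<otimes> u)" using cd uv by algebra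
      then have "(?c \<ominus> ?d) \<otimes> u \<in> ?V" using idl_minus[OF iV V(2,3)] by simp
      ultimately have "u \<in> ?V" using cancel[OF iV, of "?c \<ominus> ?d"] cd by simp
      then have cu: "?c \<otimes> u \<in> ?V" using idl_l[OF iV] cd by blast
      have "v \<in> ?V"
        by (rule idl_add_cancel[OF iV cu uv(2)]) (use V(2) cd uv a_comm in simp)
      then show False using v(2) V(1) by blast
    qed
    then obtain c where c: "c \<in> carrier R" "c \<notin> \<mm>" "\<And>V. V \<in> \<V> \<Longrightarrow> v \<oplus> c \<otimes> u \<notin> V" by auto
    have "v \<oplus> c \<otimes> u \<notin> V0"
    proof
      assume "v \<oplus> c \<otimes> u \<in> V0"
      moreover have i0: "ideal V0 R" using insert(4)[of V0] by simp
      moreover have "c \<otimes> u \<in> carrier R" using c(1) uv(1) by simp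
      ultimately have "c \<otimes> u \<in> V0" using idl_add_cancel[OF i0 True] by simp
      then have "u \<in> V0" by (rule cancel[OF i0 c(1,2)])
      then show False using u(2) by simp
    qed
    moreover have "v \<oplus> c \<otimes> u \<in> I" using u v c by (intro idl_add[OF I_ideal] idl_l[OF I_ideal])
    ultimately show ?thesis using c(3) by auto
  qed
qed

text \<open>A maximal \<open>W\<close> with \<open>V \<subseteq> W \<subset> U + V\<close> has a
  simple quotient \<open>(U + V) / W\<close>, which \<open>\<mm>\<close> annihilates. So
  \<open>\<mm>U + V \<subseteq> W\<close>, and \<open>U\<close> would lie in
  \<open>W\<close>.\<close>

lemma nakayama:
  assumes U: "ideal U R" and V: "ideal V R" and UV: "U \<subseteq> \<mm> \<cdot> U <+> V"
  shows "U \<subseteq> V"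
proof (rule ccontr)
  assume nUV: "\<not> U \<subseteq> V"
  define T where "T = U <+> V"
  have T: "ideal T R" "U \<subseteq> T" "V \<subseteq> T"
    unfolding T_def using U V add_ideals set_add_l set_add_r by auto
  let ?F = "{W. ideal W R \<and> V \<subseteq> W \<and> W \<subseteq> T \<and> W \<noteq> T}"
  have "V \<in> ?F" using V T nUV by auto
  then have "?F \<noteq> {}" by blast
  then obtain W where W: "W \<in> ?F" and max: "\<And>K. K \<in> ?F \<Longrightarrow> \<not> W \<subset> K"
    by (rule ideal_maximal_element) (simp, rule that)
  have iW: "ideal W R" "V \<subseteq> W" "W \<subseteq> T" "W \<noteq> T" using W by auto
  obtain u where u: "u \<in> T" "u \<notin> W" using iW by blast
  have uc: "u \<in> carrier R" using u T idl_carr by blast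
  have dich: "W <+> PIdl t = T \<or> t \<in> W" if t: "t \<in> T" for t
  proof (rule ccontr)
    assume neg: "\<not> ?thesis"
    have tc: "t \<in> carrier R" using t T idl_carr by blast
    note P = cgenideal_ideal[OF tc]
    have "W <+> PIdl t \<subseteq> T" using iW cgenideal_minimal[OF T(1) t] by (intro set_add_least[OF T(1)])
    then have "W <+> PIdl t \<in> ?F" using neg add_ideals[OF iW(1) P] set_add_l[OF iW(1) P] iW(2) by auto
    moreover have "W \<subset> W <+> PIdl t"
      using neg set_add_l[OF iW(1) P] set_add_r[OF iW(1) P] cgenideal_self[OF tc] by auto
    ultimately show False using max by blast
  qed
  have Tu: "T = W <+> PIdl u" using dich[OF u(1)] u(2) by simp
  have mu: "c \<otimes> u \<in> W" if c: "c \<in> \<mm>" for c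
  proof (rule ccontr)
    assume neg: "c \<otimes> u \<notin> W"
    have cc: "c \<in> carrier R" using c mm_ideal idl_carr by blast
    have "W <+> PIdl (c \<otimes> u) = T" using dich[of "c \<otimes> u"] neg idl_l[OF T(1) u(1) cc] by blast
    then obtain w a where w: "w \<in> W" "a \<in> carrier R" "u = w \<oplus> a \<otimes> (c \<otimes> u)"
      using u(1) by (auto simp: set_add_mem cgenideal_def)
    have wc: "w \<in> carrier R" using w iW idl_carr by blast
    \<comment> \<open>From \<open>u = w + acu\<close> follows \<open>(1 - ac)u = w \<in> W\<close>,
      and \<open>1 - ac\<close> is a unit because \<open>c \<in> \<mm>\<close>.\<close>
    let ?d = "\<one> \<ominus> a \<otimes> c"
    have "?d \<notin> \<mm>"
    proof
      assume "?d \<in> \<mm>"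
      then have "?d \<oplus> a \<otimes> c \<in> \<mm>" using idl_l[OF mm_ideal c w(2)] by (intro idl_add[OF mm_ideal])
      moreover have "?d \<oplus> a \<otimes> c = \<one>" using w cc by algebra
      ultimately show False using ideal.one_imp_carrier[OF mm_ideal] mm_proper by simp
    qed
    then obtain b where b: "b \<in> carrier R" "b \<otimes> ?d = \<one>" using unit_outside_mm[of ?d] w cc by auto
    have "?d \<otimes> u = u \<ominus> a \<otimes> (c \<otimes> u)" using w cc uc by algebra
    also have "\<dots> = (w \<oplus> a \<otimes> (c \<otimes> u)) \<ominus> a \<otimes> (c \<otimes> u)" using w(3) by simp
    also have "\<dots> = w" using wc w(2) cc uc by algebra
    finally have "b \<otimes> (?d \<otimes> u) \<in> W" using idl_l[OF iW(1) w(1) b(1)] by simp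
    moreover have "b \<otimes> (?d \<otimes> u) = u" using b w cc uc by (simp add: m_assoc[symmetric])
    ultimately show False using u by simp
  qed
  have "\<mm> \<cdot> U \<subseteq> W"
  proof (rule ideal_prod_least[OF iW(1)])
    fix c y assume c: "c \<in> \<mm>" and y: "y \<in> U"
    then have "y \<in> W <+> PIdl u" using T(2) Tu by blast
    then obtain w a where w: "w \<in> W" "a \<in> carrier R" "y = w \<oplus> a \<otimes> u"
      by (auto simp: set_add_mem cgenideal_def)
    have cc: "c \<in> carrier R" "w \<in> carrier R" using c mm_ideal w(1) iW(1) idl_carr by auto
    have "c \<otimes> y = c \<otimes> w \<oplus> a \<otimes> (c \<otimes> u)" unfolding w(3) using cc w(2) uc by algebra
    then show "c \<otimes> y \<in> W" using idl_add[OF iW(1)] idl_l[OF iW(1)] mu[OF c] w cc by simp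
  qed
  then have "U \<subseteq> W" using UV set_add_least[OF iW(1) _ iW(2)] by blast
  then have "T \<subseteq> W" unfolding T_def using iW by (intro set_add_least)
  then show False using iW by blast
qed

primrec hom_gen :: "(nat \<Rightarrow> 'a) \<Rightarrow> nat \<Rightarrow> nat \<Rightarrow> 'a set" where
  "hom_gen x 0 = (\<lambda>n. Jn n)"
| "hom_gen x (Suc i) = hom_add R I (hom_gen x i) 1 (x i)"

lemma hom_gen_ideal:
  "(\<And>j. j < i \<Longrightarrow> x j \<in> I) \<Longrightarrow> hom_ideal R I (hom_gen x i) \<and> (\<lambda>n. Jn n) \<le> hom_gen x i"
proof (induct i)
  case (Suc i)
  have "x i \<in> Ip 1" using Suc(2) ideal_power_1[OF I_ideal] by simp
  then show ?case using Suc hom_ideal_add[of "hom_gen x i" "x i" 1] by (auto simp: le_fun_def) blast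
qed (simp add: hom_ideal_Jn)

lemma hom_gen_cong: "(\<And>j. j < i \<Longrightarrow> x j = y j) \<Longrightarrow> hom_gen x i = hom_gen y i"
  by (induct i) auto

text \<open>Returns from graded components to ideals of \<open>R\<close>, in the form that
  Nakayama's lemma requires.\<close>

lemma hom_gen_sub:
  "(\<And>j. j < i \<Longrightarrow> x j \<in> I) \<Longrightarrow> hom_gen x i n \<subseteq> Jn n <+> Idl (x ` {..<i})"
proof (induct i)
  case 0
  then show ?case using set_add_l[OF Jn_ideal genideal_ideal[of "{}"]] by simp
next
  case (Suc i)
  have xc: "x ` {..<Suc i} \<subseteq> carrier R" using Suc(2) I_ideal idl_carr by auto
  note G = genideal_ideal[OF xc] and GS = genideal_self[OF xc]
  have "Idl (x ` {..<i}) \<subseteq> Idl (x ` {..<Suc i})" by (rule subset_Idl_subset[OF xc]) auto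
  then have 1: "hom_gen x i n \<subseteq> Jn n <+> Idl (x ` {..<Suc i})"
    using Suc set_add_mono[OF subset_refl, of _ _ "Jn n"] by (meson less_SucI subset_trans)
  have "x i \<in> Idl (x ` {..<Suc i})" using GS by auto
  then have "(\<otimes>) (x i) ` Ip k \<subseteq> Jn n <+> Idl (x ` {..<Suc i})" for k
    using set_add_r[OF Jn_ideal G] idl_r[OF G] Ip_carr by blast
  then have "hom_gen x i n <+> (\<otimes>) (x i) ` Ip (n - 1) \<subseteq> Jn n <+> Idl (x ` {..<Suc i})"
    by (rule set_add_least[OF add_ideals[OF Jn_ideal G] 1])
  then show ?case using 1 by (cases "n < 1") (simp_all add: hom_add_def)
qed

text \<open>
  Generic elements of \<open>I\<close>: each one avoids the finitely many minimal primes, not containing \<open>I\<close>, of the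
  homogeneous ideal generated by \<open>\<mm>\<close> and the previous ones.
\<close>

lemma generic_elements:
  assumes inf: "infinite (carrier (R Quot \<mm>))"
  shows "\<exists>x. (\<forall>j<i. x j \<in> I) \<and> (\<forall>p. hom_prime R I p \<longrightarrow> hom_gen x i \<le> p \<longrightarrow> \<not> I \<subseteq> p 1 \<longrightarrow>
    (\<exists>C. hom_chain i C \<and> C i = p))"
proof (induct i)
  case 0
  have "\<exists>C. hom_chain 0 C \<and> C 0 = p" if "hom_prime R I p" "(\<lambda>n. Jn n) \<le> p" for p
    using that by (intro exI[of _ "\<lambda>_. p"]) (simp add: hom_chain_def)
  then show ?case by simp
next
  case (Suc i)
  then obtain x where x: "\<And>j. j < i \<Longrightarrow> x j \<in> I"
    and chain: "\<And>p. hom_prime R I p \<Longrightarrow> hom_gen x i \<le> p \<Longrightarrow> \<not> I \<subseteq> p 1 \<Longrightarrow> \<exists>C. hom_chain i C \<and> C i = p"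
    by blast
  have G: "hom_ideal R I (hom_gen x i)" using hom_gen_ideal x by blast
  obtain \<P> where P: "finite \<P>" "\<And>p. p \<in> \<P> \<Longrightarrow> hom_prime R I p \<and> hom_gen x i \<le> p"
    "\<And>p. hom_prime R I p \<Longrightarrow> hom_gen x i \<le> p \<Longrightarrow> \<exists>q\<in>\<P>. q \<le> p"
    using finite_hom_primes[OF G] by blast
  have "\<exists>y\<in>I. \<forall>V\<in>(\<lambda>p. p 1) ` {p \<in> \<P>. \<not> I \<subseteq> p 1}. y \<notin> V"
  proof (rule avoid_ideals[OF inf])
    show "finite ((\<lambda>p. p 1) ` {p \<in> \<P>. \<not> I \<subseteq> p 1})" using P(1) by simp
    fix V assume "V \<in> (\<lambda>p. p 1) ` {p \<in> \<P>. \<not> I \<subseteq> p 1}"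
    then obtain p where p: "p \<in> \<P>" "V = p 1" "\<not> I \<subseteq> V" by auto
    then have "hom_ideal R I p" using P(2) hom_primeD(1) by blast
    then show "ideal V R \<and> \<not> I \<subseteq> V" using hom_idealD(1) p by simp
  qed
  then obtain y where y: "y \<in> I" "\<And>p. p \<in> \<P> \<Longrightarrow> \<not> I \<subseteq> p 1 \<Longrightarrow> y \<notin> p 1" by auto
  let ?x = "x(i := y)"
  have gen: "hom_gen ?x i = hom_gen x i" by (rule hom_gen_cong) simp
  have yI: "y \<in> Ip 1" using y ideal_power_1[OF I_ideal] by simp
  have "\<exists>C. hom_chain (Suc i) C \<and> C (Suc i) = p"
    if p: "hom_prime R I p" "hom_gen ?x (Suc i) \<le> p" "\<not> I \<subseteq> p 1" for p
  proof -
    have le: "hom_gen x i n \<subseteq> p n" "hom_add R I (hom_gen x i) 1 y n \<subseteq> p n" for n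
      using p(2) hom_ideal_add(2)[OF G yI, of n] by (auto simp: gen le_fun_def)
    then have "y \<in> p 1" using hom_ideal_add(3)[OF G yI] by blast
    \<comment> \<open>\<open>q \<le> p\<close> omits part of \<open>I\<close> because
      \<open>p\<close> does, so \<open>y \<notin> q 1\<close>, whereas \<open>y \<in> p 1\<close>.
      Hence \<open>q < p\<close>, and \<open>p\<close> prolongs the chain ending in
      \<open>q\<close>.\<close>
    obtain q where q: "q \<in> \<P>" "q \<le> p" using P(3)[OF p(1)] le(1) by (auto simp: le_fun_def)
    then have nq: "\<not> I \<subseteq> q 1" using p(3) by (auto simp: le_fun_def)
    then have "q \<noteq> p" using y(2)[OF q(1)] \<open>y \<in> p 1\<close> by auto
    then have "q < p" using q(2) by simp
    obtain C where C: "hom_chain i C" "C i = q" using chain[of q] P(2)[OF q(1)] nq by blast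
    then have "hom_chain (Suc i) (C(Suc i := p))" using hom_chain_extend[OF C(1) p(1)] \<open>q < p\<close> by simp
    then show ?thesis by (intro exI[of _ "C(Suc i := p)"]) simp
  qed
  moreover have "\<forall>j<Suc i. ?x j \<in> I" using x y(1) by (simp add: less_Suc_eq)
  ultimately show ?case by blast
qed

text \<open>The largest homogeneous prime of the Rees algebra; it prolongs every chain of primes
  whose top omits part of \<open>I\<close>.\<close>

lemma hom_prime_irrelevant:
  assumes "I \<subseteq> \<mm>"
  shows "hom_prime R I (\<lambda>n. if n = 0 then \<mm> else Ip n)"
proof -
  have prime: "primeideal \<mm> R" by (rule maximalideal_prime[OF maximalideal_mm])
  show ?thesis
    unfolding hom_prime_def hom_ideal_def
  proof (intro conjI allI ballI impI)
    fix m n a b assume "a \<in> Ip m" "b \<in> Ip n" "a \<otimes> b \<in> (if m + n = 0 then \<mm> else Ip (m + n))"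
    then show "a \<in> (if m = 0 then \<mm> else Ip m) \<or> b \<in> (if n = 0 then \<mm> else Ip n)"
      using primeideal.I_prime[OF prime, of a b] Ip_carr by (auto split: if_splits)
  next
    fix m n a h assume a: "a \<in> Ip m" and h: "h \<in> (if n = 0 then \<mm> else Ip n)"
    have "h \<in> Ip n" using h idl_carr[OF mm_ideal] by (auto simp: ideal_power_0 split: if_splits)
    then show "a \<otimes> h \<in> (if m + n = 0 then \<mm> else Ip (m + n))"
      using ideal_power_mult_mem[OF I_ideal a] h idl_l[OF mm_ideal _ Ip_carr[OF a]] by auto
  qed (use mm_ideal Ip_ideal mm_proper idl_carr[OF mm_ideal] in \<open>auto simp: ideal_power_0\<close>)
qed

lemma reduction_exists:
  assumes inf: "infinite (carrier (R Quot \<mm>))" and I: "I \<noteq> carrier R"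
    and s: "analytic_spread R \<mm> I = enat s"
  shows "\<exists>x N. (\<forall>j<s. x j \<in> I) \<and> Ip N \<subseteq> Idl (x ` {..<s})"
proof -
  have Im: "I \<subseteq> \<mm>" by (rule proper_ideal_sub_mm[OF I_ideal I])
  let ?M = "\<lambda>n. if n = 0 then \<mm> else Ip n"
  note M = hom_prime_irrelevant[OF Im]
  obtain x where x: "\<And>j. j < s \<Longrightarrow> x j \<in> I"
    and chain: "\<And>p. hom_prime R I p \<Longrightarrow> hom_gen x s \<le> p \<Longrightarrow> \<not> I \<subseteq> p 1 \<Longrightarrow> \<exists>C. hom_chain s C \<and> C s = p"
    using generic_elements[OF inf, of s] by blast
  have "I \<subseteq> p 1" if p: "hom_prime R I p" "hom_gen x s \<le> p" for p
  proof (rule ccontr)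
    assume nI: "\<not> I \<subseteq> p 1"
    then obtain C where C: "hom_chain s C" "C s = p" using chain[OF p] by blast
    note hp = hom_primeD(1)[OF p(1)]
    have "p \<le> ?M"
      using hom_idealD(2)[OF hp] proper_ideal_sub_mm[OF hom_idealD(1)[OF hp] hom_primeD(2)[OF p(1)]]
      by (auto simp: le_fun_def)
    moreover have "p \<noteq> ?M" using nI ideal_power_1[OF I_ideal] by auto
    \<comment> \<open>A chain of length \<open>s + 1\<close> exceeds the analytic spread.\<close>
    ultimately have "hom_chain (Suc s) (C(Suc s := ?M))"
      using hom_chain_extend[OF C(1) M] C(2) by simp
    then have "enat (Suc s) \<le> enat s" using hom_chain_krull_dim s by metis
    then show False by simp
  qed
  then obtain N where N: "Ip N \<subseteq> hom_gen x s N" using irrelevant_power hom_gen_ideal x by blast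
  have xc: "x ` {..<s} \<subseteq> carrier R" using x I_ideal idl_carr by auto
  have "Ip N \<subseteq> Idl (x ` {..<s})"
    by (rule nakayama[OF Ip_ideal genideal_ideal[OF xc]]) (use N hom_gen_sub[of s x] x in blast)
  then show ?thesis using x by blast
qed

end

section \<open>Equimultiple coefficient ideals\<close>

lemma (in localization_at) saturation_finite:
  assumes J: "ideal J R" and "finite G" "\<And>g. g \<in> G \<Longrightarrow> g \<in> saturation R P J"
  shows "\<exists>u\<in>S. \<forall>g\<in>G. u \<otimes> g \<in> J"
  using assms(2,3)
proof (induct G)
  case empty
  then show ?case using one_S by blast
next
  case (insert g G)
  then obtain u where u: "u \<in> S" "\<forall>h\<in>G. u \<otimes> h \<in> J" by blast
  have sat: "\<And>h. h \<in> insert g G \<Longrightarrow> h \<in> saturation R P J" by (rule insert(4))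
  then obtain v where v: "g \<in> carrier R" "v \<in> S" "v \<otimes> g \<in> J" by (auto simp: saturation_def)
  have "(u \<otimes> v) \<otimes> h \<in> J" if h: "h \<in> insert g G" for h
  proof -
    have hc: "h \<in> carrier R" using sat[OF h] by (simp add: saturation_def)
    show ?thesis
    proof (cases "h = g")
      case True
      then show ?thesis using u v idl_l[OF J v(3), of u] by (simp add: m_assoc)
    next
      case False
      then have "u \<otimes> h \<in> J" using h u by blast
      then have "v \<otimes> (u \<otimes> h) \<in> J" using v by (rule_tac idl_l[OF J]) auto
      then show ?thesis using u v hc by (simp add: m_ac)
    qed
  qed
  then show ?case using mult_S[OF u(1) v(2)] by blast
qed

text \<open>
  If \<open>L\<close> has the same Hilbert polynomial as \<open>I\<close> at \<open>P\<close>, then \<open>L_P^n\<close> and \<open>I_P^n\<close> have the same colength, hence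
  are equal, for large \<open>n\<close>; so \<open>L_P I_P^n \<subseteq> I_P^(n+1)\<close>, that is, \<open>L_P\<close> lies in the Ratliff--Rush closure of \<open>I_P\<close>.
\<close>

lemma (in localization_at) eventually_eq_power_imp_saturation:
  assumes I: "ideal I R" and L: "ideal L R"
    and eq: "\<forall>\<^sub>F n in sequentially. ideal_power Loc (ext I) n = ideal_power Loc (ext L) n"
    and colon: "\<And>n. n \<ge> 1 \<Longrightarrow> ideal_colon R (ideal_power R I (n + 1)) (ideal_power R I n) \<subseteq> K"
  shows "L \<subseteq> saturation R P K"
proof
  fix l assume l: "l \<in> L"
  have lc: "l \<in> carrier R" using l L idl_carr by blast
  obtain N where N: "\<And>n. n \<ge> N \<Longrightarrow> ideal_power Loc (ext I) n = ideal_power Loc (ext L) n"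
    using eq by (auto simp: eventually_sequentially)
  \<comment> \<open>A successor, since \<open>colon\<close> covers exponents from 1 on.\<close>
  define n where "n = Suc N"
  note In = ideal_power_ideal[OF I]
  obtain G where G: "G \<subseteq> carrier R" "finite G" "ideal_power R I n = Idl G" using finetely_gen[OF In] by blast
  have sat: "l \<otimes> g \<in> saturation R P (ideal_power R I (Suc n))" if g: "g \<in> G" for g
  proof -
    have gI: "g \<in> ideal_power R I n" using genideal_self[OF G(1)] g G(3) by auto
    have gc: "g \<in> carrier R" using g G by blast
    have "fr g \<one> \<in> ideal_power Loc (ext L) n"
      using ext_memI[OF In gI] ext_power[OF I, of n] N[of n] by (simp add: n_def)
    then have "fr l \<one> \<otimes>\<^bsub>Loc\<^esub> fr g \<one> \<in> ideal_power Loc (ext L) (Suc n)"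
      by (rule L.ideal_power_Suc_mem[OF ext_ideal[OF L] ext_memI[OF L l]])
    also have "\<dots> = ext (ideal_power R I (Suc n))"
      using ext_power[OF I, of "Suc n"] N[of "Suc n"] by (simp add: n_def)
    finally have "fr (l \<otimes> g) \<one> \<in> ext (ideal_power R I (Suc n))" using lc gc one_S by (simp add: fr_mult)
    then show ?thesis using ext_mem_iff[OF In _ one_S] lc gc by simp
  qed
  \<comment> \<open>One \<open>u \<notin> P\<close> serves all generators of \<open>I^n\<close>;
    hence \<open>ul\<close> multiplies \<open>I^n\<close> into \<open>I^(n+1)\<close>.\<close>
  then have "\<exists>u\<in>S. \<forall>h\<in>(\<otimes>) l ` G. u \<otimes> h \<in> ideal_power R I (Suc n)"
    using G(2) by (intro saturation_finite[OF In]) auto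
  then obtain u where u: "u \<in> S" "\<And>g. g \<in> G \<Longrightarrow> u \<otimes> (l \<otimes> g) \<in> ideal_power R I (Suc n)" by blast
  have ulc: "u \<otimes> l \<in> carrier R" using u lc by simp
  have "Idl G \<subseteq> {y \<in> carrier R. (u \<otimes> l) \<otimes> y \<in> ideal_power R I (Suc n)}"
  proof (rule genideal_minimal[OF ideal_colon_elt[OF oneideal In ulc]])
    show "G \<subseteq> {y \<in> carrier R. u \<otimes> l \<otimes> y \<in> ideal_power R I (Suc n)}"
      using u G(1) lc by (auto simp: m_assoc)
  qed
  then have "u \<otimes> l \<in> ideal_colon R (ideal_power R I (n + 1)) (ideal_power R I n)"
    using ulc G(3) by (auto simp: ideal_colon_def)
  then have "u \<otimes> l \<in> K" using colon[of n] by (auto simp: n_def)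
  then show "l \<in> saturation R P K" using u(1) lc by (auto simp: saturation_def)
qed

text \<open>The images of \<open>x\<close> generate an ideal of \<open>R_P\<close> containing a
  power of the maximal ideal. This bounds by \<open>s\<close> both the dimension and, for every
  \<open>L \<supseteq> I\<close>, the degree of the Hilbert function of \<open>L_P\<close>.\<close>

lemma (in noetherian_cring) reduction_localization:
  assumes I: "ideal I R" and P: "P \<in> min_primes R I"
    and xI: "x ` {..<s} \<subseteq> I" and red: "ideal_power R I N \<subseteq> Idl (x ` {..<s})"
    and ht: "ideal_height R I = enat s"
  shows "krull_dim (local_at R P) = enat s"
    and "\<And>L. ideal L R \<Longrightarrow> I \<subseteq> L \<Longrightarrow> (\<forall>n. ilen (local_at R P) (ideal_power (local_at R P) (extend_at R P L) n)
      (carrier (local_at R P)) \<noteq> \<infinity>) \<and>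
      npoly (Suc s) (\<lambda>n. ilen_int (local_at R P) (ideal_power (local_at R P) (extend_at R P L) n)
        (carrier (local_at R P)))"
proof -
  have pP: "primeideal P R" and IP: "I \<subseteq> P" using P by (auto simp: min_primes_def)
  interpret LA: localization_at R P
    by (intro localization_at.intro noetherian_cring_axioms pP)
  interpret LL: noetherian_local_ring LA.Loc "LA.ext P" by (rule LA.Loc_local)
  let ?y = "\<lambda>j. LA.fr (x j) \<one>" and ?G = "Idl (x ` {..<s})"
  have x: "\<And>j. j < s \<Longrightarrow> x j \<in> I" using xI by auto
  have xc: "x ` {..<s} \<subseteq> carrier R" using xI idl_sub[OF I] by (rule subset_trans)
  note G = genideal_ideal[OF xc]
  have yP: "?y j \<in> LA.ext P" if "j < s" for j
    using x[OF that] IP by (intro LA.ext_memI[OF LA.P_ideal]) auto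
  have gen: "LA.ext ?G = Idl\<^bsub>LA.Loc\<^esub> (?y ` {..<s})"
    using LA.ext_genideal[OF xc] by (simp add: image_image)
  obtain k where k: "ideal_power LA.Loc (LA.ext P) k \<subseteq> LA.ext I"
    using LA.ext_power_primary[OF I P] by blast
  \<comment> \<open>In \<open>R_P\<close>, \<open>P^(kN) = (P^k)^N \<subseteq> I^N\<close>, which
    lies in the ideal generated by \<open>x\<close>.\<close>
  have "ideal_power LA.Loc (LA.ext P) (k * N) \<subseteq> ideal_power LA.Loc (LA.ext I) N"
    using LA.L.ideal_power_mono[OF k, of N] LA.L.ideal_power_mult[OF LL.mm_ideal] by simp
  also have "\<dots> \<subseteq> LA.ext ?G"
    using LA.ext_mono[OF red ideal_power_ideal[OF I] G] LA.ext_power[OF I] by simp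
  finally have mk: "ideal_power LA.Loc (LA.ext P) (k * N) \<subseteq> Idl\<^bsub>LA.Loc\<^esub> (?y ` {..<s})"
    unfolding gen .
  have "krull_dim LA.Loc \<le> enat s" by (rule LL.primary_dim_le[OF yP mk])
  moreover have "enat s \<le> prime_height R P"
    unfolding ht[symmetric] ideal_height_def by (rule Inf_lower) (use pP IP in blast)
  then have "enat s \<le> krull_dim LA.Loc" using LA.prime_height_le_krull_dim by (rule order_trans)
  ultimately show "krull_dim LA.Loc = enat s" by (rule antisym)
  fix L assume L: "ideal L R" "I \<subseteq> L"
  have "?G \<subseteq> L" using x L by (intro genideal_minimal) auto
  then have GL: "Idl\<^bsub>LA.Loc\<^esub> (?y ` {..<s}) \<subseteq> LA.ext L"
    unfolding gen[symmetric] by (rule LA.ext_mono[OF _ G L(1)])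
  show "(\<forall>n. ilen LA.Loc (ideal_power LA.Loc (LA.ext L) n) (carrier LA.Loc) \<noteq> \<infinity>) \<and>
      npoly (Suc s) (\<lambda>n. ilen_int LA.Loc (ideal_power LA.Loc (LA.ext L) n) (carrier LA.Loc))"
    by (intro conjI allI LL.ilen_primary_power[OF subset_trans[OF mk GL]]
        LL.primary_npoly[OF yP mk LA.ext_ideal[OF L(1)] GL])
qed

lemma (in noetherian_cring) min_primes_eq_of_power:
  assumes I: "ideal I R" and K: "ideal K R" "I \<subseteq> K" and pow: "ideal_power R K n \<subseteq> I"
  shows "min_primes R K = min_primes R I"
proof -
  have "K \<subseteq> P" if P: "primeideal P R" "I \<subseteq> P" for P
  proof
    fix a assume a: "a \<in> K"
    then have "a [^] n \<in> P" using ideal_pow_mem[OF K(1) a, of n] pow P(2) by blast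
    then show "a \<in> P" using prime_powD[OF P(1)] idl_carr[OF K(1) a] by blast
  qed
  then have eq: "K \<subseteq> P \<longleftrightarrow> I \<subseteq> P" if "primeideal P R" for P
    using that by (intro iffI subset_trans[OF K(2)])
  show ?thesis unfolding min_primes_def by (simp only: eq cong: conj_cong)
qed

theorem proposition2p11:
  fixes R :: "('a, 'b) ring_scheme" (structure)
    and \<mm> I :: "'a set"
    and s :: nat
  assumes "noetherian_local_ring R \<mm>"
    and "quasi_unmixed R \<mm>"
    and "infinite (carrier (R Quot \<mm>))"
    and "krull_dim R \<ge> 1"
    and "equimultiple R \<mm> I"
    and "analytic_spread R \<mm> I = enat s"
    and "\<exists>a \<in> I. regular_element R a"
  shows "coeff_ideal R I s = unmixed_part R (ratliff_rush R I) \<and>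
         unmixed_ideal R (coeff_ideal R I s)"
proof -
  have I: "ideal I R" and nI: "I \<noteq> carrier R" and ht: "ideal_height R I = enat s"
    using assms(5,6) by (auto simp: equimultiple_def)
  interpret noetherian_local_ring R \<mm> by fact
  have RI: "local_ring_ideal R \<mm> I"
    by (intro local_ring_ideal.intro noetherian_cring_ideal.intro noetherian_cring_ideal_axioms.intro
        noetherian_local_ring_axioms noetherian_cring_axioms I)
  from assms(7) obtain a where a: "a \<in> I" "regular_element R a" by (rule bexE)
  define K where "K = ratliff_rush R I"
  note rr = ratliff_rush_closure[OF I a, folded K_def]
  have K: "ideal K R" "I \<subseteq> K" using rr(1,2) by auto
  obtain M where M: "\<And>n. n \<ge> M \<Longrightarrow> ideal_power R K n = ideal_power R I n" using rr(3) by blast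
  have minK: "min_primes R K = min_primes R I"
  proof (rule min_primes_eq_of_power[OF I K])
    \<comment> \<open>A positive exponent: \<open>M\<close> may be 0, and the zeroth power is the
      whole ring.\<close>
    show "ideal_power R K (Suc M) \<subseteq> I"
      using M[of "Suc M"] ideal_power_antimono[OF I, of 1 "Suc M"] ideal_power_1[OF I] by simp
  qed
  define J where "J = unmixed_part R K"
  have J: "ideal J R" "K \<subseteq> J" using unmixed_part_ideal[OF K(1)] by (auto simp: J_def)
  obtain x N where x: "\<And>j. j < s \<Longrightarrow> x j \<in> I" and red: "ideal_power R I N \<subseteq> Idl (x ` {..<s})"
    using local_ring_ideal.reduction_exists[OF RI assms(3) nI assms(6)] by blast
  have xI: "x ` {..<s} \<subseteq> I" using x by auto
  have loc: "localization_at R P" if "P \<in> min_primes R I" for P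
    using that by (intro localization_at.intro noetherian_cring_axioms) (simp add: min_primes_def)
  have "same_coeffs R I s J"
    unfolding same_coeffs_def
  proof (intro conjI ballI)
    show "ideal J R" "I \<subseteq> J" using J K by auto
    fix P assume P: "P \<in> min_primes R I"
    interpret LA: localization_at R P by (rule loc[OF P])
    \<comment> \<open>Elements of \<open>J\<close> lie in the saturation of \<open>K\<close> at
      \<open>P\<close>, so passing to the unmixed part changes nothing in \<open>R_P\<close>, and
      large powers of \<open>J_P\<close> agree with those of \<open>I_P\<close>.\<close>
    have JK: "LA.ext J = LA.ext K"
    proof
      show "LA.ext K \<subseteq> LA.ext J" by (rule LA.ext_mono[OF J(2) K(1) J(1)])
      show "LA.ext J \<subseteq> LA.ext K"
      proof
        fix y assume "y \<in> LA.ext J"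
        then obtain b t where b: "b \<in> J" "t \<in> LA.S" "y = LA.fr b t" unfolding LA.ext_eq[OF J(1)] by blast
        then have "b \<in> carrier R" "b \<in> saturation R P K"
          using P by (auto simp: J_def unmixed_part_eq[OF K(1)] minK)
        then show "y \<in> LA.ext K" using LA.ext_mem_iff[OF K(1)] b by simp
      qed
    qed
    have "K \<subseteq> P" using P minK by (auto simp: min_primes_def)
    then show "LA.ext J \<noteq> carrier LA.Loc"
      unfolding JK using LA.ext_mono[OF _ K(1) LA.P_ideal] LA.ext_P_proper
        LA.L.idl_sub[OF LA.ext_ideal[OF LA.P_ideal]] by blast
    have "hilbert_coeff LA.Loc (LA.ext I) = hilbert_coeff LA.Loc (LA.ext J)"
    proof (rule hilbert_coeff_cong)
      show "\<forall>\<^sub>F n in sequentially. ideal_power LA.Loc (LA.ext I) n = ideal_power LA.Loc (LA.ext J) n"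
        unfolding eventually_sequentially JK LA.ext_power[OF I, symmetric] LA.ext_power[OF K(1), symmetric]
        using M by (intro exI[of _ M]) simp
    qed
    then show "\<forall>i\<le>s. hilbert_coeff LA.Loc (LA.ext I) i = hilbert_coeff LA.Loc (LA.ext J) i" by simp
  qed
  moreover have "L \<subseteq> J" if L: "same_coeffs R I s L" for L
  proof -
    have iL: "ideal L R" "I \<subseteq> L" using L by (auto simp: same_coeffs_def)
    have "L \<subseteq> saturation R P K" if P: "P \<in> min_primes R I" for P
    proof -
      interpret LA: localization_at R P by (rule loc[OF P])
      note dim = reduction_localization(1)[OF I P xI red ht]
      note h = reduction_localization(2)[OF I P xI red ht]
      note hI = h[OF I subset_refl] and hL = h[OF iL]
      note extI = LA.ext_ideal[OF I] and extL = LA.ext_ideal[OF iL(1)]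
      note cI = LA.L.hilbert_coeff_hpoly[OF extI dim] and cL = LA.L.hilbert_coeff_hpoly[OF extL dim]
      \<comment> \<open>As \<open>R_P\<close> has dimension \<open>s\<close>, the coefficients
        compared by \<open>same_coeffs\<close> are all the coefficients of the two
        polynomials.\<close>
      have "hpoly s (hilbert_coeff LA.Loc (LA.ext I)) n = hpoly s (hilbert_coeff LA.Loc (LA.ext L)) n" for n
        using L P by (intro hpoly_cong) (auto simp: same_coeffs_def)
      moreover have "\<forall>\<^sub>F n in sequentially. ilen_int LA.Loc (ideal_power LA.Loc (LA.ext I) n) (carrier LA.Loc) =
          hpoly s (hilbert_coeff LA.Loc (LA.ext I)) n" using cI hI by blast
      moreover have "\<forall>\<^sub>F n in sequentially. ilen_int LA.Loc (ideal_power LA.Loc (LA.ext L) n) (carrier LA.Loc) =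
          hpoly s (hilbert_coeff LA.Loc (LA.ext L)) n" using cL hL by blast
      ultimately have "\<forall>\<^sub>F n in sequentially. ilen_int LA.Loc (ideal_power LA.Loc (LA.ext I) n) (carrier LA.Loc) =
          ilen_int LA.Loc (ideal_power LA.Loc (LA.ext L) n) (carrier LA.Loc)"
        by (auto elim: eventually_elim2)
      then have "\<forall>\<^sub>F n in sequentially. ideal_power LA.Loc (LA.ext I) n = ideal_power LA.Loc (LA.ext L) n"
      proof eventually_elim
        case (elim n)
        show ?case
          by (rule LA.L.ilen_int_eqD[OF LA.L.ideal_power_ideal[OF extI] LA.L.ideal_power_ideal[OF extL]
                LA.L.ideal_power_mono[OF LA.ext_mono[OF iL(2) I iL(1)]] _ elim])
            (use hI in blast)
      qed
      then show ?thesis by (rule LA.eventually_eq_power_imp_saturation[OF I iL(1) _ rr(4)])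
    qed
    then show ?thesis
      using idl_sub[OF iL(1)] unfolding J_def unmixed_part_eq[OF K(1)] minK by blast
  qed
  ultimately have "coeff_ideal R I s = J"
    unfolding coeff_ideal_def by (intro the_equality) (auto intro: antisym)
  then show ?thesis
    using unmixed_unmixed_part[OF K(1)] by (simp add: J_def K_def)
qed

end
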